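(* Let $k$ be a field, $1\le t\le n$, $b=2$, $d=n-t+1$, and let $J_t\subset R$ be the monomial ideal defined in the context, with the variables of $R$ indexed as $z_1,\dots,z_{2n}$ as described there. Let $G(J_t)$ be the minimal monomial generating set of $J_t$, and let $\nu_\ell$ be the number of monomials in $G(J_t)$ whose largest index (i.e. the largest $i$ such that $z_i$ divides the monomial) is $\ell$. Then: (a) For $1\le\ell\le 2d$, $$\nu_\ell=\binom{t+\ell-2}{t-1}.$$ (b) For $2d+1\le\ell\le 2d+t-1$, with $j=\ell-2d$, $$\nu_\ell=\sum_{k=0}^{t-j-1}\binom{n-t+j+k}{k}\binom{n-k-1}{n-t}=\sum_{\tau=1}^{n-t+1}\binom{n+\tau-1}{t-j-1}\binom{n-t+j-\tau}{j-1}=\sum_{\tau=1}^{n-t+1}\binom{n}{t-j-\tau}\binom{n-t+j}{j+\tau-1}.$$ (c) For $q=0,1,\dots,2n-t+1$, $$\beta_q(J_t)=\sum_{\ell=q+1}^{2n-t+1}\binom{\ell-1}{q}\nu_\ell,$$ where $\nu_\ell$ is given in (a) and (b).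
   Context: The ideal $J_t$: let $R=k[x_{ij}:1\le i\le n,\ 1\le j\le 2]$. Let $T_j$ ($j=1,2$) be the $t\times n$ matrix whose entry in row $r$ and column $c$ is $x_{c-r+1,j}$ if $c\ge r$ and $0$ if $c<r$, and let $\mathbf T=[T_1\ T_2]$, a $t\times 2n$ matrix. $J_t$ is the monomial ideal of $R$ generated by the products of the entries of the main diagonals of the $t\times t$ submatrices of $\mathbf T$, i.e. by all nonzero products $\mathbf T_{1,c_1}\mathbf T_{2,c_2}\cdots\mathbf T_{t,c_t}$ with $1\le c_1<c_2<\cdots<c_t\le 2n$. Re-indexing: $z_i=x_{i1}$ for $1\le i\le d$; $z_{d+i}=x_{i2}$ for $1\le i\le d$; $z_{2d+i}=x_{d+i,1}$ for $1\le i\le t-1$. The remaining $t-1$ indeterminates $x_{d+1,2},\dots,x_{n,2}$ do not occur in the minimal generators of $J_t$ and may be given the last indices $2d+t,\dots,2n$. Note that $2d+t-1=2n-t+1$. Conventions: $\binom{\alpha}{\beta}=0$ if $\alpha<\beta$ or $\beta<0$, and $\binom{\alpha}{0}=1$ for $\alpha\ge0$. For a homogeneous ideal $I$, $\beta_q(I)$ is the (total) $q$-th Betti number of $I$ as a module, i.e. the rank of the $q$-th free module in its minimal graded free resolution (so $\beta_0(I)$ is the minimal number of generators). In the sum in (b), $k$ is a summation index, not the field. *)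

theory Defs
  imports
    "HOL-Library.Poly_Mapping"
    "HOL-Algebra.Ideal"
    "Jordan_Normal_Form.Matrix"
begin

section \<open>Polynomial rings over a set of variables\<close>

text \<open>
  Monomials are finitely supported exponent functions; the product of polynomials is the
  convolution product of \<^typ>\<open>'a \<Rightarrow>\<^sub>0 'b\<close>.
\<close>

type_synonym 'v monom = "'v \<Rightarrow>\<^sub>0 nat"
type_synonym ('v, 'k) mpoly = "'v monom \<Rightarrow>\<^sub>0 'k"

definition monomial :: "'v monom \<Rightarrow> ('v, 'k::field) mpoly" where
  "monomial m = Poly_Mapping.single m 1"

definition var :: "'v \<Rightarrow> ('v, 'k::field) mpoly" where
  "var v = monomial (Poly_Mapping.single v 1)"

text \<open>The polynomial ring over \<^typ>\<open>'k\<close> whose indeterminates are the elements of \<open>V\<close>.\<close>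

definition poly_ring :: "'v set \<Rightarrow> (('v, 'k::field) mpoly) ring" where
  "poly_ring V = \<lparr>carrier = {p. \<forall>m \<in> Poly_Mapping.keys p. Poly_Mapping.keys m \<subseteq> V},
     monoid.mult = (*), one = 1, zero = 0, add = (+)\<rparr>"

definition monom_degree :: "'v monom \<Rightarrow> nat" where
  "monom_degree m = (\<Sum>v \<in> Poly_Mapping.keys m. Poly_Mapping.lookup m v)"

definition homogeneous :: "int \<Rightarrow> ('v, 'k::field) mpoly \<Rightarrow> bool" where
  "homogeneous e p \<longleftrightarrow> (\<forall>m \<in> Poly_Mapping.keys p. int (monom_degree m) = e)"

definition minimal_monomial_generating_set ::
    "'v set \<Rightarrow> ('v, 'k::field) mpoly set \<Rightarrow> 'v monom set \<Rightarrow> bool" where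
  "minimal_monomial_generating_set V I M \<longleftrightarrow>
     M \<subseteq> {m. Poly_Mapping.keys m \<subseteq> V} \<and>
     genideal (poly_ring V) (monomial ` M) = I \<and>
     (\<forall>M'. M' \<subset> M \<longrightarrow> genideal (poly_ring V) (monomial ` M') \<noteq> I)"

definition min_monomial_gens :: "'v set \<Rightarrow> ('v, 'k::field) mpoly set \<Rightarrow> 'v monom set" where
  "min_monomial_gens V I = (THE M. minimal_monomial_generating_set V I M)"


section \<open>Minimal graded free resolutions and Betti numbers\<close>

definition free_module :: "'v set \<Rightarrow> nat \<Rightarrow> ('v, 'k::field) mpoly vec set" where
  "free_module V r = {v \<in> carrier_vec r. set\<^sub>v v \<subseteq> carrier (poly_ring V)}"

text \<open>
  A graded free resolution
  \<open>\<dots> \<rightarrow> F\<^sub>2 \<rightarrow> F\<^sub>1 \<rightarrow> F\<^sub>0 \<rightarrow> I \<rightarrow> 0\<close> of the ideal \<open>I\<close>, regarded as a module over the polynomial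
  ring \<open>R\<close> in the variables \<open>V\<close>. The module \<open>F\<^sub>q\<close> is the direct sum of the \<open>R(-a q i)\<close> for
  \<open>i < rk q\<close>, the matrix \<open>D q\<close> (acting on column vectors) gives the map
  \<open>F\<^bsub>q+1\<^esub> \<rightarrow> F\<^sub>q\<close>, and the augmentation \<open>F\<^sub>0 \<rightarrow> I\<close> sends the \<open>i\<close>-th basis vector to the
  \<open>i\<close>-th entry of \<open>g\<close>. All these maps preserve degrees.
\<close>

definition graded_free_resolution ::
    "'v set \<Rightarrow> ('v, 'k::field) mpoly set \<Rightarrow> (nat \<Rightarrow> nat) \<Rightarrow> (nat \<Rightarrow> nat \<Rightarrow> int) \<Rightarrow>
     ('v, 'k) mpoly vec \<Rightarrow> (nat \<Rightarrow> ('v, 'k) mpoly mat) \<Rightarrow> bool" where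
  "graded_free_resolution V I rk a g D \<longleftrightarrow>
     g \<in> free_module V (rk 0) \<and>
     (\<forall>i < rk 0. homogeneous (a 0 i) (g $ i)) \<and>
     (\<forall>q. D q \<in> carrier_mat (rk q) (rk (Suc q)) \<and>
          elements_mat (D q) \<subseteq> carrier (poly_ring V) \<and>
          (\<forall>i < rk q. \<forall>j < rk (Suc q). homogeneous (a (Suc q) j - a q i) (D q $$ (i, j)))) \<and>
     {g \<bullet> v | v. v \<in> free_module V (rk 0)} = I \<and>
     {v \<in> free_module V (rk 0). g \<bullet> v = 0} = {D 0 *\<^sub>v w | w. w \<in> free_module V (rk 1)} \<and>
     (\<forall>q. {v \<in> free_module V (rk (Suc q)). D q *\<^sub>v v = 0\<^sub>v (rk q)} =
          {D (Suc q) *\<^sub>v w | w. w \<in> free_module V (rk (Suc (Suc q)))})"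

text \<open>
  Minimality: the image of each \<open>F\<^bsub>q+1\<^esub> \<rightarrow> F\<^sub>q\<close> lies in \<open>\<mm> F\<^sub>q\<close>, where \<open>\<mm>\<close> is the ideal
  generated by the indeterminates.
\<close>

definition minimal_graded_free_resolution ::
    "'v set \<Rightarrow> ('v, 'k::field) mpoly set \<Rightarrow> (nat \<Rightarrow> nat) \<Rightarrow> (nat \<Rightarrow> nat \<Rightarrow> int) \<Rightarrow>
     ('v, 'k) mpoly vec \<Rightarrow> (nat \<Rightarrow> ('v, 'k) mpoly mat) \<Rightarrow> bool" where
  "minimal_graded_free_resolution V I rk a g D \<longleftrightarrow>
     graded_free_resolution V I rk a g D \<and>
     (\<forall>q. elements_mat (D q) \<subseteq> genideal (poly_ring V) (var ` V))"

definition betti :: "'v set \<Rightarrow> ('v, 'k::field) mpoly set \<Rightarrow> nat \<Rightarrow> nat" where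
  "betti V I q =
     (THE b. \<exists>rk a g D. minimal_graded_free_resolution V I rk a g D \<and> rk q = b)"


section \<open>The ideal \<open>J\<^sub>t\<close> for \<open>b = 2\<close>\<close>

text \<open>The pair \<open>(i, j)\<close> stands for the indeterminate \<open>x\<^bsub>ij\<^esub>\<close>; indices start at 1.\<close>

definition vars :: "nat \<Rightarrow> (nat \<times> nat) set" where
  "vars n = {1..n} \<times> {1..2}"

definition T_block :: "nat \<Rightarrow> nat \<Rightarrow> nat \<Rightarrow> (nat \<times> nat, 'k::field) mpoly" where
  "T_block j r c = (if r \<le> c then var (c - r + 1, j) else 0)"

definition T_matrix :: "nat \<Rightarrow> nat \<Rightarrow> nat \<Rightarrow> (nat \<times> nat, 'k::field) mpoly" where
  "T_matrix n r c = (if c \<le> n then T_block 1 r c else T_block 2 r (c - n))"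

definition diagonal_products :: "nat \<Rightarrow> nat \<Rightarrow> (nat \<times> nat, 'k::field) mpoly set" where
  "diagonal_products n t =
     {(\<Prod>r = 1..t. T_matrix n r (c r)) | c :: nat \<Rightarrow> nat.
        strict_mono_on {1..t} c \<and> c ` {1..t} \<subseteq> {1..2 * n}} - {0}"

definition J_ideal :: "nat \<Rightarrow> nat \<Rightarrow> (nat \<times> nat, 'k::field) mpoly set" where
  "J_ideal n t = genideal (poly_ring (vars n)) (diagonal_products n t)"

text \<open>
  The indeterminate \<open>z\<^sub>i\<close> for \<open>1 \<le> i \<le> 2n\<close>. With \<open>d = n - t + 1\<close>, the last two cases are
  \<open>z\<^bsub>2d+i\<^esub> = x\<^bsub>d+i,1\<^esub>\<close> and \<open>z\<^bsub>2d+t-1+i\<^esub> = x\<^bsub>d+i,2\<^esub>\<close> for \<open>1 \<le> i \<le> t - 1\<close>.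
\<close>

definition z_var :: "nat \<Rightarrow> nat \<Rightarrow> nat \<Rightarrow> nat \<times> nat" where
  "z_var n t i =
     (let d = n - t + 1 in
      if i \<le> d then (i, 1)
      else if i \<le> 2 * d then (i - d, 2)
      else if i \<le> 2 * d + t - 1 then (i - d, 1)
      else (i - n, 2))"

definition largest_index :: "nat \<Rightarrow> nat \<Rightarrow> (nat \<times> nat) monom \<Rightarrow> nat \<Rightarrow> bool" where
  "largest_index n t m l \<longleftrightarrow>
     (let S = {i \<in> {1..2 * n}. Poly_Mapping.lookup m (z_var n t i) > 0}
      in l \<in> S \<and> (\<forall>i \<in> S. i \<le> l))"

definition num_max_index :: "nat \<Rightarrow> nat \<Rightarrow> (nat \<times> nat, 'k::field) mpoly set \<Rightarrow> nat \<Rightarrow> nat" where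
  "num_max_index n t I l = card {m \<in> min_monomial_gens (vars n) I. largest_index n t m l}"


section \<open>Binomial coefficients\<close>

text \<open>
  Integer arguments: the lower index may become negative in the sums, where truncated
  subtraction would turn the intended value 0 into 1.
\<close>

definition binom :: "int \<Rightarrow> int \<Rightarrow> nat" where
  "binom a b = (if b < 0 \<or> a < b then 0 else nat a choose nat b)"

end

theory Submission
  imports Defs "Jordan_Normal_Form.Determinant"
begin

text \<open>
  In the order \<open>z\<^sub>1, z\<^sub>2, \<dots>\<close> of the indeterminates, \<open>J\<^sub>t\<close> is generated by a stable set of
  monomials of degree \<open>t\<close>: \<open>u\<close> is a generator iff each \<open>x\<^bsub>i2\<^esub>\<close> dividing it has \<open>i \<le> d\<close> and each
  \<open>x\<^bsub>i1\<^esub>\<close> dividing it has \<open>i \<le> d + e\<close>, where \<open>e\<close> is the degree of \<open>u\<close> in the \<open>x\<^bsub>i2\<^esub>\<close>; replacing the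
  last indeterminate of \<open>u\<close> by an earlier one preserves this. In lexicographically decreasing
  order the generators have linear quotients: the generators preceding \<open>u\<close> have colon ideal
  \<open>(z\<^sub>1, \<dots>, z\<^bsub>m-1\<^esub>)\<close> with \<open>u\<close>, where \<open>m\<close> is the largest index of \<open>u\<close>. Iterated mapping cones
  over Koszul complexes therefore give a linear, hence minimal, resolution in which \<open>u\<close> contributes
  \<open>m - 1\<close> choose \<open>q\<close> to the rank in degree \<open>q\<close>. Minimal resolutions have unique ranks, because
  composing comparison maps in both directions gives the identity modulo the indeterminates. The
  numbers \<open>\<nu>\<^sub>l\<close> are obtained by sorting the generators according to \<open>e\<close>, and the three sums in (b) are
  identified through Vandermonde's convolution.
\<close>

section \<open>Exact complexes over a subring of coefficients\<close>

text \<open>The indeterminates form a set \<open>V\<close>, not a type, so the ring is a subset of a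
  polynomial type; linear algebra is done with matrices over the type, and membership of the entries
  is carried along. Every resolution is augmented by the ring itself: position 0 has rank 1 and the
  image of \<open>D 0\<close> is the ideal. Adding a generator then becomes a cone over a map of
  cyclic modules R/L to R/I, and the Betti number of index q sits at position q + 1.
  \<open>betti\<close> is a definite description, so its value needs both a minimal resolution and
  uniqueness of ranks. The obstacle in the cone is that comparison maps exist only by choice, and a
  nonzero constant term in them would destroy minimality. Discarding all but the homogeneous part of
  the expected degree keeps the squares commutative and leaves linear entries. For uniqueness,
  minimality enters through the constant term map, which kills every differential beyond
  \<open>D 0\<close>.\<close>

lemma mult_mat_unit_vec:
  fixes A :: "'a::semiring_1 mat"
  assumes "A \<in> carrier_mat r s" "j < s"
  shows "A *\<^sub>v unit_vec s j = col A j"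
  using assms by (intro eq_vecI) auto

locale coeff_subring =
  fixes C :: "'a::comm_ring_1 set"
  assumes zero_closed [simp, intro]: "0 \<in> C"
    and one_closed [simp, intro]: "1 \<in> C"
    and add_closed [simp, intro]: "x \<in> C \<Longrightarrow> y \<in> C \<Longrightarrow> x + y \<in> C"
    and mult_closed [simp, intro]: "x \<in> C \<Longrightarrow> y \<in> C \<Longrightarrow> x * y \<in> C"
    and uminus_closed [simp, intro]: "x \<in> C \<Longrightarrow> - x \<in> C"
begin

lemma sum_closed: "(\<And>i. i \<in> I \<Longrightarrow> f i \<in> C) \<Longrightarrow> sum f I \<in> C"
  by (induction I rule: infinite_finite_induct) auto

definition cmat :: "nat \<Rightarrow> nat \<Rightarrow> 'a mat set" where
  "cmat r s = {A \<in> carrier_mat r s. elements_mat A \<subseteq> C}"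

definition cvec :: "nat \<Rightarrow> 'a vec set" where
  "cvec r = {v \<in> carrier_vec r. set\<^sub>v v \<subseteq> C}"

lemma cmat_iff: "A \<in> cmat r s \<longleftrightarrow> A \<in> carrier_mat r s \<and> (\<forall>i<r. \<forall>j<s. A $$ (i, j) \<in> C)"
  unfolding cmat_def elements_mat_def by fastforce

lemma cvec_iff: "v \<in> cvec r \<longleftrightarrow> v \<in> carrier_vec r \<and> (\<forall>i<r. v $ i \<in> C)"
  unfolding cvec_def vec_set_def by auto

lemma cmat_carrier [dest]: "A \<in> cmat r s \<Longrightarrow> A \<in> carrier_mat r s"
  by (simp add: cmat_iff)

lemma cvec_carrier [dest]: "v \<in> cvec r \<Longrightarrow> v \<in> carrier_vec r"
  by (simp add: cvec_iff)

lemma zero_cmat [simp]: "0\<^sub>m r s \<in> cmat r s"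
  and one_cmat [simp]: "1\<^sub>m r \<in> cmat r r"
  by (auto simp: cmat_iff)

lemma unit_cvec [simp]: "unit_vec r i \<in> cvec r"
  by (auto simp: cvec_iff unit_vec_def)

lemma cmat_uminus: "A \<in> cmat r s \<Longrightarrow> - A \<in> cmat r s"
  by (auto simp: cmat_iff)

lemma cmat_minus: "A \<in> cmat r s \<Longrightarrow> B \<in> cmat r s \<Longrightarrow> A - B \<in> cmat r s"
  by (auto simp: cmat_iff simp del: add_uminus_conv_diff simp: add_uminus_conv_diff[symmetric])

lemma cmat_mult: "A \<in> cmat r s \<Longrightarrow> B \<in> cmat s u \<Longrightarrow> A * B \<in> cmat r u"
  by (auto simp: cmat_iff scalar_prod_def intro!: sum_closed)

lemma cmat_mult_vec: "A \<in> cmat r s \<Longrightarrow> v \<in> cvec s \<Longrightarrow> A *\<^sub>v v \<in> cvec r"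
  by (auto simp: cmat_iff cvec_iff scalar_prod_def intro!: sum_closed)

lemma cvec_add: "v \<in> cvec r \<Longrightarrow> w \<in> cvec r \<Longrightarrow> v + w \<in> cvec r"
  and cvec_uminus: "v \<in> cvec r \<Longrightarrow> - v \<in> cvec r"
  by (auto simp: cvec_iff)

lemma cvec_append: "v \<in> cvec r \<Longrightarrow> w \<in> cvec s \<Longrightarrow> v @\<^sub>v w \<in> cvec (r + s)"
  by (auto simp: cvec_iff)

lemma cvec_split:
  assumes "x \<in> cvec (r + s)"
  obtains v w where "v \<in> cvec r" "w \<in> cvec s" "x = v @\<^sub>v w"
proof
  show "vec_first x r \<in> cvec r" "vec_last x s \<in> cvec s"
    using assms by (auto simp: cvec_iff vec_first_def vec_last_def)
  show "x = vec_first x r @\<^sub>v vec_last x s"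
    using assms by (simp add: cvec_iff)
qed

lemma col_cvec: "A \<in> cmat r s \<Longrightarrow> j < s \<Longrightarrow> col A j \<in> cvec r"
  by (auto simp: cmat_iff cvec_iff)

text \<open>Projectivity of free modules in matrix form: preimages of the columns of
  \<open>B\<close>, chosen one at a time, are the columns of \<open>A\<close>.\<close>

lemma cmat_col_image:
  assumes D: "D \<in> cmat r s" and B: "B \<in> cmat r n"
    and img: "\<And>j. j < n \<Longrightarrow> \<exists>w \<in> cvec s. col B j = D *\<^sub>v w"
  obtains A where "A \<in> cmat s n" "B = D * A"
proof -
  obtain w where w: "\<And>j. j < n \<Longrightarrow> w j \<in> cvec s \<and> col B j = D *\<^sub>v w j"
    using img by metis
  define A where "A = mat s n (\<lambda>(i, j). w j $ i)"
  have A: "A \<in> cmat s n"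
    using w by (auto simp: A_def cmat_iff cvec_iff)
  have colA: "col A j = w j" if "j < n" for j
    using w[OF that] that by (intro eq_vecI) (auto simp: A_def cvec_iff)
  have "B = D * A"
  proof (rule mat_col_eqI)
    show "col B j = col (D * A) j" if "j < dim_col (D * A)" for j
    proof -
      have j: "j < n" using that A by (auto simp: cmat_iff)
      show ?thesis
        using w[OF j] colA[OF j] col_mult2[OF cmat_carrier[OF D] cmat_carrier[OF A] j] by simp
    qed
  qed (use D A B in \<open>auto simp: cmat_iff\<close>)
  with A that show thesis by blast
qed

text \<open>Exactness is demanded at positions 1, 2, ... only, so the complex resolves the cokernel
  of \<open>D 0\<close>.\<close>

definition exact_complex :: "(nat \<Rightarrow> nat) \<Rightarrow> (nat \<Rightarrow> 'a mat) \<Rightarrow> bool" where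
  "exact_complex r D \<longleftrightarrow>
     (\<forall>q. D q \<in> cmat (r q) (r (Suc q))) \<and>
     (\<forall>q. {v \<in> cvec (r (Suc q)). D q *\<^sub>v v = 0\<^sub>v (r q)} =
          {D (Suc q) *\<^sub>v w | w. w \<in> cvec (r (Suc (Suc q)))})"

lemma exact_complex_cmat: "exact_complex r D \<Longrightarrow> D q \<in> cmat (r q) (r (Suc q))"
  by (simp add: exact_complex_def)

lemma exact_complex_kernel:
  assumes "exact_complex r D" "v \<in> cvec (r (Suc q))" "D q *\<^sub>v v = 0\<^sub>v (r q)"
  obtains w where "w \<in> cvec (r (Suc (Suc q)))" "v = D (Suc q) *\<^sub>v w"
  using assms unfolding exact_complex_def by blast

lemma exact_complex_image:
  assumes "exact_complex r D" "w \<in> cvec (r (Suc (Suc q)))"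
  shows "D q *\<^sub>v (D (Suc q) *\<^sub>v w) = 0\<^sub>v (r q)"
  using assms unfolding exact_complex_def by blast

lemma exact_complex_mult:
  assumes "exact_complex r D"
  shows "D q * D (Suc q) = 0\<^sub>m (r q) (r (Suc (Suc q)))"
proof (rule mat_col_eqI)
  note c = cmat_carrier[OF exact_complex_cmat[OF assms]]
  fix j assume "j < dim_col (0\<^sub>m (r q) (r (Suc (Suc q))))"
  then have j: "j < r (Suc (Suc q))" by simp
  have "col (D q * D (Suc q)) j = D q *\<^sub>v col (D (Suc q)) j"
    by (rule col_mult2[OF c c j])
  also have "col (D (Suc q)) j = D (Suc q) *\<^sub>v unit_vec (r (Suc (Suc q))) j"
    by (rule mult_mat_unit_vec[OF c j, symmetric])
  also have "D q *\<^sub>v \<dots> = 0\<^sub>v (r q)"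
    by (rule exact_complex_image[OF assms]) simp
  finally show "col (D q * D (Suc q)) j = col (0\<^sub>m (r q) (r (Suc (Suc q)))) j"
    using j by simp
qed (use exact_complex_cmat[OF assms] in \<open>auto simp: cmat_iff\<close>)

lemma exact_complex_factor:
  assumes ex: "exact_complex r D" and B: "B \<in> cmat (r (Suc q)) n"
    and z: "D q * B = 0\<^sub>m (r q) n"
  obtains A where "A \<in> cmat (r (Suc (Suc q))) n" "B = D (Suc q) * A"
proof (rule cmat_col_image[OF exact_complex_cmat[OF ex] B])
  note c = cmat_carrier[OF exact_complex_cmat[OF ex]]
  fix j assume j: "j < n"
  have "D q *\<^sub>v col B j = col (D q * B) j"
    using col_mult2[OF c cmat_carrier[OF B] j] by simp
  also have "\<dots> = 0\<^sub>v (r q)" using z j by simp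
  finally show "\<exists>w \<in> cvec (r (Suc (Suc q))). col B j = D (Suc q) *\<^sub>v w"
    using exact_complex_kernel[OF ex col_cvec[OF B j]] by metis
qed blast

text \<open>The comparison theorem. \<open>img\<close> says that \<open>A0\<close> induces a map
  from the cokernel of \<open>E 0\<close> to that of \<open>D 0\<close>; it replaces exactness at
  position 0, and all later squares come from \<open>exact_complex_factor\<close>.\<close>

lemma chain_map_lift:
  assumes D: "exact_complex r D" and E: "exact_complex s E"
    and A0: "A0 \<in> cmat (r 0) (s 0)"
    and img: "\<And>w. w \<in> cvec (s 1) \<Longrightarrow> \<exists>v \<in> cvec (r 1). A0 *\<^sub>v (E 0 *\<^sub>v w) = D 0 *\<^sub>v v"
  obtains A where "A 0 = A0" "\<And>q. A q \<in> cmat (r q) (s q)"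
    "\<And>q. D q * A (Suc q) = A q * E q"
proof -
  note Dc = exact_complex_cmat[OF D] and Ec = exact_complex_cmat[OF E]
  note c = cmat_carrier[OF Dc] cmat_carrier[OF Ec]
  have "\<exists>A1 \<in> cmat (r 1) (s 1). A0 * E 0 = D 0 * A1"
  proof (rule cmat_col_image[of "D 0" "r 0" "r 1" "A0 * E 0" "s 1"])
    show "A0 * E 0 \<in> cmat (r 0) (s 1)" using A0 Ec[of 0] by (auto intro: cmat_mult)
    fix j assume j: "j < s 1"
    have "col (A0 * E 0) j = A0 *\<^sub>v col (E 0) j"
      using A0 c(2)[of 0] j by (intro col_mult2) auto
    also have "col (E 0) j = E 0 *\<^sub>v unit_vec (s 1) j"
      using c(2)[of 0] j by (intro mult_mat_unit_vec[symmetric]) auto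
    finally show "\<exists>w \<in> cvec (r 1). col (A0 * E 0) j = D 0 *\<^sub>v w"
      using img[of "unit_vec (s 1) j"] by simp
  qed (use Dc[of 0] in auto)
  then obtain A1 where A1: "A1 \<in> cmat (r 1) (s 1)" "D 0 * A1 = A0 * E 0" by metis
  \<comment> \<open>The second conjunct says that the columns of \<open>X * E (Suc q)\<close> are
    cycles of \<open>D q\<close>. This is what the construction of the next matrix needs, so it is
    the invariant of the recursive choice.\<close>
  define P where "P q X \<longleftrightarrow> X \<in> cmat (r (Suc q)) (s (Suc q)) \<and>
     D q * (X * E (Suc q)) = 0\<^sub>m (r q) (s (Suc (Suc q)))" for q X
  have zero: "D q * (X * E (Suc q)) = 0\<^sub>m (r q) (s (Suc (Suc q)))"
    if "X \<in> cmat (r (Suc q)) (s (Suc q))" "Y \<in> cmat (r q) (s q)" "D q * X = Y * E q" for q X Y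
  proof -
    have "D q * (X * E (Suc q)) = D q * X * E (Suc q)"
      by (rule assoc_mult_mat[OF c(1) cmat_carrier[OF that(1)] c(2), symmetric])
    also have "\<dots> = Y * (E q * E (Suc q))"
      unfolding that(3) by (rule assoc_mult_mat[OF cmat_carrier[OF that(2)] c(2) c(2)])
    also have "\<dots> = 0\<^sub>m (r q) (s (Suc (Suc q)))"
      unfolding exact_complex_mult[OF E] using that by (intro right_mult_zero_mat) auto
    finally show ?thesis .
  qed
  from A0 A1 have "\<exists>Y. P 0 Y \<and> D 0 * Y = A0 * E 0"
    using zero[of A1 0 A0] by (auto simp: P_def)
  \<comment> \<open>Position 0 is pinned to \<open>A0\<close> and carries no cycle condition; the
    invariant starts at position 1.\<close>
  have "\<exists>A. \<forall>q. (case q of 0 \<Rightarrow> A q = A0 | Suc p \<Rightarrow> P p (A q)) \<and> D q * A (Suc q) = A q * E q"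
  proof (rule dependent_nat_choice)
    fix X q assume X: "case q of 0 \<Rightarrow> X = A0 | Suc p \<Rightarrow> P p X"
    show "\<exists>Y. (case Suc q of 0 \<Rightarrow> Y = A0 | Suc p \<Rightarrow> P p Y) \<and> D q * Y = X * E q"
    proof (cases q)
      case 0
      then show ?thesis using X \<open>\<exists>Y. P 0 Y \<and> D 0 * Y = A0 * E 0\<close> by simp
    next
      case (Suc p)
      with X have X: "P p X" by simp
      have "X * E (Suc p) \<in> cmat (r (Suc p)) (s (Suc (Suc p)))"
        using X cmat_mult[OF _ Ec] by (auto simp: P_def)
      then obtain Y where Y: "Y \<in> cmat (r (Suc (Suc p))) (s (Suc (Suc p)))"
        "X * E (Suc p) = D (Suc p) * Y"
        using exact_complex_factor[OF D, of "X * E (Suc p)" p] X unfolding P_def by metis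
      then have "P (Suc p) Y"
        using zero[of Y "Suc p" X] X unfolding P_def by metis
      then show ?thesis using Y Suc by auto
    qed
  qed auto
  then obtain A where A: "\<And>q. case q of 0 \<Rightarrow> A q = A0 | Suc p \<Rightarrow> P p (A q)"
    "\<And>q. D q * A (Suc q) = A q * E q" by blast
  have "A q \<in> cmat (r q) (s q)" for q
    using A(1)[of q] A0 by (cases q) (auto simp: P_def)
  then show thesis using that[of A] A(2) A(1)[of 0] by simp
qed

text \<open>The matrices \<open>h\<close> form a homotopy between \<open>\<chi>\<close> and the identity; it starts with the zero
  map, so the entries of \<open>D 0\<close> may lie outside the kernel of \<open>\<epsilon>\<close>.\<close>

lemma chain_endomorphism_reduces_to_one:
  fixes \<epsilon> :: "'a \<Rightarrow> 'b::comm_ring_1"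
  assumes D: "exact_complex r D" and hom: "comm_ring_hom \<epsilon>"
    and min: "\<And>q. map_mat \<epsilon> (D (Suc q)) = 0\<^sub>m (r (Suc q)) (r (Suc (Suc q)))"
    and \<chi>: "\<And>q. \<chi> q \<in> cmat (r q) (r q)" and \<chi>0: "\<chi> 0 = 1\<^sub>m (r 0)"
    and comm: "\<And>q. D q * \<chi> (Suc q) = \<chi> q * D q"
  shows "map_mat \<epsilon> (\<chi> (Suc q)) = 1\<^sub>m (r (Suc q))"
proof -
  interpret \<epsilon>: comm_ring_hom \<epsilon> by (rule hom)
  note Dc = exact_complex_cmat[OF D]
  \<comment> \<open>\<open>R q h\<close> is what the homotopy identity still leaves over in degree q
    + 1. It is a cycle, hence equal to \<open>D (Suc q) * h'\<close>, and \<open>h'\<close> is the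
    next component of the homotopy. Both \<open>h * D q\<close> and \<open>D (Suc q) * h'\<close>
    vanish under \<open>\<epsilon>\<close>, so \<open>\<chi> (Suc q)\<close> reduces to the
    identity.\<close>
  define R where "R q h = \<chi> (Suc q) - 1\<^sub>m (r (Suc q)) - h * D q" for q h
  define P where "P q h \<longleftrightarrow> h \<in> cmat (r (Suc q)) (r q) \<and>
     map_mat \<epsilon> (h * D q) = 0\<^sub>m (r (Suc q)) (r (Suc q)) \<and>
     D q * R q h = 0\<^sub>m (r q) (r (Suc q))" for q h
  have R: "R q h \<in> cmat (r (Suc q)) (r (Suc q))" if "P q h" for q h
    using that \<chi>[of "Suc q"] Dc[of q] unfolding P_def R_def
    by (intro cmat_minus one_cmat) (auto intro: cmat_mult)
  have step: "\<exists>h'. P (Suc q) h' \<and> R q h = D (Suc q) * h'" if P: "P q h" for q h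
  proof -
    obtain h' where h': "h' \<in> cmat (r (Suc (Suc q))) (r (Suc q))" "R q h = D (Suc q) * h'"
      using exact_complex_factor[OF D R[OF P]] P unfolding P_def by metis
    note c = cmat_carrier[OF Dc] cmat_carrier[OF \<chi>] cmat_carrier[OF h'(1)]
    have h: "h \<in> carrier_mat (r (Suc q)) (r q)" using P by (auto simp: P_def)
    have "map_mat \<epsilon> (h' * D (Suc q)) = map_mat \<epsilon> h' * map_mat \<epsilon> (D (Suc q))"
      by (rule \<epsilon>.mat_hom_mult[OF c(3) c(1)])
    also have "\<dots> = 0\<^sub>m (r (Suc (Suc q))) (r (Suc (Suc q)))"
      unfolding min using c(3) by (intro right_mult_zero_mat) auto
    finally have 1: "map_mat \<epsilon> (h' * D (Suc q)) = \<dots>" .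
    have "D (Suc q) * R (Suc q) h' =
        D (Suc q) * \<chi> (Suc (Suc q)) - D (Suc q) * 1\<^sub>m (r (Suc (Suc q))) - D (Suc q) * (h' * D (Suc q))"
    proof -
      have "h' * D (Suc q) \<in> carrier_mat (r (Suc (Suc q))) (r (Suc (Suc q)))"
        by (rule mult_carrier_mat[OF c(3) c(1)])
      then show ?thesis
        unfolding R_def
        using mult_minus_distrib_mat[OF c(1)[of "Suc q"] c(2) one_carrier_mat]
          mult_minus_distrib_mat[OF c(1)[of "Suc q"] minus_carrier_mat[OF one_carrier_mat]] by simp
    qed
    also have "\<dots> = \<chi> (Suc q) * D (Suc q) - 1\<^sub>m (r (Suc q)) * D (Suc q) - R q h * D (Suc q)"
    proof -
      have "D (Suc q) * (h' * D (Suc q)) = R q h * D (Suc q)"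
        unfolding h'(2) by (rule assoc_mult_mat[OF c(1) c(3) c(1), symmetric])
      then show ?thesis using c(1)[of "Suc q"] by (simp add: comm)
    qed
    also have "\<dots> = (\<chi> (Suc q) - 1\<^sub>m (r (Suc q)) - R q h) * D (Suc q)"
      using minus_mult_distrib_mat[OF c(2)[of "Suc q"] one_carrier_mat c(1)]
        minus_mult_distrib_mat[OF minus_carrier_mat[OF one_carrier_mat] cmat_carrier[OF R[OF P]] c(1)]
      by simp
    also have "\<chi> (Suc q) - 1\<^sub>m (r (Suc q)) - R q h = h * D q"
      unfolding R_def using c h by (intro eq_matI) auto
    also have "h * D q * D (Suc q) = h * (D q * D (Suc q))"
      by (rule assoc_mult_mat[OF h c(1) c(1)])
    also have "\<dots> = 0\<^sub>m (r (Suc q)) (r (Suc (Suc q)))"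
      unfolding exact_complex_mult[OF D] using h by (rule right_mult_zero_mat)
    finally show ?thesis using 1 h' by (auto simp: P_def)
  qed
  have "P 0 (0\<^sub>m (r 1) (r 0))"
  proof -
    note c = cmat_carrier[OF Dc[of 0], simplified] cmat_carrier[OF \<chi>[of 1], simplified]
    have [simp]: "0\<^sub>m (r (Suc 0)) (r 0) * D 0 = 0\<^sub>m (r (Suc 0)) (r (Suc 0))"
      using c by (simp add: left_mult_zero_mat)
    have "D 0 * R 0 (0\<^sub>m (r 1) (r 0)) = D 0 * \<chi> 1 - D 0 * 1\<^sub>m (r 1) - D 0 * 0\<^sub>m (r 1) (r 1)"
    proof -
      have "0\<^sub>m (r 1) (r 0) * D 0 = 0\<^sub>m (r 1) (r 1)" by simp
      then show ?thesis
        unfolding R_def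
        using mult_minus_distrib_mat[OF c(1) c(2) one_carrier_mat]
          mult_minus_distrib_mat[OF c(1) minus_carrier_mat[OF one_carrier_mat] zero_carrier_mat] by simp
    qed
    also have "\<dots> = 0\<^sub>m (r 0) (r 1)" using comm[of 0] \<chi>0 c by (simp add: right_mult_zero_mat)
    finally show ?thesis by (auto simp: P_def intro!: eq_matI)
  qed
  then have "\<exists>h. P q h"
    by (induction q) (use step in auto)
  then obtain h where P: "P q h" by blast
  obtain h' where h': "P (Suc q) h'" "R q h = D (Suc q) * h'" using step[OF P] by blast
  note c = cmat_carrier[OF Dc] cmat_carrier[OF \<chi>]
  have cc: "h \<in> carrier_mat (r (Suc q)) (r q)" "h' \<in> carrier_mat (r (Suc (Suc q))) (r (Suc q))"
    using P h' by (auto simp: P_def)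
  have "map_mat \<epsilon> (D (Suc q) * h') = map_mat \<epsilon> (D (Suc q)) * map_mat \<epsilon> h'"
    by (rule \<epsilon>.mat_hom_mult[OF c(1) cc(2)])
  also have "\<dots> = 0\<^sub>m (r (Suc q)) (r (Suc q))"
    unfolding min using cc by (intro left_mult_zero_mat) auto
  finally have 2: "map_mat \<epsilon> (R q h) = \<dots>" using h' by simp
  show ?thesis
  proof (rule eq_matI)
    fix i j assume "i < dim_row (1\<^sub>m (r (Suc q)))" "j < dim_col (1\<^sub>m (r (Suc q)))"
    then have ij: "i < r (Suc q)" "j < r (Suc q)" by auto
    have e1: "\<epsilon> ((h * D q) $$ (i, j)) = 0"
    proof -
      have "\<epsilon> ((h * D q) $$ (i, j)) = map_mat \<epsilon> (h * D q) $$ (i, j)"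
        using ij c(1)[of q] cc by (subst index_map_mat) auto
      then show ?thesis using P ij by (simp add: P_def)
    qed
    have dR: "dim_row (R q h) = r (Suc q)" "dim_col (R q h) = r (Suc q)"
      using R[OF P] by (auto simp: cmat_iff)
    have "\<epsilon> (R q h $$ (i, j)) = map_mat \<epsilon> (R q h) $$ (i, j)"
      using ij dR by (subst index_map_mat) auto
    then have "\<epsilon> (R q h $$ (i, j)) = 0" using 2 ij by simp
    moreover have "R q h $$ (i, j) = \<chi> (Suc q) $$ (i, j) - 1\<^sub>m (r (Suc q)) $$ (i, j) - (h * D q) $$ (i, j)"
      unfolding R_def using ij c(1)[of q] c(2)[of "Suc q"] cc by (subst index_minus_mat) auto
    ultimately have "\<epsilon> (\<chi> (Suc q) $$ (i, j)) = \<epsilon> (1\<^sub>m (r (Suc q)) $$ (i, j))"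
      using e1 by (simp add: \<epsilon>.hom_minus)
    then show "map_mat \<epsilon> (\<chi> (Suc q)) $$ (i, j) = 1\<^sub>m (r (Suc q)) $$ (i, j)"
      using ij c(2)[of "Suc q"] by (subst index_map_mat) auto
  qed (use c(2)[of "Suc q"] in auto)
qed

end

text \<open>If \<open>s < r\<close>, padding with zeros gives square matrices that still multiply to
  the identity. A right inverse of a square matrix over a field is a left inverse, but the product
  in the other order has a zero row.\<close>

lemma right_invertible_mat_dims:
  fixes A :: "'a::field mat"
  assumes A: "A \<in> carrier_mat r s" and B: "B \<in> carrier_mat s r" and AB: "A * B = 1\<^sub>m r"
  shows "r \<le> s"
proof (rule ccontr)
  assume "\<not> r \<le> s"
  then have sr: "s < r" by simp
  define A' where "A' = mat r r (\<lambda>(i, j). if j < s then A $$ (i, j) else 0)"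
  define B' where "B' = mat r r (\<lambda>(i, j). if i < s then B $$ (i, j) else 0)"
  have c: "A' \<in> carrier_mat r r" "B' \<in> carrier_mat r r" by (auto simp: A'_def B'_def)
  have "A' * B' = A * B"
  proof (rule eq_matI)
    fix i j assume "i < dim_row (A * B)" "j < dim_col (A * B)"
    then have ij: "i < r" "j < r" using A B by auto
    have "(A' * B') $$ (i, j) = (\<Sum>k = 0..<r. A' $$ (i, k) * B' $$ (k, j))"
      using c ij by (auto simp: scalar_prod_def)
    also have "\<dots> = (\<Sum>k = 0..<s. A $$ (i, k) * B $$ (k, j))"
      using sr ij by (intro sum.mono_neutral_cong_right) (auto simp: A'_def B'_def)
    also have "\<dots> = (A * B) $$ (i, j)"
      using A B ij by (auto simp: scalar_prod_def)
    finally show "(A' * B') $$ (i, j) = (A * B) $$ (i, j)" .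
  qed (use A B c in auto)
  then have "B' * A' = 1\<^sub>m r"
    using mat_mult_left_right_inverse[OF c] AB by simp
  moreover have "(B' * A') $$ (s, s) = 0"
    using sr c by (auto simp: scalar_prod_def B'_def)
  ultimately show False using sr by simp
qed

context coeff_subring begin

text \<open>Only \<open>D\<close> is required to be minimal. Lifts \<phi> from \<open>D\<close> to
  \<open>E\<close> and \<psi> back, both starting with the identity, compose to an endomorphism of
  \<open>D\<close> that reduces to the identity over the residue field, so the reduction of
  \<open>\<psi> (Suc q)\<close> has a right inverse.\<close>

lemma minimal_complex_rank_le:
  fixes \<epsilon> :: "'a \<Rightarrow> 'b::field"
  assumes D: "exact_complex r D" and E: "exact_complex s E" and rs: "r 0 = s 0"
    and img: "{D 0 *\<^sub>v v | v. v \<in> cvec (r 1)} = {E 0 *\<^sub>v w | w. w \<in> cvec (s 1)}"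
    and hom: "comm_ring_hom \<epsilon>"
    and min: "\<And>q. map_mat \<epsilon> (D (Suc q)) = 0\<^sub>m (r (Suc q)) (r (Suc (Suc q)))"
  shows "r (Suc q) \<le> s (Suc q)"
proof -
  interpret \<epsilon>: comm_ring_hom \<epsilon> by (rule hom)
  note c = cmat_carrier[OF exact_complex_cmat[OF D]] cmat_carrier[OF exact_complex_cmat[OF E]]
  have 0: "1\<^sub>m (r 0) *\<^sub>v (D 0 *\<^sub>v v) = D 0 *\<^sub>v v" "1\<^sub>m (r 0) *\<^sub>v (E 0 *\<^sub>v w) = E 0 *\<^sub>v w" for v w
  proof -
    have "D 0 *\<^sub>v v \<in> carrier_vec (r 0)" using c(1)[of 0] by (intro carrier_vecI) simp
    moreover have "E 0 *\<^sub>v w \<in> carrier_vec (r 0)"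
      unfolding rs using c(2)[of 0] by (intro carrier_vecI) simp
    ultimately show "1\<^sub>m (r 0) *\<^sub>v (D 0 *\<^sub>v v) = D 0 *\<^sub>v v" "1\<^sub>m (r 0) *\<^sub>v (E 0 *\<^sub>v w) = E 0 *\<^sub>v w"
      by simp_all
  qed
  have lift1: "\<exists>w' \<in> cvec (s 1). 1\<^sub>m (r 0) *\<^sub>v (D 0 *\<^sub>v v) = E 0 *\<^sub>v w'" if "v \<in> cvec (r 1)" for v
  proof -
    have "D 0 *\<^sub>v v \<in> {D 0 *\<^sub>v v | v. v \<in> cvec (r 1)}" using that by blast
    then show ?thesis unfolding img 0 by blast
  qed
  have lift2: "\<exists>w' \<in> cvec (r 1). 1\<^sub>m (r 0) *\<^sub>v (E 0 *\<^sub>v v) = D 0 *\<^sub>v w'" if "v \<in> cvec (s 1)" for v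
  proof -
    have "E 0 *\<^sub>v v \<in> {E 0 *\<^sub>v v | v. v \<in> cvec (s 1)}" using that by blast
    then show ?thesis unfolding img[symmetric] 0 by blast
  qed
  obtain \<phi> where \<phi>: "\<phi> 0 = 1\<^sub>m (r 0)" "\<And>q. \<phi> q \<in> cmat (s q) (r q)"
    "\<And>q. E q * \<phi> (Suc q) = \<phi> q * D q"
    using chain_map_lift[OF E D, of "1\<^sub>m (r 0)"] lift1 one_cmat rs by metis
  obtain \<psi> where \<psi>: "\<psi> 0 = 1\<^sub>m (r 0)" "\<And>q. \<psi> q \<in> cmat (r q) (s q)"
    "\<And>q. D q * \<psi> (Suc q) = \<psi> q * E q"
    using chain_map_lift[OF D E, of "1\<^sub>m (r 0)"] lift2 one_cmat rs by metis
  note f = cmat_carrier[OF \<phi>(2)] and p = cmat_carrier[OF \<psi>(2)]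
  have "map_mat \<epsilon> (\<psi> (Suc q) * \<phi> (Suc q)) = 1\<^sub>m (r (Suc q))"
  proof (rule chain_endomorphism_reduces_to_one[where \<chi> = "\<lambda>q. \<psi> q * \<phi> q", OF D hom min])
    show "\<psi> q * \<phi> q \<in> cmat (r q) (r q)" for q using \<psi>(2) \<phi>(2) by (rule cmat_mult)
    show "\<psi> 0 * \<phi> 0 = 1\<^sub>m (r 0)" using \<psi>(1) \<phi>(1) by simp
    fix q
    have "D q * (\<psi> (Suc q) * \<phi> (Suc q)) = D q * \<psi> (Suc q) * \<phi> (Suc q)"
      by (rule assoc_mult_mat[OF c(1) p f, symmetric])
    also have "\<dots> = \<psi> q * (E q * \<phi> (Suc q))"
      unfolding \<psi>(3) by (rule assoc_mult_mat[OF p c(2) f])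
    also have "\<dots> = \<psi> q * \<phi> q * D q"
      unfolding \<phi>(3) by (rule assoc_mult_mat[OF p f c(1), symmetric])
    finally show "D q * (\<psi> (Suc q) * \<phi> (Suc q)) = \<psi> q * \<phi> q * D q" .
  qed
  then have "map_mat \<epsilon> (\<psi> (Suc q)) * map_mat \<epsilon> (\<phi> (Suc q)) = 1\<^sub>m (r (Suc q))"
    by (simp add: \<epsilon>.mat_hom_mult[OF p f])
  then show ?thesis
    using p[of "Suc q"] f[of "Suc q"] by (intro right_invertible_mat_dims) auto
qed

end

section \<open>Mapping cones of chain maps\<close>

lemma mult_mat_uminus_vec:
  fixes A :: "'a::comm_ring_1 mat"
  assumes "A \<in> carrier_mat r s" "v \<in> carrier_vec s"
  shows "A *\<^sub>v (- v) = - (A *\<^sub>v v)"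
  using assms by (intro eq_vecI) auto

definition cone_rank :: "(nat \<Rightarrow> nat) \<Rightarrow> (nat \<Rightarrow> nat) \<Rightarrow> nat \<Rightarrow> nat" where
  "cone_rank r s q = r q + (case q of 0 \<Rightarrow> 0 | Suc p \<Rightarrow> s p)"

text \<open>The sign on \<open>E\<close> makes consecutive maps compose to zero, because the upper
  right block of the product is \<open>D q * A (Suc q) - A q * E q\<close>. At position 0 the
  shifted complex contributes nothing, hence the blocks without rows.\<close>

definition cone_map :: "(nat \<Rightarrow> nat) \<Rightarrow> (nat \<Rightarrow> nat) \<Rightarrow> (nat \<Rightarrow> 'a::comm_ring_1 mat) \<Rightarrow>
    (nat \<Rightarrow> 'a mat) \<Rightarrow> (nat \<Rightarrow> 'a mat) \<Rightarrow> nat \<Rightarrow> 'a mat" where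
  "cone_map r s D E A q = (case q of
      0 \<Rightarrow> four_block_mat (D 0) (A 0) (0\<^sub>m 0 (r 1)) (0\<^sub>m 0 (s 0))
    | Suc p \<Rightarrow> four_block_mat (D q) (A q) (0\<^sub>m (s p) (r (Suc q))) (- E p))"

context coeff_subring begin

lemma cone_map_cmat:
  assumes "\<And>q. D q \<in> cmat (r q) (r (Suc q))" "\<And>q. E q \<in> cmat (s q) (s (Suc q))"
    "\<And>q. A q \<in> cmat (r q) (s q)"
  shows "cone_map r s D E A q \<in> cmat (cone_rank r s q) (cone_rank r s (Suc q))"
proof -
  have *: "four_block_mat X Y (0\<^sub>m i k) Z \<in> cmat (h + i) (k + l)"
    if "X \<in> cmat h k" "Y \<in> cmat h l" "Z \<in> cmat i l" for X Y Z h i k l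
    using that by (auto simp: cmat_iff)
  show ?thesis
    using assms *[OF assms(1)[of 0] assms(3)[of 0] zero_cmat[of 0 "s 0"]]
    by (cases q) (auto simp: cone_map_def cone_rank_def intro!: * cmat_uminus)
qed

lemma cone_map_mult_vec:
  assumes D: "\<And>q. D q \<in> cmat (r q) (r (Suc q))" and E: "\<And>q. E q \<in> cmat (s q) (s (Suc q))"
    and A: "\<And>q. A q \<in> cmat (r q) (s q)"
    and v: "v \<in> cvec (r (Suc q))" and w: "w \<in> cvec (s q)"
  shows "cone_map r s D E A q *\<^sub>v (v @\<^sub>v w) = (D q *\<^sub>v v + A q *\<^sub>v w) @\<^sub>v
     (case q of 0 \<Rightarrow> vNil | Suc p \<Rightarrow> - (E p *\<^sub>v w))"
proof (cases q)
  case 0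
  have "cone_map r s D E A q *\<^sub>v (v @\<^sub>v w) = (D q *\<^sub>v v + A q *\<^sub>v w) @\<^sub>v
     (0\<^sub>m 0 (r 1) *\<^sub>v v + 0\<^sub>m 0 (s 0) *\<^sub>v w)"
    unfolding cone_map_def 0 nat.case One_nat_def[symmetric]
    by (rule four_block_mat_mult_vec[OF cmat_carrier[OF D[of 0, folded One_nat_def]]
        cmat_carrier[OF A] zero_carrier_mat zero_carrier_mat
        cvec_carrier[OF v[unfolded 0, folded One_nat_def]] cvec_carrier[OF w[unfolded 0]]])
  also have "0\<^sub>m 0 (r 1) *\<^sub>v v + 0\<^sub>m 0 (s 0) *\<^sub>v w = vNil"
    by (intro eq_vecI) auto
  finally show ?thesis using 0 by simp
next
  case (Suc p)
  have "cone_map r s D E A q *\<^sub>v (v @\<^sub>v w) = (D q *\<^sub>v v + A q *\<^sub>v w) @\<^sub>v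
     (0\<^sub>m (s p) (r (Suc q)) *\<^sub>v v + (- E p) *\<^sub>v w)"
    unfolding cone_map_def Suc nat.case
    by (rule four_block_mat_mult_vec[OF cmat_carrier[OF D] cmat_carrier[OF A] zero_carrier_mat
        uminus_carrier_mat[OF cmat_carrier[OF E]]
        cvec_carrier[OF v[unfolded Suc]] cvec_carrier[OF w[unfolded Suc]]])
  also have "0\<^sub>m (s p) (r (Suc q)) *\<^sub>v v + (- E p) *\<^sub>v w = - (E p *\<^sub>v w)"
    using Suc E[of p] v w by (intro eq_vecI) (auto simp: cmat_iff cvec_iff)
  finally show ?thesis using Suc by simp
qed

text \<open>\<open>inj\<close> says that \<open>A 0\<close> induces an injective map on cokernels.
  It is what exactness of the cone at position 1 requires, where \<open>E\<close> itself has no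
  exactness to offer; at higher positions exactness of \<open>E\<close> takes over.\<close>

lemma mapping_cone_exact:
  assumes D: "exact_complex r D" and E: "exact_complex s E"
    and A: "\<And>q. A q \<in> cmat (r q) (s q)" and DA: "\<And>q. D q * A (Suc q) = A q * E q"
    and inj: "\<And>v w. v \<in> cvec (r 1) \<Longrightarrow> w \<in> cvec (s 0) \<Longrightarrow> D 0 *\<^sub>v v + A 0 *\<^sub>v w = 0\<^sub>v (r 0) \<Longrightarrow>
       \<exists>x \<in> cvec (s 1). w = E 0 *\<^sub>v x"
  shows "exact_complex (cone_rank r s) (cone_map r s D E A)"
proof -
  note Dc = exact_complex_cmat[OF D] and Ec = exact_complex_cmat[OF E]
  note c = cmat_carrier[OF Dc] cmat_carrier[OF Ec] cmat_carrier[OF A]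
  let ?F = "cone_map r s D E A" and ?r = "cone_rank r s"
  note F = cone_map_cmat[of D r E s A, OF Dc Ec A]
  note Fv = cone_map_mult_vec[of D r E s A, OF Dc Ec A]
  have DAv: "D q *\<^sub>v (A (Suc q) *\<^sub>v x) = A q *\<^sub>v (E q *\<^sub>v x)" if "x \<in> cvec (s (Suc q))" for q x
    using assoc_mult_mat_vec[OF c(1)[of q] c(3)[of "Suc q"] cvec_carrier[OF that]]
      assoc_mult_mat_vec[OF c(3)[of q] c(2)[of q] cvec_carrier[OF that]] by (simp add: DA)
  have rS: "?r (Suc q) = r (Suc q) + s q" for q by (simp add: cone_rank_def)
  have "{x \<in> cvec (?r (Suc q)). ?F q *\<^sub>v x = 0\<^sub>v (?r q)} =
        {?F (Suc q) *\<^sub>v y | y. y \<in> cvec (?r (Suc (Suc q)))}" for q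
  proof (intro equalityI subsetI; clarify)
    fix x assume x: "x \<in> cvec (?r (Suc q))" and Fx: "?F q *\<^sub>v x = 0\<^sub>v (?r q)"
    obtain v w where vw: "v \<in> cvec (r (Suc q))" "w \<in> cvec (s q)" "x = v @\<^sub>v w"
      using cvec_split x unfolding rS by metis
    have dimDA: "D q *\<^sub>v v + A q *\<^sub>v w \<in> carrier_vec (r q)"
      using c(3)[of q] by (intro carrier_vecI) simp
    have "D q *\<^sub>v v + A q *\<^sub>v w = 0\<^sub>v (r q) \<and> (\<exists>y \<in> cvec (s (Suc q)). w = E q *\<^sub>v y)"
    proof (cases q)
      case 0
      have "(D q *\<^sub>v v + A q *\<^sub>v w) @\<^sub>v vNil = 0\<^sub>v (r q)"
        using Fx Fv[OF vw(1,2)] vw(3) 0 by (simp add: cone_rank_def)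
      also have "(D q *\<^sub>v v + A q *\<^sub>v w) @\<^sub>v vNil = D q *\<^sub>v v + A q *\<^sub>v w"
        by (intro eq_vecI) auto
      finally show ?thesis using inj vw 0 by auto
    next
      case (Suc p)
      have "(D q *\<^sub>v v + A q *\<^sub>v w) @\<^sub>v (- (E p *\<^sub>v w)) = 0\<^sub>v (r q + s p)"
        using Fx Fv[OF vw(1,2)] vw(3) Suc by (simp add: cone_rank_def)
      also have "0\<^sub>v (r q + s p) = 0\<^sub>v (r q) @\<^sub>v 0\<^sub>v (s p)"
        by (intro eq_vecI) auto
      finally have *: "D q *\<^sub>v v + A q *\<^sub>v w = 0\<^sub>v (r q)" "- (E p *\<^sub>v w) = 0\<^sub>v (s p)"
        using append_vec_eq[OF dimDA zero_carrier_vec] by auto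
      have "E p *\<^sub>v w \<in> carrier_vec (s p)" using c(2)[of p] by (intro carrier_vecI) simp
      then have "E p *\<^sub>v w = 0\<^sub>v (s p)"
        using *(2) by (metis uminus_uminus_vec uminus_zero_vec)
      then show ?thesis
        using *(1) exact_complex_kernel[OF E, of w p] vw(2) Suc by metis
    qed
    then obtain y where y: "y \<in> cvec (s (Suc q))" "w = E q *\<^sub>v y"
      and eq: "D q *\<^sub>v v + A q *\<^sub>v w = 0\<^sub>v (r q)" by blast
    \<comment> \<open>Subtracting the image of \<open>0 @\<^sub>v - y\<close> from \<open>x\<close>
      cancels the lower part \<open>w\<close> and leaves \<open>?u\<close> on top. This is a cycle
      of \<open>D q\<close>, so it lifts to some \<open>z\<close>, and
      \<open>z @\<^sub>v - y\<close> is the wanted preimage.\<close>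
    let ?u = "v + A (Suc q) *\<^sub>v y"
    have Ay: "A (Suc q) *\<^sub>v y \<in> cvec (r (Suc q))" using A y(1) by (rule cmat_mult_vec)
    have u: "?u \<in> cvec (r (Suc q))" using vw(1) Ay by (rule cvec_add)
    have "D q *\<^sub>v ?u = D q *\<^sub>v v + D q *\<^sub>v (A (Suc q) *\<^sub>v y)"
      by (rule mult_add_distrib_mat_vec[OF c(1) cvec_carrier[OF vw(1)] cvec_carrier[OF Ay]])
    also have "\<dots> = 0\<^sub>v (r q)" using eq y by (simp add: DAv)
    finally obtain z where z: "z \<in> cvec (r (Suc (Suc q)))" "?u = D (Suc q) *\<^sub>v z"
      using exact_complex_kernel[OF D u] by metis
    have "- y \<in> cvec (s (Suc q))" using y(1) by (rule cvec_uminus)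
    note Fv[OF z(1) this]
    moreover have "E q *\<^sub>v (- y) = - w"
      unfolding y(2) by (rule mult_mat_uminus_vec[OF c(2) cvec_carrier[OF y(1)]])
    moreover have "A (Suc q) *\<^sub>v (- y) = - (A (Suc q) *\<^sub>v y)"
      by (rule mult_mat_uminus_vec[OF c(3) cvec_carrier[OF y(1)]])
    moreover have "D (Suc q) *\<^sub>v z + - (A (Suc q) *\<^sub>v y) = v"
      using z(2)[symmetric] c(3)[of "Suc q"] vw(1) by (intro eq_vecI) (auto simp: cvec_iff)
    ultimately have "?F (Suc q) *\<^sub>v (z @\<^sub>v - y) = x" using vw(3) by simp
    moreover have "z @\<^sub>v - y \<in> cvec (?r (Suc (Suc q)))"
      unfolding rS using z(1) \<open>- y \<in> cvec (s (Suc q))\<close> by (rule cvec_append)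
    ultimately show "\<exists>y. x = ?F (Suc q) *\<^sub>v y \<and> y \<in> cvec (?r (Suc (Suc q)))" by metis
  next
    fix x assume x: "x \<in> cvec (?r (Suc (Suc q)))"
    obtain v w where vw: "v \<in> cvec (r (Suc (Suc q)))" "w \<in> cvec (s (Suc q))" "x = v @\<^sub>v w"
      using cvec_split x unfolding rS by metis
    let ?v = "D (Suc q) *\<^sub>v v + A (Suc q) *\<^sub>v w" and ?w = "- (E q *\<^sub>v w)"
    have Fx: "?F (Suc q) *\<^sub>v x = ?v @\<^sub>v ?w" using Fv[OF vw(1,2)] vw(3) by simp
    have Dv: "D (Suc q) *\<^sub>v v \<in> cvec (r (Suc q))" and Aw: "A (Suc q) *\<^sub>v w \<in> cvec (r (Suc q))"
      and Ew: "E q *\<^sub>v w \<in> cvec (s q)"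
      using cmat_mult_vec[OF Dc vw(1)] cmat_mult_vec[OF A vw(2)] cmat_mult_vec[OF Ec vw(2)] by auto
    have v: "?v \<in> cvec (r (Suc q))" and w: "?w \<in> cvec (s q)"
      using Dv Aw Ew by (auto intro: cvec_add cvec_uminus)
    have "D q *\<^sub>v ?v = D q *\<^sub>v (D (Suc q) *\<^sub>v v) + D q *\<^sub>v (A (Suc q) *\<^sub>v w)"
      by (rule mult_add_distrib_mat_vec[OF c(1) cvec_carrier[OF Dv] cvec_carrier[OF Aw]])
    also have "\<dots> = A q *\<^sub>v (E q *\<^sub>v w)"
      unfolding exact_complex_image[OF D vw(1)] DAv[OF vw(2)]
      using c(3)[of q] by (intro eq_vecI) auto
    also have "A q *\<^sub>v ?w = - (A q *\<^sub>v (E q *\<^sub>v w))"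
      by (rule mult_mat_uminus_vec[OF c(3) cvec_carrier[OF Ew]])
    ultimately have top: "D q *\<^sub>v ?v + A q *\<^sub>v ?w = 0\<^sub>v (r q)"
      using c(3)[of q] by (intro eq_vecI) auto
    have "?F q *\<^sub>v (?v @\<^sub>v ?w) = 0\<^sub>v (?r q)"
    proof (cases q)
      case 0
      then show ?thesis
        unfolding Fv[OF v w] top by (intro eq_vecI) (auto simp: cone_rank_def)
    next
      case (Suc p)
      have "E p *\<^sub>v ?w = - (E p *\<^sub>v (E q *\<^sub>v w))"
        using mult_mat_uminus_vec[OF c(2)[of p]] Ew Suc by auto
      also have "\<dots> = 0\<^sub>v (s p)"
        using exact_complex_image[OF E, of w p] vw(2) Suc by auto
      finally show ?thesis
        unfolding Fv[OF v w] top using Suc by (intro eq_vecI) (auto simp: cone_rank_def)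
    qed
    then show "?F (Suc q) *\<^sub>v x \<in> cvec (?r (Suc q)) \<and> ?F q *\<^sub>v (?F (Suc q) *\<^sub>v x) = 0\<^sub>v (?r q)"
      unfolding Fx rS using cvec_append[OF v w] by simp
  qed
  with F show ?thesis by (auto simp: exact_complex_def)
qed

end

section \<open>Polynomials and homogeneous parts\<close>

lemma poly_ring_simps [simp]:
  "monoid.mult (poly_ring V) = (*)" "monoid.one (poly_ring V) = 1"
  "ring.zero (poly_ring V) = 0" "ring.add (poly_ring V) = (+)"
  by (simp_all add: poly_ring_def)

lemma poly_ring_carrier_iff:
  "p \<in> carrier (poly_ring V) \<longleftrightarrow> (\<forall>m \<in> Poly_Mapping.keys p. Poly_Mapping.keys m \<subseteq> V)"
  by (simp add: poly_ring_def)

lemma keys_add_nat: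
  fixes a b :: "'v monom"
  shows "Poly_Mapping.keys (a + b) = Poly_Mapping.keys a \<union> Poly_Mapping.keys b"
  by (auto simp: in_keys_iff lookup_add)

lemma keys_uminus:
  fixes p :: "'m \<Rightarrow>\<^sub>0 'k::ab_group_add"
  shows "Poly_Mapping.keys (- p) = Poly_Mapping.keys p"
  by (auto simp: in_keys_iff)

lemma coeff_subring_poly_ring:
  "coeff_subring (carrier (poly_ring V) :: ('v, 'k::field) mpoly set)"
proof
  fix x y :: "('v, 'k) mpoly"
  assume xy: "x \<in> carrier (poly_ring V)" "y \<in> carrier (poly_ring V)"
  then show "x + y \<in> carrier (poly_ring V)"
    using keys_add[of x y] by (auto simp: poly_ring_carrier_iff)
  show "x * y \<in> carrier (poly_ring V)"
    unfolding poly_ring_carrier_iff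
  proof
    fix m assume "m \<in> Poly_Mapping.keys (x * y)"
    then obtain a b where "m = a + b" "a \<in> Poly_Mapping.keys x" "b \<in> Poly_Mapping.keys y"
      using keys_mult[of x y] by blast
    then show "Poly_Mapping.keys m \<subseteq> V"
      using xy by (auto simp: poly_ring_carrier_iff keys_add_nat)
  qed
qed (auto simp: poly_ring_carrier_iff keys_uminus)

interpretation PV: coeff_subring "carrier (poly_ring V) :: ('v, 'k::field) mpoly set" for V
  by (rule coeff_subring_poly_ring)

lemma free_module_eq: "free_module V r = PV.cvec V r"
  by (simp add: free_module_def PV.cvec_def)

lemma cring_poly_ring: "cring (poly_ring V :: ('v, 'k::field) mpoly ring)"
proof (intro cringI abelian_groupI comm_monoidI; simp)
  show "\<exists>y \<in> carrier (poly_ring V). y + x = 0" if "x \<in> carrier (poly_ring V)"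
    for x :: "('v, 'k) mpoly"
    using that by (intro bexI[of _ "- x"]) auto
qed (auto simp: algebra_simps)

interpretation PR: cring "poly_ring V :: ('v, 'k::field) mpoly ring" for V
  by (rule cring_poly_ring)

lemma ideal_poly_ringI:
  fixes I :: "('v, 'k::field) mpoly set"
  assumes "I \<subseteq> carrier (poly_ring V)" "0 \<in> I" "\<And>x y. x \<in> I \<Longrightarrow> y \<in> I \<Longrightarrow> x + y \<in> I"
    and mult: "\<And>x y. x \<in> carrier (poly_ring V) \<Longrightarrow> y \<in> I \<Longrightarrow> x * y \<in> I"
  shows "ideal I (poly_ring V)"
proof -
  have mult': "y * x \<in> I" if "x \<in> carrier (poly_ring V)" "y \<in> I" for x y
    using mult[OF that] by (simp add: mult.commute)
  show ?thesis
proof (rule idealI[OF PR.ring_axioms])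
  show "subgroup I (add_monoid (poly_ring V))"
  proof
    fix x assume x: "x \<in> I"
    have "inv\<^bsub>add_monoid (poly_ring V)\<^esub> x = - x"
      using x assms(1) by (intro group.inv_equality[OF PR.a_group]) auto
    then show "inv\<^bsub>add_monoid (poly_ring V)\<^esub> x \<in> I"
      using mult[of "- 1" x] x by simp
  qed (use assms in auto)
qed (use mult mult' in auto)
qed

lemma ideal_closed:
  fixes I :: "('v, 'k::field) mpoly set"
  assumes "ideal I (poly_ring V)"
  shows "0 \<in> I" "x \<in> I \<Longrightarrow> y \<in> I \<Longrightarrow> x + y \<in> I" "x \<in> carrier (poly_ring V) \<Longrightarrow> y \<in> I \<Longrightarrow> x * y \<in> I"
    "(\<And>i. i \<in> S \<Longrightarrow> f i \<in> I) \<Longrightarrow> sum f S \<in> I"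
proof -
  interpret ideal I "poly_ring V" by (rule assms)
  show 0: "0 \<in> I" using zero_closed by simp
  show add: "x \<in> I \<Longrightarrow> y \<in> I \<Longrightarrow> x + y \<in> I" for x y using a_closed by simp
  show "x \<in> carrier (poly_ring V) \<Longrightarrow> y \<in> I \<Longrightarrow> x * y \<in> I" using I_l_closed by simp
  show "(\<And>i. i \<in> S \<Longrightarrow> f i \<in> I) \<Longrightarrow> sum f S \<in> I"
    by (induction S rule: infinite_finite_induct) (use 0 add in auto)
qed

lemma poly_mapping_expand: "p = (\<Sum>m \<in> Poly_Mapping.keys p. Poly_Mapping.single m (Poly_Mapping.lookup p m))"
  by (rule poly_mapping_eqI) (auto simp: lookup_sum lookup_single when_def in_keys_iff sum.delta)

text \<open>The residue map from the ring to the field, used as \<open>\<epsilon>\<close> in the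
  comparison of ranks. It is multiplicative because exponents are natural numbers: a product of
  monomials is 1 only if both factors are 1.\<close>

lemma comm_ring_hom_constant_term:
  "comm_ring_hom (\<lambda>p :: ('v, 'k::field) mpoly. Poly_Mapping.lookup p 0)"
proof -
  have mult: "Poly_Mapping.lookup (p * q) 0 = Poly_Mapping.lookup p 0 * Poly_Mapping.lookup q 0"
    for p q :: "('v, 'k) mpoly"
  proof -
    have 0: "a = 0 \<and> b = 0" if "a + b = 0" for a b :: "'v monom"
    proof -
      have "Poly_Mapping.keys a \<union> Poly_Mapping.keys b = {}"
        using that keys_add_nat[of a b] by simp
      then show ?thesis by simp
    qed
    have *: "Poly_Mapping.lookup (x * q) 0 = 0" if x: "0 \<notin> Poly_Mapping.keys x" for x q :: "('v, 'k) mpoly"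
    proof (rule ccontr)
      assume "Poly_Mapping.lookup (x * q) 0 \<noteq> 0"
      then have "0 \<in> Poly_Mapping.keys (x * q)" by (simp add: in_keys_iff)
      then obtain a b where "0 = a + b" "a \<in> Poly_Mapping.keys x"
        using keys_mult[of x q] by blast
      then show False using x 0[of a b] by simp
    qed
    let ?c = "\<lambda>p. Poly_Mapping.single 0 (Poly_Mapping.lookup p 0) :: ('v, 'k) mpoly"
    have c: "0 \<notin> Poly_Mapping.keys (x - ?c x)" for x
      by (simp add: in_keys_iff lookup_minus)
    \<comment> \<open>After the product of the constant terms, each remaining summand has a factor
      without constant term.\<close>
    have "p * q = ?c p * ?c q + (q - ?c q) * ?c p + (p - ?c p) * q"
      by (simp only: left_diff_distrib mult.commute[of q]) (simp add: mult.commute)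
    also have "Poly_Mapping.lookup \<dots> 0 = Poly_Mapping.lookup (?c p * ?c q) 0"
      by (simp only: lookup_add *[OF c] add_0_right)
    finally show ?thesis by (simp only: mult_single add_0_right lookup_single_eq)
  qed
  show ?thesis
    by unfold_locales (auto simp: mult lookup_add)
qed

text \<open>Turns the minimality condition on a resolution into the vanishing of its matrices under
  the residue map.\<close>

lemma genideal_vars_constant_term:
  fixes p :: "('v, 'k::field) mpoly"
  assumes "p \<in> genideal (poly_ring V) (var ` V)"
  shows "Poly_Mapping.lookup p 0 = 0"
proof -
  interpret comm_ring_hom "\<lambda>p :: ('v, 'k) mpoly. Poly_Mapping.lookup p 0"
    by (rule comm_ring_hom_constant_term)
  let ?I = "{p \<in> carrier (poly_ring V). Poly_Mapping.lookup p 0 = (0 :: 'k)}"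
  have "ideal ?I (poly_ring V)"
    by (rule ideal_poly_ringI) (auto simp: lookup_add hom_mult)
  moreover have "var ` V \<subseteq> ?I"
    by (auto simp: var_def monomial_def poly_ring_carrier_iff lookup_single when_def)
      (metis One_nat_def lookup_single_eq lookup_zero zero_neq_one)
  ultimately have "genideal (poly_ring V) (var ` V) \<subseteq> ?I"
    by (rule PR.genideal_minimal)
  then show ?thesis using assms by blast
qed

section \<open>Degrees of monomials and homogeneous parts of polynomials\<close>

definition weight :: "('v \<Rightarrow> bool) \<Rightarrow> 'v monom \<Rightarrow> nat" where
  "weight P m = (\<Sum>v \<in> Poly_Mapping.keys m. if P v then Poly_Mapping.lookup m v else 0)"

lemma weight_add: "weight P (a + b) = weight P a + weight P b"
  unfolding weight_def by (rule setsum_keys_plus_distrib) auto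

lemma weight_single [simp]: "weight P (Poly_Mapping.single v c) = (if P v then c else 0)"
  by (auto simp: weight_def)

lemma weight_zero [simp]: "weight P 0 = 0"
  by (simp add: weight_def)

lemma monom_degree_weight: "monom_degree m = weight (\<lambda>_. True) m"
  by (simp add: monom_degree_def weight_def)

lemma monom_degree_add: "monom_degree (a + b) = monom_degree a + monom_degree b"
  by (simp add: monom_degree_weight weight_add)

lemma monom_degree_single [simp]: "monom_degree (Poly_Mapping.single v c) = c"
  by (simp add: monom_degree_weight)

lemma monom_degree_zero [simp]: "monom_degree 0 = 0"
  by (simp add: monom_degree_weight)

lemma monom_degree_eq_0_iff: "monom_degree m = 0 \<longleftrightarrow> m = 0"
proof
  assume "monom_degree m = 0"
  then have "\<forall>v \<in> Poly_Mapping.keys m. Poly_Mapping.lookup m v = 0"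
    by (simp add: monom_degree_def)
  then show "m = 0"
    by (intro poly_mapping_eqI) (auto simp: in_keys_iff)
qed simp

lemma single_add_minus:
  fixes m :: "'v monom"
  assumes "v \<in> Poly_Mapping.keys m"
  shows "m = Poly_Mapping.single v 1 + (m - Poly_Mapping.single v 1)"
  using assms by (intro poly_mapping_eqI)
    (auto simp: lookup_add lookup_minus lookup_single when_def in_keys_iff)

lemma monom_degree_minus_single:
  assumes "v \<in> Poly_Mapping.keys m"
  shows "monom_degree m = Suc (monom_degree (m - Poly_Mapping.single v 1))"
  using arg_cong[OF single_add_minus[OF assms], of monom_degree]
  by (simp add: monom_degree_add)

lemma homogeneous_iff: "homogeneous (int e) p \<longleftrightarrow> (\<forall>m \<in> Poly_Mapping.keys p. monom_degree m = e)"
  by (simp add: homogeneous_def)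

text \<open>The reason why a linear resolution is automatically minimal: each term of a linear form
  is a scalar times an indeterminate.\<close>

lemma linear_form_in_genideal_vars:
  fixes p :: "('v, 'k::field) mpoly"
  assumes p: "p \<in> carrier (poly_ring V)" "homogeneous 1 p"
  shows "p \<in> genideal (poly_ring V) (var ` V)"
proof -
  have var: "var ` V \<subseteq> (carrier (poly_ring V) :: ('v, 'k) mpoly set)"
    by (auto simp: var_def monomial_def poly_ring_carrier_iff split: if_splits)
  note ideal = PR.genideal_ideal[OF var]
  have "Poly_Mapping.single m (Poly_Mapping.lookup p m) \<in> genideal (poly_ring V) (var ` V)"
    if m: "m \<in> Poly_Mapping.keys p" for m
  proof -
    have deg: "monom_degree m = 1"
      using p(2) m homogeneous_iff[of 1 p] by simp
    then obtain v where v: "v \<in> Poly_Mapping.keys m"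
      using monom_degree_zero by (metis One_nat_def ex_in_conv keys_eq_empty zero_neq_one)
    let ?r = "m - Poly_Mapping.single v 1"
    have "?r = 0"
      using deg monom_degree_minus_single[OF v] by (simp add: monom_degree_eq_0_iff)
    then have "m = Poly_Mapping.single v 1"
      using single_add_minus[OF v] by simp
    moreover have "v \<in> V" using v m p(1) by (auto simp: poly_ring_carrier_iff)
    moreover have "Poly_Mapping.single (Poly_Mapping.single v 1) c =
        Poly_Mapping.single 0 c * (var v :: ('v, 'k) mpoly)" for c
      by (simp add: var_def monomial_def mult_single)
    ultimately show ?thesis
      using PR.genideal_self[OF var] by (auto intro!: ideal_closed(3)[OF ideal] simp: poly_ring_carrier_iff)
  qed
  then show ?thesis
    by (subst poly_mapping_expand) (rule ideal_closed(4)[OF ideal])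
qed

definition homogeneous_part :: "nat \<Rightarrow> ('v, 'k::field) mpoly \<Rightarrow> ('v, 'k) mpoly" where
  "homogeneous_part e p = Abs_poly_mapping (\<lambda>m. Poly_Mapping.lookup p m when monom_degree m = e)"

lemma lookup_homogeneous_part:
  "Poly_Mapping.lookup (homogeneous_part e p) m = (Poly_Mapping.lookup p m when monom_degree m = e)"
proof -
  have "finite {m. (Poly_Mapping.lookup p m when monom_degree m = e) \<noteq> 0}"
    by (rule finite_subset[OF _ finite_keys[of p]]) (auto simp: in_keys_iff)
  then show ?thesis by (simp add: homogeneous_part_def)
qed

lemma homogeneous_part_add: "homogeneous_part e (p + q) = homogeneous_part e p + homogeneous_part e q"
  by (rule poly_mapping_eqI) (simp add: lookup_homogeneous_part lookup_add when_def)

lemma homogeneous_part_sum: "homogeneous_part e (sum f S) = (\<Sum>i \<in> S. homogeneous_part e (f i))"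
  by (rule poly_mapping_eqI) (simp add: lookup_homogeneous_part lookup_sum when_def)

lemma homogeneous_homogeneous_part: "homogeneous (int e) (homogeneous_part e p)"
  by (auto simp: homogeneous_iff in_keys_iff lookup_homogeneous_part when_def split: if_splits)

lemma homogeneous_part_id: "homogeneous (int e) p \<Longrightarrow> homogeneous_part e p = p"
  by (rule poly_mapping_eqI) (auto simp: homogeneous_iff in_keys_iff lookup_homogeneous_part when_def)

lemma homogeneous_part_carrier:
  "p \<in> carrier (poly_ring V) \<Longrightarrow> homogeneous_part e p \<in> carrier (poly_ring V)"
  by (auto simp: poly_ring_carrier_iff in_keys_iff lookup_homogeneous_part when_def split: if_splits)

text \<open>The terms of \<open>p\<close> outside degree \<open>f\<close> contribute to
  \<open>q * p\<close> only outside degree \<open>e + f\<close>.\<close>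

lemma homogeneous_part_mult:
  fixes p q :: "('v, 'k::field) mpoly"
  assumes "homogeneous (int e) q"
  shows "homogeneous_part (e + f) (q * p) = q * homogeneous_part f p"
proof -
  let ?p = "homogeneous_part f p"
  have deg: "\<exists>b \<in> Poly_Mapping.keys x. monom_degree m = e + monom_degree b"
    if m: "m \<in> Poly_Mapping.keys (q * x)" for m x
  proof -
    obtain a b where "m = a + b" "a \<in> Poly_Mapping.keys q" "b \<in> Poly_Mapping.keys x"
      using keys_mult[of q x] m by blast
    then show ?thesis using assms by (auto simp: homogeneous_iff monom_degree_add)
  qed
  have "homogeneous (int (e + f)) (q * ?p)"
    using deg[of _ ?p] homogeneous_homogeneous_part[of f p] unfolding homogeneous_iff by fastforce
  then have 1: "homogeneous_part (e + f) (q * ?p) = q * ?p"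
    by (rule homogeneous_part_id)
  have rest: "monom_degree b \<noteq> f" if "b \<in> Poly_Mapping.keys (p - ?p)" for b
    using that by (auto simp: in_keys_iff lookup_minus lookup_homogeneous_part)
  have 2: "homogeneous_part (e + f) (q * (p - ?p)) = 0"
  proof (rule poly_mapping_eqI)
    fix m
    show "Poly_Mapping.lookup (homogeneous_part (e + f) (q * (p - ?p))) m = Poly_Mapping.lookup 0 m"
      using deg[of m "p - ?p"] rest by (fastforce simp: lookup_homogeneous_part when_def in_keys_iff)
  qed
  have "q * p = q * ?p + q * (p - ?p)" by (simp add: right_diff_distrib)
  then show ?thesis using 1 2 by (simp add: homogeneous_part_add)
qed

text \<open>Together with its mirror image below, this lets a chain map between complexes with
  homogeneous differentials be replaced by a homogeneous part without losing the commuting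
  squares.\<close>

lemma map_homogeneous_part_mult_left:
  assumes D: "D \<in> carrier_mat r n" and A: "A \<in> carrier_mat n s"
    and hom: "elements_mat D \<subseteq> {p. homogeneous (int e) p}"
  shows "map_mat (homogeneous_part (e + f)) (D * A) = D * map_mat (homogeneous_part f) A"
proof (rule eq_matI)
  fix i j
  assume "i < dim_row (D * map_mat (homogeneous_part f) A)"
    "j < dim_col (D * map_mat (homogeneous_part f) A)"
  then have ij: "i < r" "j < s" using D A by auto
  have "homogeneous (int e) (D $$ (i, k))" if "k < n" for k
    using hom elements_matI[OF D _ that refl] ij by auto
  then show "map_mat (homogeneous_part (e + f)) (D * A) $$ (i, j) =
      (D * map_mat (homogeneous_part f) A) $$ (i, j)"
    using D A ij by (auto simp: scalar_prod_def homogeneous_part_sum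
        intro!: sum.cong homogeneous_part_mult)
qed (use D A in auto)

lemma map_homogeneous_part_mult_right:
  assumes A: "A \<in> carrier_mat r n" and E: "E \<in> carrier_mat n s"
    and hom: "elements_mat E \<subseteq> {p. homogeneous (int e) p}"
  shows "map_mat (homogeneous_part (f + e)) (A * E) = map_mat (homogeneous_part f) A * E"
proof (rule eq_matI)
  have mult: "homogeneous_part (f + e) (p * q) = homogeneous_part f p * q"
    if "homogeneous (int e) q" for p q :: "('a, 'b) mpoly"
    using homogeneous_part_mult[OF that, of f p] by (simp add: ac_simps)
  fix i j
  assume "i < dim_row (map_mat (homogeneous_part f) A * E)"
    "j < dim_col (map_mat (homogeneous_part f) A * E)"
  then have ij: "i < r" "j < s" using A E by auto
  have "homogeneous (int e) (E $$ (k, j))" if "k < n" for k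
    using hom elements_matI[OF E that _ refl] ij by auto
  then show "map_mat (homogeneous_part (f + e)) (A * E) $$ (i, j) =
      (map_mat (homogeneous_part f) A * E) $$ (i, j)"
    using A E ij by (auto simp: scalar_prod_def homogeneous_part_sum intro!: sum.cong mult)
qed (use A E in auto)

section \<open>Linear resolutions and Betti numbers\<close>

text \<open>Position 0 is the ring and the single row of \<open>D 0\<close> lists generators of
  degree \<open>t\<close>; all later entries are linear forms. The free module of index q in a
  resolution of \<open>I\<close> is thus the one at position q + 1.\<close>

definition linear_resolution ::
    "'v set \<Rightarrow> nat \<Rightarrow> ('v, 'k::field) mpoly set \<Rightarrow> (nat \<Rightarrow> nat) \<Rightarrow> (nat \<Rightarrow> ('v, 'k) mpoly mat) \<Rightarrow> bool" where
  "linear_resolution V t I r D \<longleftrightarrow>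
     r 0 = 1 \<and> PV.exact_complex V r D \<and>
     (\<forall>q. elements_mat (D q) \<subseteq> {p. homogeneous (int (if q = 0 then t else 1)) p}) \<and>
     I = {(D 0 *\<^sub>v v) $ 0 | v. v \<in> PV.cvec V (r 1)}"

lemma vec1_eq_iff: "v \<in> carrier_vec 1 \<Longrightarrow> w \<in> carrier_vec 1 \<Longrightarrow> v = w \<longleftrightarrow> v $ 0 = w $ 0"
  by (auto intro: eq_vecI)

lemma index_1x1_mult_vec: "v \<in> carrier_vec 1 \<Longrightarrow> (mat 1 1 (\<lambda>_. u) *\<^sub>v v) $ 0 = u * v $ 0"
  by (simp add: scalar_prod_def)

text \<open>\<open>colon\<close> states that \<open>L\<close> is the colon ideal I : u, so
  multiplication by \<open>u\<close> gives an exact sequence 0 -> R/L -> R/I -> R/(I + (u)) -> 0,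
  and the cone over a lift of this multiplication resolves the last module. One direction of
  \<open>colon\<close> lets the multiplication be lifted, the other is the injectivity that the cone
  needs.\<close>

lemma linear_resolution_add_generator:
  fixes u :: "('v, 'k::field) mpoly"
  assumes I: "linear_resolution V t I r D" and L: "linear_resolution V 1 L s E"
    and u: "u \<in> carrier (poly_ring V)" "homogeneous (int t) u"
    and colon: "\<And>w. w \<in> carrier (poly_ring V) \<Longrightarrow> u * w \<in> I \<longleftrightarrow> w \<in> L"
  shows "\<exists>D'. linear_resolution V t {p + u * w | p w. p \<in> I \<and> w \<in> carrier (poly_ring V)}
           (cone_rank r s) D'"
proof -
  have r0: "r 0 = 1" and s0: "s 0 = 1"
    and D: "PV.exact_complex V r D" and E: "PV.exact_complex V s E"
    and homD: "\<And>q. elements_mat (D q) \<subseteq> {p. homogeneous (int (if q = 0 then t else 1)) p}"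
    and I_eq: "I = {(D 0 *\<^sub>v v) $ 0 | v. v \<in> PV.cvec V (r 1)}"
    and L_eq: "L = {(E 0 *\<^sub>v v) $ 0 | v. v \<in> PV.cvec V (s 1)}"
    using I L by (auto simp: linear_resolution_def)
  have homE: "elements_mat (E q) \<subseteq> {p. homogeneous (int 1) p}" for q
    using L unfolding linear_resolution_def by (metis (full_types))
  note Dc = PV.exact_complex_cmat[OF D] and Ec = PV.exact_complex_cmat[OF E]
  note c = PV.cmat_carrier[OF Dc] PV.cmat_carrier[OF Ec]
  have dims: "dim_row (D 0) = 1" "dim_row (E 0) = 1"
    using c(1)[of 0] c(2)[of 0] r0 s0 by auto
  have D0: "D 0 *\<^sub>v v \<in> carrier_vec 1" and E0: "E 0 *\<^sub>v v \<in> carrier_vec 1" for v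
    using c(1)[of 0] c(2)[of 0] r0 s0 by (auto intro!: carrier_vecI)
  define A0 where "A0 = mat 1 1 (\<lambda>_. u)"
  have A0: "A0 \<in> PV.cmat V (r 0) (s 0)"
    using u by (simp add: A0_def PV.cmat_iff r0 s0)
  have A0v: "A0 *\<^sub>v v \<in> carrier_vec 1" for v
    by (auto simp: A0_def intro!: carrier_vecI)
  have lift: "\<exists>v \<in> PV.cvec V (r 1). A0 *\<^sub>v (E 0 *\<^sub>v w) = D 0 *\<^sub>v v" if w: "w \<in> PV.cvec V (s 1)" for w
  proof -
    have "(E 0 *\<^sub>v w) $ 0 \<in> carrier (poly_ring V)"
      using PV.cmat_mult_vec[OF Ec[of 0], of w] w s0 by (auto simp: PV.cvec_iff)
    moreover have "(E 0 *\<^sub>v w) $ 0 \<in> L" using w L_eq by blast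
    ultimately have "u * (E 0 *\<^sub>v w) $ 0 \<in> I" using colon by blast
    then obtain v where "v \<in> PV.cvec V (r 1)" "u * (E 0 *\<^sub>v w) $ 0 = (D 0 *\<^sub>v v) $ 0"
      using I_eq by blast
    then show ?thesis
      using vec1_eq_iff[OF A0v D0] index_1x1_mult_vec[OF E0] unfolding A0_def by metis
  qed
  obtain A where A: "A 0 = A0" "\<And>q. A q \<in> PV.cmat V (r q) (s q)"
    "\<And>q. D q * A (Suc q) = A q * E q"
    using PV.chain_map_lift[OF D E A0 lift] by metis
  \<comment> \<open>The expected degrees: multiplication by \<open>u\<close> has degree
    \<open>t\<close>. At a position q > 0 the basis of the complex of \<open>I\<close> has degree t
    + q - 1 and that of the complex of \<open>L\<close>, shifted by t, has degree t + q, so the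
    comparison matrix must be linear.\<close>
  define dg where "dg q = (if q = 0 then t else 1)" for q :: nat
  define B where "B q = map_mat (homogeneous_part (dg q)) (A q)" for q
  have B: "B q \<in> PV.cmat V (r q) (s q)" for q
    using A(2)[of q] by (auto simp: B_def PV.cmat_iff homogeneous_part_carrier)
  have B0: "B 0 = A0"
    using homogeneous_part_id[OF u(2)] by (auto simp: B_def A(1) A0_def dg_def)
  have DB: "D q * B (Suc q) = B q * E q" for q
  proof -
    have "D q * B (Suc q) = map_mat (homogeneous_part (dg q + 1)) (D q * A (Suc q))"
      unfolding B_def using homD[of q]
      by (subst map_homogeneous_part_mult_left[OF c(1) PV.cmat_carrier[OF A(2)]]) (auto simp: dg_def)
    also have "\<dots> = B q * E q"
      unfolding B_def A(3)
      by (rule map_homogeneous_part_mult_right[OF PV.cmat_carrier[OF A(2)] c(2) homE])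
    finally show ?thesis .
  qed
  let ?F = "cone_map r s D E B"
  have D0minus: "(D 0 *\<^sub>v (- v)) $ 0 = - ((D 0 *\<^sub>v v) $ 0)" if "v \<in> PV.cvec V (r 1)" for v
  proof -
    have "D 0 *\<^sub>v (- v) = - (D 0 *\<^sub>v v)"
      using mult_mat_uminus_vec[OF c(1)[of 0], of v] that by auto
    then show ?thesis using dims by simp
  qed
  have ex: "PV.exact_complex V (cone_rank r s) ?F"
  proof (rule PV.mapping_cone_exact[OF D E B DB])
    fix v w assume v: "v \<in> PV.cvec V (r 1)" and w: "w \<in> PV.cvec V (s 0)"
      and eq: "D 0 *\<^sub>v v + B 0 *\<^sub>v w = 0\<^sub>v (r 0)"
    have w': "w \<in> carrier_vec 1" "w $ 0 \<in> carrier (poly_ring V)"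
      using w unfolding PV.cvec_iff s0 by auto
    have "(D 0 *\<^sub>v v + B 0 *\<^sub>v w) $ 0 = 0" unfolding eq by (simp add: r0)
    then have "(D 0 *\<^sub>v v) $ 0 + u * w $ 0 = 0"
      using index_1x1_mult_vec[OF w'(1), of u] A0v[of w, unfolded A0_def]
      unfolding B0 A0_def by (simp del: index_mult_mat_vec)
    then have "u * w $ 0 = (D 0 *\<^sub>v (- v)) $ 0"
      unfolding D0minus[OF v] by (rule eq_neg_iff_add_eq_0[THEN iffD2, OF add.commute[THEN trans]])
    then have "u * w $ 0 \<in> I"
      using PV.cvec_uminus[OF v] I_eq by blast
    then have "w $ 0 \<in> L" using colon w' by blast
    then obtain x where "x \<in> PV.cvec V (s 1)" "w $ 0 = (E 0 *\<^sub>v x) $ 0" using L_eq by blast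
    then show "\<exists>x \<in> PV.cvec V (s 1). w = E 0 *\<^sub>v x"
      using vec1_eq_iff[OF w'(1) E0] by blast
  qed
  have homB: "elements_mat (B q) \<subseteq> {p. homogeneous (int (dg q)) p}" for q
    unfolding B_def by (auto simp: homogeneous_homogeneous_part)
  have hom0: "homogeneous e (0 :: ('v, 'k) mpoly)" for e by (simp add: homogeneous_def)
  have hom: "elements_mat (?F q) \<subseteq> {p. homogeneous (int (if q = 0 then t else 1)) p}" for q
  proof (cases q)
    case 0
    have "elements_mat (?F q) \<subseteq> elements_mat (D 0) \<union> elements_mat (B 0) \<union>
        elements_mat (0\<^sub>m 0 (r 1)) \<union> elements_mat (0\<^sub>m 0 (s 0))"
      unfolding cone_map_def 0 nat.case
      by (rule elements_four_block_mat[OF c(1)[of 0, folded One_nat_def] PV.cmat_carrier[OF B]]) auto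
    then show ?thesis
      using homD[of 0] homB[of 0] elements_0_mat[of 0 "r 1"] elements_0_mat[of 0 "s 0"] 0 hom0
      by (fastforce simp: dg_def)
  next
    case (Suc p)
    have "elements_mat (?F q) \<subseteq> elements_mat (D q) \<union> elements_mat (B q) \<union>
        elements_mat (0\<^sub>m (s p) (r (Suc q))) \<union> elements_mat (- E p)"
      unfolding cone_map_def Suc nat.case
      by (rule elements_four_block_mat[OF c(1) PV.cmat_carrier[OF B] zero_carrier_mat
            uminus_carrier_mat[OF c(2)]])
    moreover have "elements_mat (- E p) \<subseteq> {p. homogeneous (int 1) p}"
    proof
      fix x assume "x \<in> elements_mat (- E p)"
      then obtain i j where "x = (- E p) $$ (i, j)" "i < dim_row (E p)" "j < dim_col (E p)"
        by auto
      then have "x = - (E p $$ (i, j))" "E p $$ (i, j) \<in> elements_mat (E p)"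
        by auto
      then show "x \<in> {p. homogeneous (int 1) p}"
        using homE[of p] by (auto simp: homogeneous_def keys_uminus)
    qed
    ultimately show ?thesis
      using homD[of q] homB[of q] elements_0_mat[of "s p" "r (Suc q)"] Suc hom0
      by (fastforce simp: dg_def)
  qed
  have img: "(?F 0 *\<^sub>v (v @\<^sub>v w)) $ 0 = (D 0 *\<^sub>v v) $ 0 + u * w $ 0"
    if "v \<in> PV.cvec V (r 1)" "w \<in> PV.cvec V (s 0)" for v w
  proof -
    have w: "w \<in> carrier_vec 1" using that s0 by auto
    have "?F 0 *\<^sub>v (v @\<^sub>v w) = (D 0 *\<^sub>v v + B 0 *\<^sub>v w) @\<^sub>v vNil"
      using PV.cone_map_mult_vec[where D = D and r = r and E = E and s = s and A = B and v = v
          and w = w and q = 0, OF Dc Ec B] that by simp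
    then show ?thesis
      using index_1x1_mult_vec[OF w, of u] dims
      unfolding B0 A0_def by (simp del: index_mult_mat_vec)
  qed
  have r1: "cone_rank r s 1 = r 1 + s 0" by (simp add: cone_rank_def)
  have "{p + u * w | p w. p \<in> I \<and> w \<in> carrier (poly_ring V)} =
        {(?F 0 *\<^sub>v y) $ 0 | y. y \<in> PV.cvec V (cone_rank r s 1)}"
  proof (intro equalityI subsetI; clarify)
    fix p w :: "('v, 'k) mpoly" assume "p \<in> I" and w: "w \<in> carrier (poly_ring V)"
    then obtain v where v: "v \<in> PV.cvec V (r 1)" "p = (D 0 *\<^sub>v v) $ 0" using I_eq by blast
    have w': "vec 1 (\<lambda>_. w) \<in> PV.cvec V (s 0)" using w s0 by (simp add: PV.cvec_iff)
    have "(?F 0 *\<^sub>v (v @\<^sub>v vec 1 (\<lambda>_. w))) $ 0 = p + u * w"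
      using img[OF v(1) w'] v(2) by simp
    then show "\<exists>y. p + u * w = (?F 0 *\<^sub>v y) $ 0 \<and> y \<in> PV.cvec V (cone_rank r s 1)"
      using PV.cvec_append[OF v(1) w'] unfolding r1 by metis
  next
    fix y :: "('v, 'k) mpoly vec" assume "y \<in> PV.cvec V (cone_rank r s 1)"
    then obtain v w where vw: "v \<in> PV.cvec V (r 1)" "w \<in> PV.cvec V (s 0)" "y = v @\<^sub>v w"
      unfolding r1 using PV.cvec_split by metis
    then show "\<exists>p w. (?F 0 *\<^sub>v y) $ 0 = p + u * w \<and> p \<in> I \<and> w \<in> carrier (poly_ring V)"
      using img[OF vw(1,2)] s0 I_eq vw by (auto simp: PV.cvec_iff)
  qed
  moreover have "cone_rank r s 0 = 1" using r0 by (simp add: cone_rank_def)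
  ultimately show ?thesis using ex hom unfolding linear_resolution_def by blast
qed

text \<open>Start of both inductions that add generators. The matrices have no entries, so every
  \<open>t\<close> is admissible.\<close>

lemma linear_resolution_zero_ideal:
  "\<exists>D. linear_resolution V t ({0} :: ('v, 'k::field) mpoly set) (\<lambda>q. if q = 0 then 1 else 0) D"
proof -
  let ?r = "\<lambda>q :: nat. if q = 0 then 1 else 0 :: nat"
  let ?D = "\<lambda>q. 0\<^sub>m (?r q) 0 :: ('v, 'k) mpoly mat"
  have v0: "PV.cvec V 0 = {vNil :: ('v, 'k) mpoly vec}"
    by (auto simp: PV.cvec_iff)
  have e: "elements_mat (?D q) = {}" for q by (auto simp: elements_mat_def)
  have "linear_resolution V t {0} ?r ?D"
    unfolding linear_resolution_def PV.exact_complex_def e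
    by (auto simp: v0 PV.cmat_iff scalar_prod_def intro!: eq_vecI)
  then show ?thesis by blast
qed

section \<open>Augmented complexes and uniqueness of Betti numbers\<close>

fun augmented_rank :: "(nat \<Rightarrow> nat) \<Rightarrow> nat \<Rightarrow> nat" where
  "augmented_rank rk 0 = 1"
| "augmented_rank rk (Suc q) = rk q"

fun augmented_map :: "'a vec \<Rightarrow> (nat \<Rightarrow> 'a mat) \<Rightarrow> nat \<Rightarrow> 'a mat" where
  "augmented_map g D 0 = mat 1 (dim_vec g) (\<lambda>(i, j). g $ j)"
| "augmented_map g D (Suc q) = D q"

lemma augmented_map_0_mult_vec:
  "augmented_map g D 0 *\<^sub>v v = vec 1 (\<lambda>_. g \<bullet> v)"
proof -
  have "row (mat 1 (dim_vec g) (\<lambda>(i, j). g $ j)) 0 = g" by (intro eq_vecI) auto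
  then show ?thesis by (intro eq_vecI) auto
qed

text \<open>With the augmentation \<open>g\<close> written as a matrix with one row, the condition
  on its kernel becomes exactness at position 1, and the ideal is recovered as the image of the
  first map.\<close>

lemma graded_free_resolution_exact_complex:
  fixes g :: "('v, 'k::field) mpoly vec"
  assumes "graded_free_resolution V I rk a g D"
  shows "PV.exact_complex V (augmented_rank rk) (augmented_map g D)"
    and "I = {(augmented_map g D 0 *\<^sub>v v) $ 0 | v. v \<in> PV.cvec V (augmented_rank rk 1)}"
proof -
  note a = assms[unfolded graded_free_resolution_def free_module_eq]
  from a have g: "g \<in> PV.cvec V (rk 0)" and Dq: "D q \<in> PV.cmat V (rk q) (rk (Suc q))" for q
    by (auto simp: PV.cmat_def)
  from a have I: "{g \<bullet> v | v. v \<in> PV.cvec V (rk 0)} = I"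
    and k0: "{v \<in> PV.cvec V (rk 0). g \<bullet> v = 0} = {D 0 *\<^sub>v w | w. w \<in> PV.cvec V (rk 1)}"
    and kS: "{v \<in> PV.cvec V (rk (Suc q)). D q *\<^sub>v v = 0\<^sub>v (rk q)} =
          {D (Suc q) *\<^sub>v w | w. w \<in> PV.cvec V (rk (Suc (Suc q)))}" for q by auto
  have z: "vec 1 (\<lambda>_. x) = 0\<^sub>v 1 \<longleftrightarrow> x = 0" for x :: "('v, 'k) mpoly"
    by (subst vec1_eq_iff) auto
  show "I = {(augmented_map g D 0 *\<^sub>v v) $ 0 | v. v \<in> PV.cvec V (augmented_rank rk 1)}"
    using I by (simp add: augmented_map_0_mult_vec del: augmented_map.simps)
  have "augmented_map g D q \<in> PV.cmat V (augmented_rank rk q) (augmented_rank rk (Suc q))" for q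
    using g Dq by (cases q) (auto simp: PV.cmat_iff PV.cvec_iff)
  moreover have "{v \<in> PV.cvec V (augmented_rank rk (Suc q)).
        augmented_map g D q *\<^sub>v v = 0\<^sub>v (augmented_rank rk q)} =
      {augmented_map g D (Suc q) *\<^sub>v w | w. w \<in> PV.cvec V (augmented_rank rk (Suc (Suc q)))}" for q
  proof (cases q)
    case 0
    then show ?thesis
      using k0 z by (simp add: augmented_map_0_mult_vec del: augmented_map.simps(1))
  next
    case (Suc p)
    then show ?thesis using kS[of p] by simp
  qed
  ultimately show "PV.exact_complex V (augmented_rank rk) (augmented_map g D)"
    unfolding PV.exact_complex_def by blast
qed

text \<open>All basis elements of the free module of index q get degree \<open>t + q\<close>, which
  fits linear differentials; linear entries lie in the ideal of the indeterminates.\<close>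

lemma linear_resolution_minimal:
  fixes D :: "nat \<Rightarrow> ('v, 'k::field) mpoly mat"
  assumes "linear_resolution V t I r D"
  shows "minimal_graded_free_resolution V I (\<lambda>q. r (Suc q)) (\<lambda>q _. int (t + q)) (row (D 0) 0)
           (\<lambda>q. D (Suc q))"
proof -
  let ?g = "row (D 0) 0"
  have r0: "r 0 = 1" and ex: "PV.exact_complex V r D"
    and hom: "\<And>q. elements_mat (D q) \<subseteq> {p. homogeneous (int (if q = 0 then t else 1)) p}"
    and I: "I = {(D 0 *\<^sub>v v) $ 0 | v. v \<in> PV.cvec V (r 1)}"
    using assms by (auto simp: linear_resolution_def)
  note c = PV.exact_complex_cmat[OF ex]
  have D0: "D 0 \<in> carrier_mat 1 (r 1)" using c[of 0] r0 by auto
  have entry: "homogeneous (int (if q = 0 then t else 1)) (D q $$ (i, j))"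
    if "i < r q" "j < r (Suc q)" for i j q
    using hom[of q] elements_matI[OF PV.cmat_carrier[OF c[of q]] that refl] by blast
  have g0: "D 0 *\<^sub>v v = 0\<^sub>v 1 \<longleftrightarrow> ?g \<bullet> v = 0" for v
    using D0 by (subst vec1_eq_iff) (auto intro!: carrier_vecI)
  have g: "(D 0 *\<^sub>v v) $ 0 = ?g \<bullet> v" for v using D0 by simp
  have "graded_free_resolution V I (\<lambda>q. r (Suc q)) (\<lambda>q _. int (t + q)) ?g (\<lambda>q. D (Suc q))"
    unfolding graded_free_resolution_def free_module_eq
  proof (intro conjI allI impI)
    show "?g \<in> PV.cvec V (r (Suc 0))"
    proof -
      have "\<forall>j < r (Suc 0). D 0 $$ (0, j) \<in> carrier (poly_ring V)"
        using c[of 0] unfolding PV.cmat_iff r0 by simp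
      moreover have "?g \<in> carrier_vec (r (Suc 0))"
        using row_carrier_vec[OF _ D0, of 0] by simp
      ultimately show ?thesis using D0 by (simp add: PV.cvec_iff)
    qed
    show "homogeneous (int (t + 0)) (?g $ i)" if "i < r (Suc 0)" for i
      using entry[of 0 0 i] that D0 r0 by simp
    show "D (Suc q) \<in> carrier_mat (r (Suc q)) (r (Suc (Suc q)))"
      "elements_mat (D (Suc q)) \<subseteq> carrier (poly_ring V)" for q
      using c[of "Suc q"] by (auto simp: PV.cmat_def)
    show "homogeneous (int (t + Suc q) - int (t + q)) (D (Suc q) $$ (i, j))"
      if "i < r (Suc q)" "j < r (Suc (Suc q))" for i j q
      using entry[of i "Suc q" j] that by simp
    show "{?g \<bullet> v | v. v \<in> PV.cvec V (r (Suc 0))} = I"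
      using I g by simp
    show "{v \<in> PV.cvec V (r (Suc 0)). ?g \<bullet> v = 0} = {D (Suc 0) *\<^sub>v w | w. w \<in> PV.cvec V (r (Suc 1))}"
    proof -
      have "{v \<in> PV.cvec V (r (Suc 0)). D 0 *\<^sub>v v = 0\<^sub>v (r 0)} =
          {D (Suc 0) *\<^sub>v w | w. w \<in> PV.cvec V (r (Suc (Suc 0)))}"
        using ex unfolding PV.exact_complex_def by blast
      then show ?thesis by (simp only: r0 g0[unfolded One_nat_def] One_nat_def)
    qed
    show "{v \<in> PV.cvec V (r (Suc (Suc q))). D (Suc q) *\<^sub>v v = 0\<^sub>v (r (Suc q))} =
        {D (Suc (Suc q)) *\<^sub>v w | w. w \<in> PV.cvec V (r (Suc (Suc (Suc q))))}" for q
      using ex unfolding PV.exact_complex_def by blast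
  qed
  moreover have "elements_mat (D (Suc q)) \<subseteq> genideal (poly_ring V) (var ` V)" for q
  proof
    fix p assume p: "p \<in> elements_mat (D (Suc q))"
    then have "p \<in> carrier (poly_ring V)"
      using c[of "Suc q"] unfolding PV.cmat_def by blast
    moreover have "homogeneous 1 p" using p hom[of "Suc q"] by auto
    ultimately show "p \<in> genideal (poly_ring V) (var ` V)"
      by (rule linear_form_in_genideal_vars)
  qed
  ultimately show ?thesis by (simp add: minimal_graded_free_resolution_def)
qed

text \<open>Used in both directions, this makes the rank in each degree unique and so justifies the
  definite description in \<open>betti\<close>.\<close>

lemma minimal_graded_free_resolution_rank_le:
  fixes I :: "('v, 'k::field) mpoly set"
  assumes D: "minimal_graded_free_resolution V I rk a g D"
    and E: "minimal_graded_free_resolution V I rk' a' g' E"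
  shows "rk q \<le> rk' q"
proof -
  let ?D = "augmented_map g D" and ?E = "augmented_map g' E"
  let ?r = "augmented_rank rk" and ?s = "augmented_rank rk'"
  let ?c = "\<lambda>p :: ('v, 'k) mpoly. Poly_Mapping.lookup p 0"
  from D E have res: "graded_free_resolution V I rk a g D" "graded_free_resolution V I rk' a' g' E"
    and min: "\<And>q. elements_mat (D q) \<subseteq> genideal (poly_ring V) (var ` V)"
    by (auto simp: minimal_graded_free_resolution_def)
  note ex = graded_free_resolution_exact_complex(1)[OF res(1)] graded_free_resolution_exact_complex(1)[OF res(2)]
  have D0: "?D 0 *\<^sub>v v = vec 1 (\<lambda>_. (?D 0 *\<^sub>v v) $ 0)" and E0: "?E 0 *\<^sub>v v = vec 1 (\<lambda>_. (?E 0 *\<^sub>v v) $ 0)" for v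
    by (intro eq_vecI; simp)+
  \<comment> \<open>The two resolutions share the ideal, a set of polynomials, while the comparison
    needs equal images as sets of vectors of length 1; \<open>h\<close> stands for the passage from
    an entry to its vector.\<close>
  have aux: "{F v | v. P v} = h ` {F v $ 0 | v. P v}" if F: "\<And>v. F v = h (F v $ 0)"
    for F :: "('v, 'k) mpoly vec \<Rightarrow> ('v, 'k) mpoly vec" and P h
  proof (intro equalityI subsetI)
    fix x assume "x \<in> {F v | v. P v}"
    then obtain v where v: "P v" "x = F v" by blast
    then have "x = h (F v $ 0)" using F by metis
    with v show "x \<in> h ` {F v $ 0 | v. P v}" by blast
  next
    fix x assume "x \<in> h ` {F v $ 0 | v. P v}"
    then obtain v where v: "P v" "x = h (F v $ 0)" by blast
    then have "x = F v" using F by metis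
    with v show "x \<in> {F v | v. P v}" by blast
  qed
  have img: "{?D 0 *\<^sub>v v | v. v \<in> PV.cvec V (?r 1)} = {?E 0 *\<^sub>v v | v. v \<in> PV.cvec V (?s 1)}"
  proof -
    have "{?D 0 *\<^sub>v v | v. v \<in> PV.cvec V (?r 1)} = (\<lambda>x. vec 1 (\<lambda>_. x)) ` I"
      unfolding graded_free_resolution_exact_complex(2)[OF res(1)]
      by (rule aux[of "\<lambda>v. ?D 0 *\<^sub>v v", OF D0])
    also have "\<dots> = {?E 0 *\<^sub>v v | v. v \<in> PV.cvec V (?s 1)}"
      unfolding graded_free_resolution_exact_complex(2)[OF res(2)]
      by (rule aux[of "\<lambda>v. ?E 0 *\<^sub>v v", OF E0, symmetric])
    finally show ?thesis .
  qed
  have "map_mat ?c (?D (Suc q)) = 0\<^sub>m (?r (Suc q)) (?r (Suc (Suc q)))" for q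
  proof -
    have c: "D q \<in> carrier_mat (rk q) (rk (Suc q))"
      using PV.exact_complex_cmat[OF ex(1), of "Suc q"] by auto
    have "?c (D q $$ (i, j)) = 0" if "i < rk q" "j < rk (Suc q)" for i j
      using genideal_vars_constant_term min[of q] elements_matI[OF c that refl] by blast
    then show ?thesis using c by (intro eq_matI) auto
  qed
  then have "?r (Suc q) \<le> ?s (Suc q)"
    by (intro PV.minimal_complex_rank_le[OF ex _ img comm_ring_hom_constant_term]) auto
  then show ?thesis by simp
qed

lemma betti_linear_resolution:
  fixes I :: "('v, 'k::field) mpoly set"
  assumes "linear_resolution V t I r D"
  shows "betti V I q = r (Suc q)"
  unfolding betti_def
proof (rule the_equality)
  note min = linear_resolution_minimal[OF assms]
  then show "\<exists>rk a g D. minimal_graded_free_resolution V I rk a g D \<and> rk q = r (Suc q)"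
    by fast
  fix b assume "\<exists>rk a g D. minimal_graded_free_resolution V I rk a g D \<and> rk q = b"
  then show "b = r (Suc q)"
    using minimal_graded_free_resolution_rank_le[OF min]
      minimal_graded_free_resolution_rank_le[OF _ min] by (metis le_antisym)
qed

section \<open>Stable monomial ideals\<close>

lemma monom_add_iff_le:
  fixes m k :: "'v monom"
  shows "(\<exists>l. k = m + l) \<longleftrightarrow> (\<forall>v. Poly_Mapping.lookup m v \<le> Poly_Mapping.lookup k v)"
proof
  assume le: "\<forall>v. Poly_Mapping.lookup m v \<le> Poly_Mapping.lookup k v"
  have "k = m + (k - m)"
    using le by (intro poly_mapping_eqI) (simp add: lookup_add lookup_minus)
  then show "\<exists>l. k = m + l" ..
qed (auto simp: lookup_add)

lemma single_add_iff:
  fixes k :: "'v monom"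
  shows "(\<exists>l. k = Poly_Mapping.single v 1 + l) \<longleftrightarrow> v \<in> Poly_Mapping.keys k"
  unfolding monom_add_iff_le by (auto simp: lookup_single when_def in_keys_iff Suc_le_eq)

text \<open>Divisibility of monomials appears as additive decomposition of exponents. Membership is
  decided term by term, so colon ideals can be computed on monomials alone.\<close>

definition monomial_ideal :: "'v set \<Rightarrow> 'v monom set \<Rightarrow> ('v, 'k::field) mpoly set" where
  "monomial_ideal V M =
     {p \<in> carrier (poly_ring V). \<forall>k \<in> Poly_Mapping.keys p. \<exists>m \<in> M. \<exists>l. k = m + l}"

lemma monomial_carrier: "Poly_Mapping.keys m \<subseteq> V \<Longrightarrow> monomial m \<in> carrier (poly_ring V)"
  by (auto simp: monomial_def poly_ring_carrier_iff)

lemma ideal_monomial_ideal: "ideal (monomial_ideal V M :: ('v, 'k::field) mpoly set) (poly_ring V)"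
proof (rule ideal_poly_ringI)
  fix x y :: "('v, 'k) mpoly"
  show "x + y \<in> monomial_ideal V M" if "x \<in> monomial_ideal V M" "y \<in> monomial_ideal V M"
    using that keys_add[of x y] by (auto simp: monomial_ideal_def)
  show "x * y \<in> monomial_ideal V M"
    if x: "x \<in> carrier (poly_ring V)" and y: "y \<in> monomial_ideal V M"
    unfolding monomial_ideal_def
  proof (intro CollectI conjI ballI)
    show "x * y \<in> carrier (poly_ring V)"
      using x y by (auto simp: monomial_ideal_def)
    fix k assume "k \<in> Poly_Mapping.keys (x * y)"
    then obtain a b where k: "k = a + b" "b \<in> Poly_Mapping.keys y"
      using keys_mult[of x y] by blast
    then obtain m l where "m \<in> M" "b = m + l"
      using y unfolding monomial_ideal_def by blast
    with k have "m \<in> M" "k = m + (a + l)" by (simp_all add: ac_simps)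
    then show "\<exists>m \<in> M. \<exists>l. k = m + l" by blast
  qed
qed (auto simp: monomial_ideal_def)

lemma genideal_monomials:
  assumes M: "M \<subseteq> {m. Poly_Mapping.keys m \<subseteq> V}"
  shows "genideal (poly_ring V) (monomial ` M) = (monomial_ideal V M :: ('v, 'k::field) mpoly set)"
proof
  have car: "monomial ` M \<subseteq> (carrier (poly_ring V) :: ('v, 'k) mpoly set)"
    using M by (auto intro: monomial_carrier)
  note ideal = PR.genideal_ideal[OF car]
  have "monomial m \<in> (monomial_ideal V M :: ('v, 'k) mpoly set)" if "m \<in> M" for m
    using that car by (auto simp: monomial_ideal_def monomial_def intro!: exI[of _ 0])
  then show "genideal (poly_ring V) (monomial ` M) \<subseteq> (monomial_ideal V M :: ('v, 'k) mpoly set)"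
    by (intro PR.genideal_minimal ideal_monomial_ideal) blast
  show "(monomial_ideal V M :: ('v, 'k) mpoly set) \<subseteq> genideal (poly_ring V) (monomial ` M)"
  proof
    fix p :: "('v, 'k) mpoly" assume p: "p \<in> monomial_ideal V M"
    have "Poly_Mapping.single k (Poly_Mapping.lookup p k) \<in> genideal (poly_ring V) (monomial ` M)"
      if k: "k \<in> Poly_Mapping.keys p" for k
    proof -
      obtain m l where m: "m \<in> M" "k = m + l"
        using p k unfolding monomial_ideal_def by blast
      have "Poly_Mapping.keys k \<subseteq> V"
        using p k by (simp add: monomial_ideal_def poly_ring_carrier_iff)
      then have "Poly_Mapping.keys l \<subseteq> V"
        by (simp add: m(2) keys_add_nat)
      then have "Poly_Mapping.single l c \<in> carrier (poly_ring V)" for c :: 'k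
        by (simp add: poly_ring_carrier_iff)
      moreover have "Poly_Mapping.single k c = Poly_Mapping.single l c * monomial m" for c :: 'k
        by (simp add: monomial_def mult_single m(2) add.commute)
      ultimately show ?thesis
        using PR.genideal_self[OF car] m(1) by (auto intro!: ideal_closed(3)[OF ideal])
    qed
    then show "p \<in> genideal (poly_ring V) (monomial ` M)"
      by (subst poly_mapping_expand) (rule ideal_closed(4)[OF ideal])
  qed
qed

lemma monomial_ideal_insert:
  fixes V :: "'v set"
  assumes M: "M \<subseteq> {m. Poly_Mapping.keys m \<subseteq> V}" and u: "Poly_Mapping.keys u \<subseteq> V"
  shows "monomial_ideal V (insert u M) =
    {p + monomial u * w | p w :: ('v, 'k::field) mpoly. p \<in> monomial_ideal V M \<and> w \<in> carrier (poly_ring V)}"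
    (is "_ = ?R")
proof
  note I = ideal_monomial_ideal[of V M, where 'k = 'k]
  have R: "p + monomial u * w \<in> ?R" if "p \<in> monomial_ideal V M" "w \<in> carrier (poly_ring V)"
    for p w :: "('v, 'k) mpoly" using that by blast
  have "ideal ?R (poly_ring V)"
  proof (rule ideal_poly_ringI)
    show "?R \<subseteq> carrier (poly_ring V)"
      using monomial_carrier[OF u] by (auto simp: monomial_ideal_def)
    show "0 \<in> ?R" using R[OF ideal_closed(1)[OF I], of 0] by simp
    fix x y assume y: "y \<in> ?R"
    then obtain p w where pw: "y = p + monomial u * w" "p \<in> monomial_ideal V M" "w \<in> carrier (poly_ring V)"
      by blast
    show "x + y \<in> ?R" if "x \<in> ?R"
    proof -
      obtain p' w' where pw': "x = p' + monomial u * w'" "p' \<in> monomial_ideal V M" "w' \<in> carrier (poly_ring V)"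
        using \<open>x \<in> ?R\<close> by blast
      have "x + y = (p' + p) + monomial u * (w' + w)" by (simp add: pw pw' algebra_simps)
      then show ?thesis
        using R[OF ideal_closed(2)[OF I pw'(2) pw(2)] PV.add_closed[OF pw'(3) pw(3)]] by simp
    qed
    show "x * y \<in> ?R" if x: "x \<in> carrier (poly_ring V)"
    proof -
      have "x * y = x * p + monomial u * (x * w)" by (simp add: pw algebra_simps)
      then show ?thesis
        using R[OF ideal_closed(3)[OF I x pw(2)] PV.mult_closed[OF x pw(3)]] by simp
    qed
  qed
  moreover have "monomial m \<in> ?R" if "m \<in> insert u M" for m
  proof (cases "m = u")
    case True
    then show ?thesis using R[OF ideal_closed(1)[OF I], of 1] by simp
  next
    case False
    then have "monomial m \<in> (monomial_ideal V M :: ('v, 'k) mpoly set)"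
      using that M by (auto simp: monomial_ideal_def monomial_def poly_ring_carrier_iff intro!: exI[of _ 0])
    from R[OF this, of 0] show ?thesis by simp
  qed
  ultimately have "genideal (poly_ring V) (monomial ` insert u M) \<subseteq> ?R"
    by (intro PR.genideal_minimal) blast+
  then show "monomial_ideal V (insert u M) \<subseteq> ?R"
    using M u by (subst (asm) genideal_monomials) auto
  show "?R \<subseteq> monomial_ideal V (insert u M)"
  proof clarify
    fix p w :: "('v, 'k) mpoly"
    assume p: "p \<in> monomial_ideal V M" and w: "w \<in> carrier (poly_ring V)"
    note J = ideal_monomial_ideal[of V "insert u M", where 'k = 'k]
    have "monomial u \<in> (monomial_ideal V (insert u M) :: ('v, 'k) mpoly set)"
      using u by (auto simp: monomial_ideal_def monomial_def poly_ring_carrier_iff intro!: exI[of _ 0])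
    from ideal_closed(3)[OF J w this]
    have "monomial u * w \<in> monomial_ideal V (insert u M)" by (simp add: mult.commute)
    moreover have "p \<in> monomial_ideal V (insert u M)"
      using p by (auto simp: monomial_ideal_def)
    ultimately show "p + monomial u * w \<in> monomial_ideal V (insert u M)"
      using ideal_closed(2)[OF J] by blast
  qed
qed

lemma lookup_monomial_mult:
  fixes w :: "('v, 'k::field) mpoly"
  shows "Poly_Mapping.lookup (monomial u * w) (u + k) = Poly_Mapping.lookup w k"
proof -
  have "monomial u * w = (\<Sum>m \<in> Poly_Mapping.keys w. Poly_Mapping.single (u + m) (Poly_Mapping.lookup w m))"
    by (subst (1) poly_mapping_expand[of w]) (simp add: sum_distrib_left monomial_def mult_single)
  then show ?thesis
    by (simp add: lookup_sum lookup_single when_def in_keys_iff)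
qed

lemma keys_monomial_mult:
  fixes w :: "('v, 'k::field) mpoly"
  shows "Poly_Mapping.keys (monomial u * w) = (+) u ` Poly_Mapping.keys w"
proof
  show "Poly_Mapping.keys (monomial u * w) \<subseteq> (+) u ` Poly_Mapping.keys w"
    using keys_mult[of "monomial u" w] by (auto simp: monomial_def)
  show "(+) u ` Poly_Mapping.keys w \<subseteq> Poly_Mapping.keys (monomial u * w)"
    by (auto simp: in_keys_iff lookup_monomial_mult)
qed

text \<open>Multiplication by a monomial translates the set of exponents without any cancellation,
  so the colon condition can be tested on single monomials.\<close>

lemma monomial_ideal_colon:
  fixes w :: "('v, 'k::field) mpoly"
  assumes u: "Poly_Mapping.keys u \<subseteq> V" and w: "w \<in> carrier (poly_ring V)"
    and eq: "\<And>k. Poly_Mapping.keys k \<subseteq> V \<Longrightarrow> (\<exists>m \<in> M. \<exists>l. u + k = m + l) \<longleftrightarrow> (\<exists>m \<in> L. \<exists>l. k = m + l)"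
  shows "monomial u * w \<in> monomial_ideal V M \<longleftrightarrow> w \<in> monomial_ideal V L"
proof -
  have "monomial u * w \<in> carrier (poly_ring V)" using monomial_carrier[OF u] w by blast
  then have "monomial u * w \<in> monomial_ideal V M \<longleftrightarrow>
      (\<forall>k \<in> Poly_Mapping.keys w. \<exists>m \<in> M. \<exists>l. u + k = m + l)"
    by (simp add: monomial_ideal_def keys_monomial_mult)
  also have "\<dots> \<longleftrightarrow> (\<forall>k \<in> Poly_Mapping.keys w. \<exists>m \<in> L. \<exists>l. k = m + l)"
    using w eq unfolding poly_ring_carrier_iff by (intro ball_cong refl) blast
  finally show ?thesis using w by (simp add: monomial_ideal_def)
qed

lemma monomial_ideal_empty: "monomial_ideal V {} = {0}"
  by (auto simp: monomial_ideal_def)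

lemma homogeneous_monomial: "homogeneous (int (monom_degree u)) (monomial u)"
  by (simp add: homogeneous_def monomial_def)

lemma linear_resolution_insert_monomial:
  fixes V :: "'v set"
  assumes M: "linear_resolution V t (monomial_ideal V M :: ('v, 'k::field) mpoly set) r D"
    and L: "linear_resolution V 1 (monomial_ideal V L :: ('v, 'k) mpoly set) s E"
    and u: "Poly_Mapping.keys u \<subseteq> V" "monom_degree u = t" and MV: "M \<subseteq> {m. Poly_Mapping.keys m \<subseteq> V}"
    and eq: "\<And>k. Poly_Mapping.keys k \<subseteq> V \<Longrightarrow> (\<exists>m \<in> M. \<exists>l. u + k = m + l) \<longleftrightarrow> (\<exists>m \<in> L. \<exists>l. k = m + l)"
  shows "\<exists>D'. linear_resolution V t (monomial_ideal V (insert u M) :: ('v, 'k) mpoly set)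
     (cone_rank r s) D'"
  unfolding monomial_ideal_insert[OF MV u(1)]
  using linear_resolution_add_generator[OF M L monomial_carrier[OF u(1)]]
    homogeneous_monomial[of u] monomial_ideal_colon[OF u(1) _ eq] u(2) by blast

text \<open>The Koszul complex as an iterated cone: a new indeterminate is a nonzerodivisor modulo
  the earlier ones, so the colon ideal is the old ideal itself. The cone joins two copies of the
  same complex, and the ranks obey Pascal's rule.\<close>

lemma linear_resolution_variables:
  fixes z :: "nat \<Rightarrow> 'v"
  assumes z: "inj z" "z ` {1..m} \<subseteq> V"
  shows "\<exists>D. linear_resolution V 1
     (monomial_ideal V ((\<lambda>i. Poly_Mapping.single (z i) 1) ` {1..m}) :: ('v, 'k::field) mpoly set)
     (\<lambda>q. m choose q) D"
  using z(2)
proof (induction m)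
  case 0
  have "(\<lambda>q. 0 choose q) = (\<lambda>q. if q = 0 then 1 else 0)" by (auto simp: binomial_eq_0)
  then show ?case
    using linear_resolution_zero_ideal[of V 1, where 'k = 'k] by (simp add: monomial_ideal_empty)
next
  case (Suc m)
  let ?x = "\<lambda>i. Poly_Mapping.single (z i) 1 :: 'v monom"
  let ?M = "?x ` {1..m}"
  have "z ` {1..m} \<subseteq> V" using Suc.prems by auto
  from Suc.IH[OF this] obtain D where
    D: "linear_resolution V 1 (monomial_ideal V ?M :: ('v, 'k) mpoly set) (\<lambda>q. m choose q) D" by blast
  have eq: "(\<exists>n \<in> ?M. \<exists>l. ?x (Suc m) + k = n + l) \<longleftrightarrow> (\<exists>n \<in> ?M. \<exists>l. k = n + l)" for k
  proof -
    have "(\<exists>l. ?x (Suc m) + k = ?x i + l) \<longleftrightarrow> (\<exists>l. k = ?x i + l)" if "i \<in> {1..m}" for i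
    proof -
      have "z i \<noteq> z (Suc m)" using that z(1) by (auto dest: injD)
      then show ?thesis unfolding single_add_iff by (auto simp: keys_add_nat)
    qed
    then show ?thesis by blast
  qed
  have "cone_rank (\<lambda>q. m choose q) (\<lambda>q. m choose q) q = Suc m choose q" for q
    by (cases q) (auto simp: cone_rank_def)
  then have "cone_rank (\<lambda>q. m choose q) (\<lambda>q. m choose q) = (\<lambda>q. Suc m choose q)" ..
  moreover have "\<exists>D'. linear_resolution V 1
      (monomial_ideal V (insert (?x (Suc m)) ?M) :: ('v, 'k) mpoly set)
      (cone_rank (\<lambda>q. m choose q) (\<lambda>q. m choose q)) D'"
    by (rule linear_resolution_insert_monomial[OF D D _ _ _ eq]) (use Suc.prems in auto)
  moreover have "?x ` {1..Suc m} = insert (?x (Suc m)) ?M"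
    by (simp add: atLeastAtMostSuc_conv)
  ultimately show ?case by (simp only:)
qed

text \<open>Stability in the sense of Eliahou and Kervaire, imposed on generators of one common
  degree. Positivity of \<open>t\<close> guarantees that a generator has a last
  indeterminate.\<close>

locale stable_monomials =
  fixes z :: "nat \<Rightarrow> 'v" and N t :: nat and G :: "'v monom set"
  assumes inj_z: "inj z" and t_pos: "1 \<le> t" and finite_G: "finite G"
    and keys_G: "u \<in> G \<Longrightarrow> Poly_Mapping.keys u \<subseteq> z ` {1..N}"
    and degree_G: "u \<in> G \<Longrightarrow> monom_degree u = t"
    and stable: "u \<in> G \<Longrightarrow> z l \<in> Poly_Mapping.keys u \<Longrightarrow> (\<And>j. z j \<in> Poly_Mapping.keys u \<Longrightarrow> j \<le> l) \<Longrightarrow>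
       1 \<le> i \<Longrightarrow> i < l \<Longrightarrow> Poly_Mapping.single (z i) 1 + (u - Poly_Mapping.single (z l) 1) \<in> G"
begin

definition max_index :: "'v monom \<Rightarrow> nat" where
  "max_index u = Max {i. z i \<in> Poly_Mapping.keys u}"

lemma finite_indices: "finite {i. z i \<in> Poly_Mapping.keys u}"
  using finite_vimageI[OF finite_keys inj_z, of u] by (simp add: vimage_def)

lemma max_index_ge: "z j \<in> Poly_Mapping.keys u \<Longrightarrow> j \<le> max_index u"
  unfolding max_index_def using finite_indices by (intro Max_ge) auto

lemma z_in_range_iff: "z j \<in> z ` {1..N} \<longleftrightarrow> j \<in> {1..N}"
  by (rule inj_image_mem_iff[OF inj_z])

lemma max_index_in:
  assumes "u \<in> G"
  shows "z (max_index u) \<in> Poly_Mapping.keys u" "max_index u \<in> {1..N}"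
proof -
  have "Poly_Mapping.keys u \<noteq> {}"
    using degree_G[OF assms] t_pos by auto
  then have "{i. z i \<in> Poly_Mapping.keys u} \<noteq> {}" using keys_G[OF assms] by blast
  then show *: "z (max_index u) \<in> Poly_Mapping.keys u"
    using Max_in[OF finite_indices, of u] by (auto simp: max_index_def)
  then show "max_index u \<in> {1..N}"
    using keys_G[OF assms] z_in_range_iff by blast
qed

text \<open>Lexicographic order with z_1 > z_2 > ...: the first index at which the exponents differ
  decides, and the larger exponent wins.\<close>

definition lex_greater :: "'v monom \<Rightarrow> 'v monom \<Rightarrow> bool" where
  "lex_greater m u \<longleftrightarrow> (\<exists>i. Poly_Mapping.lookup u (z i) < Poly_Mapping.lookup m (z i) \<and>
     (\<forall>j<i. Poly_Mapping.lookup m (z j) = Poly_Mapping.lookup u (z j)))"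

lemma lex_greater_irrefl: "\<not> lex_greater m m"
  by (simp add: lex_greater_def)

lemma lex_greater_trans: "lex_greater a b \<Longrightarrow> lex_greater b c \<Longrightarrow> lex_greater a c"
  unfolding lex_greater_def
proof (elim exE conjE)
  fix i j
  assume "Poly_Mapping.lookup b (z i) < Poly_Mapping.lookup a (z i)"
    "\<forall>k<i. Poly_Mapping.lookup a (z k) = Poly_Mapping.lookup b (z k)"
    "Poly_Mapping.lookup c (z j) < Poly_Mapping.lookup b (z j)"
    "\<forall>k<j. Poly_Mapping.lookup b (z k) = Poly_Mapping.lookup c (z k)"
  then show "\<exists>i. Poly_Mapping.lookup c (z i) < Poly_Mapping.lookup a (z i) \<and>
      (\<forall>j<i. Poly_Mapping.lookup a (z j) = Poly_Mapping.lookup c (z j))"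
    by (intro exI[of _ "min i j"]) (cases i j rule: linorder_cases; fastforce)
qed

text \<open>If \<open>z i\<close> with i below the largest index \<open>?l\<close> divides
  \<open>k\<close>, replacing \<open>z ?l\<close> by \<open>z i\<close> in \<open>u\<close> yields a
  lexicographically larger generator dividing \<open>u + k\<close>. Conversely, if \<open>k\<close>
  avoids these indeterminates, a generator \<open>m\<close> of the segment dividing
  \<open>u + k\<close> has exponents at most those of \<open>u\<close> below \<open>?l\<close>, and
  a strict drop at the first difference makes \<open>u\<close> larger than \<open>m\<close>, against
  the choice of \<open>u\<close>.\<close>

lemma linear_quotient:
  assumes S: "S \<subseteq> G" "u \<in> S" and up: "\<And>v m. v \<in> S \<Longrightarrow> m \<in> G \<Longrightarrow> lex_greater m v \<Longrightarrow> m \<in> S"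
    and least: "\<And>m. m \<in> S \<Longrightarrow> \<not> lex_greater u m"
    and k: "Poly_Mapping.keys k \<subseteq> z ` {1..N}"
  shows "(\<exists>m \<in> S - {u}. \<exists>l. u + k = m + l) \<longleftrightarrow>
    (\<exists>m \<in> (\<lambda>i. Poly_Mapping.single (z i) 1) ` {1..max_index u - 1}. \<exists>l. k = m + l)"
proof
  have uG: "u \<in> G" using S by blast
  let ?l = "max_index u"
  note l = max_index_in[OF uG]
  {
    assume "\<exists>m \<in> (\<lambda>i. Poly_Mapping.single (z i) 1) ` {1..?l - 1}. \<exists>l. k = m + l"
    then obtain i where i: "i \<in> {1..?l - 1}" "z i \<in> Poly_Mapping.keys k"
      by (auto simp: single_add_iff simp del: One_nat_def)
    then have il: "1 \<le> i" "i < ?l" by auto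
    then have zil: "z i \<noteq> z ?l" using inj_z by (auto dest: injD)
    let ?m = "Poly_Mapping.single (z i) 1 + (u - Poly_Mapping.single (z ?l) 1)"
    have "?m \<in> G" by (rule stable[OF uG l(1) max_index_ge il])
    moreover have "lex_greater ?m u"
      unfolding lex_greater_def using il inj_z
      by (intro exI[of _ i]) (auto simp: lookup_add lookup_minus lookup_single when_def dest: injD)
    ultimately have "?m \<in> S - {u}"
      using up[OF S(2)] lex_greater_irrefl by auto
    moreover have "\<exists>l. u + k = ?m + l"
      unfolding monom_add_iff_le using i(2)
      by (auto simp: lookup_add lookup_minus lookup_single when_def in_keys_iff)
    ultimately show "\<exists>m \<in> S - {u}. \<exists>l. u + k = m + l" by blast
  }
  assume "\<exists>m \<in> S - {u}. \<exists>l. u + k = m + l"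
  then obtain m where m: "m \<in> S" "m \<noteq> u"
    and le: "\<And>v. Poly_Mapping.lookup m v \<le> Poly_Mapping.lookup u v + Poly_Mapping.lookup k v"
    using monom_add_iff_le by (metis DiffE insertI1 lookup_add)
  show "\<exists>m \<in> (\<lambda>i. Poly_Mapping.single (z i) 1) ` {1..?l - 1}. \<exists>l. k = m + l"
  proof (rule ccontr)
    assume "\<not> ?thesis"
    then have no: "z i \<notin> Poly_Mapping.keys k" if "1 \<le> i" "i < ?l" for i
      using that by (auto simp: single_add_iff simp del: One_nat_def)
    have le': "Poly_Mapping.lookup m (z j) \<le> Poly_Mapping.lookup u (z j)" if "j < ?l" for j
    proof -
      have "z j \<notin> Poly_Mapping.keys k"
      proof
        assume zj: "z j \<in> Poly_Mapping.keys k"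
        then have "j \<in> {1..N}" using k z_in_range_iff by blast
        then have "1 \<le> j" by simp
        then show False using no[of j] that zj by blast
      qed
      then show ?thesis using le[of "z j"] by (simp add: in_keys_iff)
    qed
    have "lex_greater u m"
    proof (cases "\<exists>j<?l. Poly_Mapping.lookup m (z j) \<noteq> Poly_Mapping.lookup u (z j)")
      case True
      define j where "j = (LEAST j. j < ?l \<and> Poly_Mapping.lookup m (z j) \<noteq> Poly_Mapping.lookup u (z j))"
      have j: "j < ?l" "Poly_Mapping.lookup m (z j) \<noteq> Poly_Mapping.lookup u (z j)"
        using LeastI_ex[OF True] unfolding j_def by auto
      have "Poly_Mapping.lookup u (z i) = Poly_Mapping.lookup m (z i)" if "i < j" for i
        using not_less_Least[OF that[unfolded j_def]] that j(1) by auto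
      then show ?thesis
        unfolding lex_greater_def using j le'[OF j(1)] by (intro exI[of _ j]) auto
    next
      case False
      \<comment> \<open>Otherwise \<open>u\<close> would divide \<open>m\<close>, and since both
        have degree \<open>t\<close> they would coincide.\<close>
      have "Poly_Mapping.lookup m (z ?l) < Poly_Mapping.lookup u (z ?l)"
      proof (rule ccontr)
        assume ge: "\<not> ?thesis"
        have "Poly_Mapping.lookup u v \<le> Poly_Mapping.lookup m v" for v
        proof (cases "v \<in> Poly_Mapping.keys u")
          case True
          then obtain j where j: "v = z j" using keys_G[OF uG] by blast
          then have "j \<le> ?l" using True max_index_ge by blast
          then show ?thesis using j False ge by (cases "j = ?l") auto
        qed (simp add: in_keys_iff)
        then obtain x where x: "m = u + x" using monom_add_iff_le by metis
        then have "monom_degree x = 0"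
          using degree_G[OF uG] degree_G[of m] m(1) S(1) monom_degree_add[of u x] by auto
        then show False using x m(2) by (simp add: monom_degree_eq_0_iff)
      qed
      then show ?thesis
        unfolding lex_greater_def using False by (intro exI[of _ ?l]) auto
    qed
    then show False using least[OF m(1)] by blast
  qed
qed

text \<open>Generators are added in decreasing order. Removing the least element of an upward closed
  set leaves an upward closed set, and the removed \<open>u\<close> contributes the Koszul ranks of
  its colon ideal, shifted by one position.\<close>

lemma linear_resolution_segment:
  assumes "S \<subseteq> G" and "\<And>v m. v \<in> S \<Longrightarrow> m \<in> G \<Longrightarrow> lex_greater m v \<Longrightarrow> m \<in> S"
  shows "\<exists>D. linear_resolution (z ` {1..N}) t
    (monomial_ideal (z ` {1..N}) S :: ('v, 'k::field) mpoly set)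
    (\<lambda>q. case q of 0 \<Rightarrow> 1 | Suc p \<Rightarrow> \<Sum>u \<in> S. (max_index u - 1) choose p) D"
  using assms
proof (induction "card S" arbitrary: S)
  case 0
  then have S: "S = {}" using finite_subset[OF _ finite_G] by auto
  have rank: "(\<lambda>q. case q of 0 \<Rightarrow> 1 | Suc p \<Rightarrow> \<Sum>u \<in> {}. (max_index u - 1) choose p) =
      (\<lambda>q. if q = 0 then 1 else 0)" by (auto split: nat.split)
  show ?case
    unfolding S rank monomial_ideal_empty by (rule linear_resolution_zero_ideal)
next
  case (Suc n)
  have fin: "finite S" by (rule finite_subset[OF Suc.prems(1) finite_G])
  have "S \<noteq> {}" using Suc.hyps(2) by auto
  \<comment> \<open>The maximum is taken for \<open>lex_greater\<close> read as a strict order from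
    left to right, so the element obtained is lexicographically least.\<close>
  have "\<exists>u \<in> S. \<forall>x \<in> S. x \<noteq> u \<longrightarrow> \<not> lex_greater u x"
  proof (rule Finite_Set.bex_max_element[OF fin _ _ \<open>S \<noteq> {}\<close>])
    show "asymp_on S lex_greater"
      using lex_greater_trans lex_greater_irrefl by (intro asymp_onI) blast
    show "transp_on S lex_greater"
      using lex_greater_trans by (intro transp_onI)
  qed
  then obtain u where u: "u \<in> S" and least: "\<And>x. x \<in> S \<Longrightarrow> \<not> lex_greater u x"
    using lex_greater_irrefl by metis
  let ?V = "z ` {1..N}"
  have uG: "u \<in> G" using u Suc.prems by blast
  have "S - {u} \<subseteq> G" using Suc.prems by blast
  moreover have "m \<in> S - {u}" if "v \<in> S - {u}" "m \<in> G" "lex_greater m v" for v m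
    using Suc.prems(2)[of v m] least[of v] that by blast
  moreover have "n = card (S - {u})" using Suc.hyps(2) u fin by simp
  ultimately obtain D where D: "linear_resolution ?V t
      (monomial_ideal ?V (S - {u}) :: ('v, 'k) mpoly set)
      (\<lambda>q. case q of 0 \<Rightarrow> 1 | Suc p \<Rightarrow> \<Sum>u \<in> S - {u}. (max_index u - 1) choose p) D"
    using Suc.hyps(1)[of "S - {u}"] by blast
  have "z ` {1..max_index u - 1} \<subseteq> ?V" using max_index_in[OF uG] by auto
  from linear_resolution_variables[OF inj_z this, where 'k = 'k] obtain E where
    E: "linear_resolution ?V 1
      (monomial_ideal ?V ((\<lambda>i. Poly_Mapping.single (z i) 1) ` {1..max_index u - 1}) :: ('v, 'k) mpoly set)
      (\<lambda>q. (max_index u - 1) choose q) E" by blast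
  have "\<exists>D'. linear_resolution ?V t (monomial_ideal ?V (insert u (S - {u})) :: ('v, 'k) mpoly set)
      (cone_rank (\<lambda>q. case q of 0 \<Rightarrow> 1 | Suc p \<Rightarrow> \<Sum>u \<in> S - {u}. (max_index u - 1) choose p)
        (\<lambda>q. (max_index u - 1) choose q)) D'"
    using keys_G Suc.prems(1) degree_G[OF uG] uG
    by (intro linear_resolution_insert_monomial[OF D E]
        linear_quotient[OF Suc.prems(1) u Suc.prems(2) least]) auto
  moreover have "cone_rank (\<lambda>q. case q of 0 \<Rightarrow> 1 | Suc p \<Rightarrow> \<Sum>u \<in> S - {u}. (max_index u - 1) choose p)
        (\<lambda>q. (max_index u - 1) choose q) =
      (\<lambda>q. case q of 0 \<Rightarrow> 1 | Suc p \<Rightarrow> \<Sum>u \<in> S. (max_index u - 1) choose p)"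
    by (rule ext) (simp add: cone_rank_def sum.remove[OF fin u] split: nat.split)
  moreover have "insert u (S - {u}) = S" using u by blast
  ultimately show ?case by (simp only:)
qed

theorem betti_stable_ideal:
  "betti (z ` {1..N}) (monomial_ideal (z ` {1..N}) G :: ('v, 'k::field) mpoly set) q =
     (\<Sum>u \<in> G. (max_index u - 1) choose q)"
proof -
  obtain D where "linear_resolution (z ` {1..N}) t
      (monomial_ideal (z ` {1..N}) G :: ('v, 'k) mpoly set)
      (\<lambda>q. case q of 0 \<Rightarrow> 1 | Suc p \<Rightarrow> \<Sum>u \<in> G. (max_index u - 1) choose p) D"
    using linear_resolution_segment[of G, where 'k = 'k] by blast
  from betti_linear_resolution[OF this, of q] show ?thesis by simp
qed

end

section \<open>Binomial sums\<close>

text \<open>Both sides count the subsets of {0, ..., M} with s + r + 1 elements: \<open>k\<close> is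
  the element having exactly s smaller ones in the subset, and the r others lie above it.\<close>

lemma sum_choose_mult_choose_diff:
  "(\<Sum>k\<le>M. (k choose s) * ((M - k) choose r)) = Suc M choose (s + r + 1)"
proof (induction M arbitrary: r)
  case 0
  then show ?case by (cases s; cases r) auto
next
  case (Suc M)
  show ?case
  proof (cases r)
    case 0
    then show ?thesis using sum_choose_upper[of s "Suc M"] by simp
  next
    case (Suc r')
    have "(\<Sum>k\<le>Suc M. (k choose s) * ((Suc M - k) choose r)) =
        (\<Sum>k\<le>M. (k choose s) * ((Suc M - k) choose r))"
      by (simp add: Suc)
    also have "\<dots> = (\<Sum>k\<le>M. (k choose s) * ((M - k) choose r') + (k choose s) * ((M - k) choose r))"
      by (intro sum.cong refl) (simp add: Suc Suc_diff_le algebra_simps)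
    also have "\<dots> = (Suc M choose (s + r' + 1)) + (Suc M choose (s + r + 1))"
      by (simp only: sum.distrib Suc.IH)
    also have "\<dots> = Suc (Suc M) choose (s + r + 1)" by (simp add: Suc)
    finally show ?thesis .
  qed
qed

text \<open>Meant for D = n - t and p = t - j - 1, so that D + j + 1 + p = n. The second factor is
  split by Vandermonde along (p - k) + (D + j); after interchanging the sums, the inner one is an
  instance of \<open>sum_choose_mult_choose_diff\<close>.\<close>

lemma sum_choose_mult_choose_vandermonde:
  "(\<Sum>k\<le>p. ((D + j + k) choose k) * ((D + p + j - k) choose D)) =
   (\<Sum>i\<le>D. ((D + j) choose (j + i)) * ((D + j + 1 + p) choose (D + j + 1 + i)))"
proof -
  have "(\<Sum>k\<le>p. ((D + j + k) choose k) * ((D + p + j - k) choose D)) =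
      (\<Sum>k\<le>p. \<Sum>i\<le>D. ((D + j) choose (j + i)) * (((D + j + k) choose (D + j)) * ((p - k) choose i)))"
  proof (intro sum.cong refl)
    fix k assume "k \<in> {..p}"
    then have k: "k \<le> p" by simp
    have "(D + p + j - k) choose D = (\<Sum>i\<le>D. ((p - k) choose i) * ((D + j) choose (D - i)))"
      using k by (simp add: vandermonde add.commute add.left_commute)
    also have "\<dots> = (\<Sum>i\<le>D. ((p - k) choose i) * ((D + j) choose (j + i)))"
    proof (intro sum.cong refl)
      fix i assume "i \<in> {..D}"
      then have "(D + j) choose (D - i) = (D + j) choose (j + i)"
        by (subst binomial_symmetric) (auto intro: arg_cong2[of _ _ _ _ "(choose)"])
      then show "((p - k) choose i) * ((D + j) choose (D - i)) = ((p - k) choose i) * ((D + j) choose (j + i))"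
        by simp
    qed
    moreover have "(D + j + k) choose k = (D + j + k) choose (D + j)"
      by (subst binomial_symmetric) auto
    ultimately show "((D + j + k) choose k) * ((D + p + j - k) choose D) =
        (\<Sum>i\<le>D. ((D + j) choose (j + i)) * (((D + j + k) choose (D + j)) * ((p - k) choose i)))"
      by (simp add: sum_distrib_left ac_simps)
  qed
  also have "\<dots> = (\<Sum>i\<le>D. ((D + j) choose (j + i)) *
      (\<Sum>k\<le>p. ((D + j + k) choose (D + j)) * ((p - k) choose i)))"
    by (subst sum.swap) (simp add: sum_distrib_left)
  also have "\<dots> = (\<Sum>i\<le>D. ((D + j) choose (j + i)) * ((D + j + 1 + p) choose (D + j + 1 + i)))"
  proof (intro sum.cong refl)
    fix i
    let ?h = "\<lambda>k. (k choose (D + j)) * ((D + j + p - k) choose i)"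
    have "(\<Sum>k\<le>p. ((D + j + k) choose (D + j)) * ((p - k) choose i)) = sum ?h {D + j..D + j + p}"
      by (rule sum.reindex_bij_witness[of _ "\<lambda>k. k - (D + j)" "\<lambda>k. D + j + k"]) auto
    also have "\<dots> = sum ?h {..D + j + p}"
      by (intro sum.mono_neutral_left) (auto simp: binomial_eq_0)
    finally show "((D + j) choose (j + i)) * (\<Sum>k\<le>p. ((D + j + k) choose (D + j)) * ((p - k) choose i)) =
        ((D + j) choose (j + i)) * ((D + j + 1 + p) choose (D + j + 1 + i))"
      using sum_choose_mult_choose_diff[where M = "D + j + p" and s = "D + j" and r = i] by (simp add: ac_simps)
  qed
  finally show ?thesis .
qed

text \<open>The same target as in \<open>sum_choose_mult_choose_vandermonde\<close>, reached from
  the second sum of (b): here the first factor is split along ?N + s, and the inner sum over s is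
  again a convolution.\<close>

lemma sum_choose_add_mult_choose_diff:
  assumes "1 \<le> j"
  shows "(\<Sum>s\<le>D. ((D + j + 1 + p + s) choose p) * ((D + j - 1 - s) choose (j - 1))) =
   (\<Sum>i\<le>D. ((D + j) choose (j + i)) * ((D + j + 1 + p) choose (D + j + 1 + i)))"
proof -
  let ?N = "D + j + 1 + p"
  have "(\<Sum>s\<le>D. ((?N + s) choose p) * ((D + j - 1 - s) choose (j - 1))) =
      (\<Sum>s\<le>D. \<Sum>i\<le>p. (?N choose (p - i)) * ((s choose i) * ((D + j - 1 - s) choose (j - 1))))"
  proof (intro sum.cong refl)
    fix s
    have "(?N + s) choose p = (\<Sum>i\<le>p. (s choose i) * (?N choose (p - i)))"
      by (simp only: vandermonde add.commute)
    then show "((?N + s) choose p) * ((D + j - 1 - s) choose (j - 1)) =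
        (\<Sum>i\<le>p. (?N choose (p - i)) * ((s choose i) * ((D + j - 1 - s) choose (j - 1))))"
      by (simp only: sum_distrib_right) (simp add: ac_simps)
  qed
  also have "\<dots> = (\<Sum>i\<le>p. (?N choose (p - i)) * (\<Sum>s\<le>D. (s choose i) * ((D + j - 1 - s) choose (j - 1))))"
    by (subst sum.swap) (simp only: sum_distrib_left)
  also have "\<dots> = (\<Sum>i\<le>p. (?N choose (D + j + 1 + i)) * ((D + j) choose (j + i)))"
  proof (intro sum.cong refl)
    fix i assume "i \<in> {..p}"
    then have 1: "?N choose (p - i) = ?N choose (D + j + 1 + i)"
      by (subst binomial_symmetric) (auto intro: arg_cong2[of _ _ _ _ "(choose)"])
    \<comment> \<open>For s > D the second lower index j - 1 exceeds D + j - 1 - s, so the range can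
      be extended to the one of the convolution identity.\<close>
    have "(\<Sum>s\<le>D. (s choose i) * ((D + j - 1 - s) choose (j - 1))) =
        (\<Sum>s\<le>D + j - 1. (s choose i) * ((D + j - 1 - s) choose (j - 1)))"
      using assms by (intro sum.mono_neutral_left) (auto intro!: binomial_eq_0)
    also have "\<dots> = (D + j) choose (j + i)"
      using sum_choose_mult_choose_diff[where M = "D + j - 1" and s = i and r = "j - 1"] assms by (simp add: add.commute)
    finally show "(?N choose (p - i)) * (\<Sum>s\<le>D. (s choose i) * ((D + j - 1 - s) choose (j - 1))) =
        (?N choose (D + j + 1 + i)) * ((D + j) choose (j + i))"
      using 1 by simp
  qed
  \<comment> \<open>The bound p is exchanged for D through the common upper bound D + p: the first
    factor vanishes for i > p, the second for i > D.\<close>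
  also have "\<dots> = (\<Sum>i\<le>D + p. (?N choose (D + j + 1 + i)) * ((D + j) choose (j + i)))"
    by (intro sum.mono_neutral_left) auto
  also have "\<dots> = (\<Sum>i\<le>D. (?N choose (D + j + 1 + i)) * ((D + j) choose (j + i)))"
    by (intro sum.mono_neutral_right) auto
  finally show ?thesis by (simp add: mult.commute)
qed

section \<open>The three sums of (b) in integer binomials\<close>

lemma binom_int: "binom (int a) (int b) = a choose b"
  by (simp add: binom_def binomial_eq_0)

lemma binom_eqI: "a = int a' \<Longrightarrow> b = int b' \<Longrightarrow> binom a b = a' choose b'"
  by (simp add: binom_int)

context
  fixes n t j :: nat
  assumes j: "1 \<le> j" "j < t" "t \<le> n"
begin

private abbreviation (input) "closed_form \<equiv>
  \<Sum>k\<le>t - j - 1. ((n - t + j + k) choose k) * ((n - 1 - k) choose (n - t))"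

text \<open>The right-hand side is the third sum of (b) with i = \<tau> - 1 and the first factor
  replaced by its symmetric form; the other two sums are compared through it.\<close>

lemma closed_form_eq:
  "closed_form = (\<Sum>i\<le>n - t. ((n - t + j) choose (j + i)) * (n choose (n - t + j + 1 + i)))"
proof -
  have n: "n - t + (t - j - 1) + j = n - 1" "n - t + j + 1 + (t - j - 1) = n" using j by auto
  show ?thesis
    using sum_choose_mult_choose_vandermonde[of "n - t" j "t - j - 1"] unfolding n by simp
qed

lemma binom_sum_1:
  "(\<Sum>k = 0..t - j - 1. binom (int n - int t + int j + int k) (int k) *
     binom (int n - int k - 1) (int n - int t)) = closed_form"
  unfolding atMost_atLeast0[symmetric]
  using j by (intro sum.cong refl arg_cong2[of _ _ _ _ "(*)"] binom_eqI) auto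

lemma binom_sum_2:
  "(\<Sum>\<tau> = 1..n - t + 1. binom (int n + int \<tau> - 1) (int t - int j - 1) *
     binom (int n - int t + int j - int \<tau>) (int j - 1)) = closed_form"
proof -
  have n: "n - t + j + 1 + (t - j - 1) = n" using j by auto
  have "(\<Sum>\<tau> = 1..n - t + 1. binom (int n + int \<tau> - 1) (int t - int j - 1) *
       binom (int n - int t + int j - int \<tau>) (int j - 1)) =
     (\<Sum>s\<le>n - t. ((n + s) choose (t - j - 1)) * ((n - t + j - 1 - s) choose (j - 1)))"
    using j unfolding One_nat_def sum.atLeast1_atMost_eq
    by (intro sum.cong arg_cong2[of _ _ _ _ "(*)"] binom_eqI) auto
  then show ?thesis
    using sum_choose_add_mult_choose_diff[OF j(1), of "n - t" "t - j - 1"] closed_form_eq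
    unfolding n by simp
qed

lemma binom_sum_3:
  "(\<Sum>\<tau> = 1..n - t + 1. binom (int n) (int t - int j - int \<tau>) *
     binom (int n - int t + int j) (int j + int \<tau> - 1)) = closed_form"
proof -
  have "(\<Sum>\<tau> = 1..n - t + 1. binom (int n) (int t - int j - int \<tau>) *
       binom (int n - int t + int j) (int j + int \<tau> - 1)) =
     (\<Sum>s\<le>n - t. (n choose (n - t + j + 1 + s)) * ((n - t + j) choose (j + s)))"
    unfolding One_nat_def sum.atLeast1_atMost_eq
  proof (intro sum.cong arg_cong2[of _ _ _ _ "(*)"])
    show "{..<n - t + Suc 0} = {..n - t}" by auto
    fix s
    show "binom (int n - int t + int j) (int j + int (Suc s) - 1) = (n - t + j) choose (j + s)"
      using j by (intro binom_eqI) auto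
    show "binom (int n) (int t - int j - int (Suc s)) = n choose (n - t + j + Suc 0 + s)"
    proof (cases "s \<le> t - j - 1")
      case True
      then have "binom (int n) (int t - int j - int (Suc s)) = n choose (t - j - 1 - s)"
        using j by (intro binom_eqI) auto
      also have "\<dots> = n choose (n - t + j + Suc 0 + s)"
        using j True by (subst binomial_symmetric) (auto intro: arg_cong2[of _ _ _ _ "(choose)"])
      finally show ?thesis .
    next
      \<comment> \<open>The lower index t - j - 1 - s is negative, so \<open>binom\<close> is 0 by
        convention, while on the other side the lower index exceeds n.\<close>
      case False
      then show ?thesis using j by (auto simp: binom_def intro!: binomial_eq_0)
    qed
  qed
  then show ?thesis using closed_form_eq by (simp add: mult.commute)
qed

end

section \<open>Counting monomials\<close>

lemma weight_mono: "(\<And>v. P v \<Longrightarrow> Q v) \<Longrightarrow> weight P m \<le> weight Q m"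
  unfolding weight_def by (rule sum_mono) auto

lemma weight_eq_degree:
  "(\<And>v. v \<in> Poly_Mapping.keys m \<Longrightarrow> P v) \<Longrightarrow> weight P m = monom_degree m"
  unfolding weight_def monom_degree_def by (rule sum.cong) auto

lemma weight_eq_0: "(\<And>v. v \<in> Poly_Mapping.keys m \<Longrightarrow> \<not> P v) \<Longrightarrow> weight P m = 0"
  unfolding weight_def by (rule sum.neutral) auto

definition monoms_on :: "'v set \<Rightarrow> nat \<Rightarrow> 'v monom set" where
  "monoms_on A k = {m. Poly_Mapping.keys m \<subseteq> A \<and> monom_degree m = k}"

definition monom_restrict :: "'v set \<Rightarrow> 'v monom \<Rightarrow> 'v monom" where
  "monom_restrict A m = Abs_poly_mapping (\<lambda>v. Poly_Mapping.lookup m v when v \<in> A)"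

lemma lookup_monom_restrict:
  "Poly_Mapping.lookup (monom_restrict A m) v = (Poly_Mapping.lookup m v when v \<in> A)"
proof -
  have "finite {v. (Poly_Mapping.lookup m v when v \<in> A) \<noteq> 0}"
    by (rule finite_subset[OF _ finite_keys[of m]]) (auto simp: in_keys_iff when_def split: if_splits)
  then show ?thesis by (simp add: monom_restrict_def)
qed

lemma keys_monom_restrict: "Poly_Mapping.keys (monom_restrict A m) = Poly_Mapping.keys m \<inter> A"
  by (auto simp: in_keys_iff lookup_monom_restrict when_def split: if_splits)

text \<open>A monomial in two disjoint groups of variables is the product of its two restrictions,
  and the weight on \<open>B\<close> records the degree of the second factor.\<close>

lemma bij_betw_monoms_on_Un:
  assumes "A \<inter> B = {}"
  shows "bij_betw (\<lambda>(a, b). a + b) (monoms_on A i \<times> monoms_on B j)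
    {m. Poly_Mapping.keys m \<subseteq> A \<union> B \<and> monom_degree m = i + j \<and> weight (\<lambda>v. v \<in> B) m = j}"
proof (rule bij_betw_byWitness[where f' = "\<lambda>m. (monom_restrict A m, monom_restrict B m)"])
  have r: "monom_restrict A (a + b) = a" "monom_restrict B (a + b) = b"
    if "Poly_Mapping.keys a \<subseteq> A" "Poly_Mapping.keys b \<subseteq> B" for a b :: "'a monom"
    using that assms by (auto intro!: poly_mapping_eqI simp: lookup_monom_restrict lookup_add when_def
        in_keys_iff subset_iff disjoint_iff; metis neq0_conv)+
  then show "\<forall>x \<in> monoms_on A i \<times> monoms_on B j.
      (\<lambda>m. (monom_restrict A m, monom_restrict B m)) ((\<lambda>(a, b). a + b) x) = x"
    by (auto simp: monoms_on_def)
  have s: "monom_restrict A m + monom_restrict B m = m" if "Poly_Mapping.keys m \<subseteq> A \<union> B" for m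
    using that assms by (auto intro!: poly_mapping_eqI simp: lookup_monom_restrict lookup_add when_def
        in_keys_iff subset_iff disjoint_iff)
  then show "\<forall>m \<in> {m. Poly_Mapping.keys m \<subseteq> A \<union> B \<and> monom_degree m = i + j \<and> weight (\<lambda>v. v \<in> B) m = j}.
      (\<lambda>(a, b). a + b) (monom_restrict A m, monom_restrict B m) = m"
    by auto
  have w: "weight (\<lambda>v. v \<in> B) (a + b) = monom_degree b"
    if "Poly_Mapping.keys a \<subseteq> A" "Poly_Mapping.keys b \<subseteq> B" for a b :: "'a monom"
  proof -
    have "weight (\<lambda>v. v \<in> B) a = 0" using that assms by (intro weight_eq_0) blast
    moreover have "weight (\<lambda>v. v \<in> B) b = monom_degree b" using that by (intro weight_eq_degree) blast
    ultimately show ?thesis by (simp add: weight_add)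
  qed
  then show "(\<lambda>(a, b). a + b) ` (monoms_on A i \<times> monoms_on B j) \<subseteq>
      {m. Poly_Mapping.keys m \<subseteq> A \<union> B \<and> monom_degree m = i + j \<and> weight (\<lambda>v. v \<in> B) m = j}"
    by (auto simp: monoms_on_def keys_add_nat monom_degree_add)
  show "(\<lambda>m. (monom_restrict A m, monom_restrict B m)) `
      {m. Poly_Mapping.keys m \<subseteq> A \<union> B \<and> monom_degree m = i + j \<and> weight (\<lambda>v. v \<in> B) m = j}
      \<subseteq> monoms_on A i \<times> monoms_on B j"
  proof clarify
    fix m assume m: "Poly_Mapping.keys m \<subseteq> A \<union> B" "monom_degree m = i + weight (\<lambda>v. v \<in> B) m"
    have "weight (\<lambda>v. v \<in> B) m = monom_degree (monom_restrict B m)"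
      using w[of "monom_restrict A m" "monom_restrict B m"] s[OF m(1)] by (simp add: keys_monom_restrict)
    moreover have "monom_degree m = monom_degree (monom_restrict A m) + monom_degree (monom_restrict B m)"
      using s[OF m(1)] monom_degree_add by metis
    ultimately show "monom_restrict A m \<in> monoms_on A i \<and>
        monom_restrict B m \<in> monoms_on B (weight (\<lambda>v. v \<in> B) m)"
      using m by (simp add: monoms_on_def keys_monom_restrict)
  qed
qed

lemma monoms_on_Un_partition:
  "{m. Poly_Mapping.keys m \<subseteq> A \<union> B \<and> monom_degree m = k \<and> c \<le> weight (\<lambda>v. v \<in> B) m} =
   (\<Union>e \<in> {c..k}. {m. Poly_Mapping.keys m \<subseteq> A \<union> B \<and> monom_degree m = (k - e) + e \<and>
      weight (\<lambda>v. v \<in> B) m = e})"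
proof -
  have "weight (\<lambda>v. v \<in> B) m \<le> monom_degree m" for m
    unfolding monom_degree_weight by (rule weight_mono) simp
  then show ?thesis by fastforce
qed

lemma card_monoms_on_Un:
  assumes AB: "A \<inter> B = {}" and fin: "\<And>i. finite (monoms_on A i)" "\<And>i. finite (monoms_on B i)"
  shows "finite {m. Poly_Mapping.keys m \<subseteq> A \<union> B \<and> monom_degree m = k \<and> c \<le> weight (\<lambda>v. v \<in> B) m}"
    and "card {m. Poly_Mapping.keys m \<subseteq> A \<union> B \<and> monom_degree m = k \<and> c \<le> weight (\<lambda>v. v \<in> B) m} =
      (\<Sum>e = c..k. card (monoms_on A (k - e)) * card (monoms_on B e))"
proof -
  note bij = bij_betw_monoms_on_Un[OF AB]
  have f: "finite {m. Poly_Mapping.keys m \<subseteq> A \<union> B \<and> monom_degree m = i + e \<and> weight (\<lambda>v. v \<in> B) m = e}" for i e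
    using bij_betw_finite[OF bij, of i e] fin by blast
  show "finite {m. Poly_Mapping.keys m \<subseteq> A \<union> B \<and> monom_degree m = k \<and> c \<le> weight (\<lambda>v. v \<in> B) m}"
    unfolding monoms_on_Un_partition using f by blast
  have "card {m. Poly_Mapping.keys m \<subseteq> A \<union> B \<and> monom_degree m = i + e \<and> weight (\<lambda>v. v \<in> B) m = e} =
      card (monoms_on A i) * card (monoms_on B e)" for i e
    using bij_betw_same_card[OF bij, of i e] by (simp add: card_cartesian_product)
  moreover have "card (\<Union>e \<in> {c..k}. {m. Poly_Mapping.keys m \<subseteq> A \<union> B \<and>
        monom_degree m = (k - e) + e \<and> weight (\<lambda>v. v \<in> B) m = e}) =
      (\<Sum>e = c..k. card {m. Poly_Mapping.keys m \<subseteq> A \<union> B \<and>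
        monom_degree m = (k - e) + e \<and> weight (\<lambda>v. v \<in> B) m = e})"
    using f by (intro card_UN_disjoint) blast+
  ultimately show "card {m. Poly_Mapping.keys m \<subseteq> A \<union> B \<and> monom_degree m = k \<and> c \<le> weight (\<lambda>v. v \<in> B) m} =
      (\<Sum>e = c..k. card (monoms_on A (k - e)) * card (monoms_on B e))"
    unfolding monoms_on_Un_partition by (simp only:)
qed

lemma monoms_on_singleton: "monoms_on {x} k = {Poly_Mapping.single x k}"
proof -
  have "m = Poly_Mapping.single x (monom_degree m)" if "Poly_Mapping.keys m \<subseteq> {x}" for m
  proof -
    have "m = Poly_Mapping.single x (Poly_Mapping.lookup m x)"
      using that by (intro poly_mapping_eqI) (auto simp: lookup_single when_def in_keys_iff subset_iff)
    then show ?thesis by (metis monom_degree_single)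
  qed
  then show ?thesis by (auto simp: monoms_on_def split: if_splits)
qed

text \<open>Stars and bars. Adjoining \<open>x\<close> sorts the monomials by the exponent of
  \<open>x\<close>, and the resulting sum over a diagonal of Pascal's triangle collapses.\<close>

lemma card_monoms_on:
  assumes "finite A" "A \<noteq> {}"
  shows "finite (monoms_on A k) \<and> card (monoms_on A k) = (card A - 1 + k) choose k"
  using assms
proof (induction A arbitrary: k rule: finite_ne_induct)
  case (singleton x)
  then show ?case by (simp add: monoms_on_singleton)
next
  case (insert x A)
  have d: "A \<inter> {x} = {}" using insert by simp
  have eq: "monoms_on (insert x A) k =
      {m. Poly_Mapping.keys m \<subseteq> A \<union> {x} \<and> monom_degree m = k \<and> 0 \<le> weight (\<lambda>v. v \<in> {x}) m}"
    by (auto simp: monoms_on_def)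
  have fin: "finite (monoms_on A i)" "finite (monoms_on {x} i)" for i
    using insert.IH by (auto simp: monoms_on_singleton)
  have "card (monoms_on (insert x A) k) = (\<Sum>e = 0..k. (card A - 1 + (k - e)) choose (k - e))"
    unfolding eq card_monoms_on_Un(2)[OF d fin] using insert.IH by (simp add: monoms_on_singleton)
  also have "\<dots> = (\<Sum>e\<le>k. (card A - 1 + e) choose e)"
    by (rule sum.reindex_bij_witness[of _ "\<lambda>e. k - e" "\<lambda>e. k - e"]) auto
  also have "\<dots> = (card A + k) choose k"
  proof -
    have "0 < card A" using insert by (simp add: card_gt_0_iff)
    then have "Suc (card A - 1 + k) = card A + k" by simp
    then show ?thesis unfolding sum_choose_lower by (rule arg_cong)
  qed
  finally have "card (monoms_on (insert x A) k) = (card A + k) choose k" .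
  moreover have "finite (monoms_on (insert x A) k)"
    unfolding eq by (rule card_monoms_on_Un(1)[OF d fin])
  ultimately show ?case using insert by simp
qed

text \<open>Division by \<open>y\<close> is a bijection that removes the requirement that
  \<open>y\<close> occur. With \<open>y\<close> the last indeterminate allowed, this turns counting
  by largest index into counting monomials of degree t - 1.\<close>

lemma card_monoms_with_factor:
  assumes "y \<in> A"
  shows "card {m. Poly_Mapping.keys m \<subseteq> A \<and> y \<in> Poly_Mapping.keys m \<and> P (m - Poly_Mapping.single y 1)} =
    card {m :: 'v monom. Poly_Mapping.keys m \<subseteq> A \<and> P m}"
proof -
  let ?y = "Poly_Mapping.single y 1 :: 'v monom"
  have "m - ?y + ?y = m" if "y \<in> Poly_Mapping.keys m" for m :: "'v monom"
    using single_add_minus[OF that] by (simp add: add.commute)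
  moreover have "Poly_Mapping.keys (m - ?y) \<subseteq> Poly_Mapping.keys m" for m
    by (auto simp: in_keys_iff lookup_minus)
  ultimately show ?thesis
    using assms
    by (intro bij_betw_same_card[OF bij_betw_byWitness[where f = "\<lambda>m. m - ?y" and f' = "\<lambda>m. m + ?y"]])
      (auto simp: keys_add_nat)
qed

section \<open>The ideal and its generators\<close>

text \<open>A monomial \<open>g\<close> of \<open>G\<close> is divisible by some element of any
  other monomial generating set, and that element by some \<open>g'\<close> of \<open>G\<close>.
  Equal degrees force all three to agree, so every monomial generating set contains
  \<open>G\<close>.\<close>

lemma min_monomial_gens_equal_degree:
  fixes V :: "'v set"
  assumes G: "G \<subseteq> {m. Poly_Mapping.keys m \<subseteq> V}" and deg: "\<And>m. m \<in> G \<Longrightarrow> monom_degree m = t"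
  shows "min_monomial_gens V (monomial_ideal V G :: ('v, 'k::field) mpoly set) = G"
proof -
  have G_sub: "G \<subseteq> M" if M: "M \<subseteq> {m. Poly_Mapping.keys m \<subseteq> V}"
    and eq: "genideal (poly_ring V) (monomial ` M) = (monomial_ideal V G :: ('v, 'k) mpoly set)" for M
  proof
    fix g assume g: "g \<in> G"
    have eq': "monomial_ideal V M = (monomial_ideal V G :: ('v, 'k) mpoly set)"
      using eq genideal_monomials[OF M, where 'k = 'k] by simp
    have "monomial g \<in> (monomial_ideal V G :: ('v, 'k) mpoly set)"
      using g G by (auto simp: monomial_ideal_def monomial_def poly_ring_carrier_iff intro!: exI[of _ 0])
    then have "monomial g \<in> (monomial_ideal V M :: ('v, 'k) mpoly set)" by (simp add: eq')
    then obtain m l where m: "m \<in> M" "g = m + l"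
      by (auto simp: monomial_ideal_def monomial_def)
    then have "monomial m \<in> (monomial_ideal V M :: ('v, 'k) mpoly set)"
      using M by (auto simp: monomial_ideal_def monomial_def poly_ring_carrier_iff intro!: exI[of _ 0])
    then have "monomial m \<in> (monomial_ideal V G :: ('v, 'k) mpoly set)" by (simp add: eq')
    then obtain g' l' where g': "g' \<in> G" "m = g' + l'"
      by (auto simp: monomial_ideal_def monomial_def)
    have "monom_degree l = 0"
      using deg[OF g] deg[OF g'(1)] m(2) g'(2) by (simp add: monom_degree_add)
    then show "g \<in> M" using m by (simp add: monom_degree_eq_0_iff)
  qed
  show ?thesis
    unfolding min_monomial_gens_def
  proof (rule the_equality)
    show "minimal_monomial_generating_set V (monomial_ideal V G :: ('v, 'k) mpoly set) G"
      unfolding minimal_monomial_generating_set_def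
    proof (intro conjI allI impI notI)
      show "G \<subseteq> {m. Poly_Mapping.keys m \<subseteq> V}" by (rule G)
      show "genideal (poly_ring V) (monomial ` G) = (monomial_ideal V G :: ('v, 'k) mpoly set)"
        by (rule genideal_monomials[OF G])
      fix M' assume M': "M' \<subset> G"
        and eq: "genideal (poly_ring V) (monomial ` M') = (monomial_ideal V G :: ('v, 'k) mpoly set)"
      have "M' \<subseteq> {m. Poly_Mapping.keys m \<subseteq> V}" using M' G by blast
      then have "G \<subseteq> M'" using eq by (rule G_sub)
      then show False using M' by blast
    qed
    fix M assume "minimal_monomial_generating_set V (monomial_ideal V G :: ('v, 'k) mpoly set) M"
    then have M: "M \<subseteq> {m. Poly_Mapping.keys m \<subseteq> V}"
      and eq: "genideal (poly_ring V) (monomial ` M) = (monomial_ideal V G :: ('v, 'k) mpoly set)"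
      and min: "\<And>M'. M' \<subset> M \<Longrightarrow>
        genideal (poly_ring V) (monomial ` M') \<noteq> (monomial_ideal V G :: ('v, 'k) mpoly set)"
      by (auto simp: minimal_monomial_generating_set_def)
    have "G \<subseteq> M" using M eq by (rule G_sub)
    moreover have "\<not> G \<subset> M" using min[of G] genideal_monomials[OF G] by blast
    ultimately show "M = G" by blast
  qed
qed

lemma weight_sum: "weight P (sum f S) = (\<Sum>i \<in> S. weight P (f i))"
  by (induction S rule: infinite_finite_induct) (auto simp: weight_add)

lemma monom_degree_sum: "monom_degree (sum f S) = (\<Sum>i \<in> S. monom_degree (f i))"
  by (simp add: monom_degree_weight weight_sum)

lemma keys_sum_nat:
  fixes f :: "'i \<Rightarrow> 'v monom"
  assumes "finite S"
  shows "Poly_Mapping.keys (sum f S) = (\<Union>i \<in> S. Poly_Mapping.keys (f i))"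
  using assms by (induction S rule: finite_induct) (auto simp: keys_add_nat)

lemma prod_var:
  "finite S \<Longrightarrow> (\<Prod>i \<in> S. var (p i)) = (monomial (\<Sum>i \<in> S. Poly_Mapping.single (p i) 1) :: ('v, 'k::field) mpoly)"
  by (induction S rule: finite_induct) (auto simp: var_def monomial_def mult_single)

lemma monomial_neq_0: "monomial m \<noteq> 0"
  by (metis keys_single keys_zero monomial_def singletonI empty_iff zero_neq_one)

lemma monom_as_sum_list:
  "\<exists>xs. length xs = monom_degree m \<and> m = sum_list (map (\<lambda>v. Poly_Mapping.single v 1) xs)"
proof (induction "monom_degree m" arbitrary: m)
  case 0
  then show ?case by (simp add: monom_degree_eq_0_iff)
next
  case (Suc k)
  then obtain v where v: "v \<in> Poly_Mapping.keys m"
    by (metis ex_in_conv keys_eq_empty monom_degree_zero nat.distinct(1))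
  let ?r = "m - Poly_Mapping.single v 1"
  have deg: "monom_degree m = Suc (monom_degree ?r)" by (rule monom_degree_minus_single[OF v])
  then obtain xs where "length xs = monom_degree ?r" "?r = sum_list (map (\<lambda>v. Poly_Mapping.single v 1) xs)"
    using Suc by (metis nat.inject)
  then show ?case
    using single_add_minus[OF v] deg by (intro exI[of _ "v # xs"]) auto
qed

text \<open>Writes a monomial as a product of variables, with multiplicity, in an order prescribed
  by \<open>w\<close>; the position of a variable will become its row in the matrix.\<close>

lemma monom_as_sorted_sum:
  fixes w :: "'v \<Rightarrow> nat"
  shows "\<exists>xs. length xs = monom_degree m \<and> sorted (map w xs) \<and>
     m = (\<Sum>i<length xs. Poly_Mapping.single (xs ! i) 1)"
proof -
  obtain xs where xs: "length xs = monom_degree m" "m = sum_list (map (\<lambda>v. Poly_Mapping.single v 1) xs)"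
    using monom_as_sum_list by blast
  let ?ys = "sort_key w xs"
  have "sum_list (map (\<lambda>v. Poly_Mapping.single v 1) ?ys) = m"
    unfolding xs(2) by (simp flip: sum_mset_sum_list)
  then have "m = (\<Sum>i<length ?ys. Poly_Mapping.single (?ys ! i) 1)"
    by (simp add: sum_list_sum_nth atLeast0LessThan)
  then show ?thesis using xs(1) by (intro exI[of _ ?ys]) simp
qed

section \<open>The generators of the ideal and their largest indices\<close>

abbreviation weight2 :: "(nat \<times> nat) monom \<Rightarrow> nat" where
  "weight2 \<equiv> weight (\<lambda>v. snd v = 2)"

text \<open>Origin of the bounds: if e factors come from the second block, then rows 1 to t - e use
  the first. A factor with first index i in row r sits in column i + r - 1, and t - e - r larger
  columns of that block follow, so i + t - e - 1 is at most n, that is i is at most d + e. In the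
  second block the same count over all t rows gives d.\<close>

definition J_gens :: "nat \<Rightarrow> nat \<Rightarrow> (nat \<times> nat) monom set" where
  "J_gens n t = {m. monom_degree m = t \<and>
     Poly_Mapping.keys m \<subseteq> {1..n - t + 1 + weight2 m} \<times> {1} \<union> {1..n - t + 1} \<times> {2}}"

text \<open>One occurrence of a variable of the first family costs one degree, so e is at most t - 1
  whenever the bound d + e matters. This is why the largest index never exceeds 2d + t - 1.\<close>

lemma weight2_less:
  assumes "v \<in> Poly_Mapping.keys m" "snd v \<noteq> 2"
  shows "weight2 m < monom_degree m"
proof -
  have "weight2 m \<le> (\<Sum>x \<in> Poly_Mapping.keys m - {v}. Poly_Mapping.lookup m x)"
  proof -
    have "weight2 m = (\<Sum>x \<in> Poly_Mapping.keys m - {v}. if snd x = 2 then Poly_Mapping.lookup m x else 0)"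
      unfolding weight_def using assms by (subst sum.remove[of _ v]) auto
    also have "\<dots> \<le> (\<Sum>x \<in> Poly_Mapping.keys m - {v}. Poly_Mapping.lookup m x)"
      by (rule sum_mono) simp
    finally show ?thesis .
  qed
  moreover have "monom_degree m = Poly_Mapping.lookup m v + (\<Sum>x \<in> Poly_Mapping.keys m - {v}. Poly_Mapping.lookup m x)"
    unfolding monom_degree_def using assms by (intro sum.remove) auto
  ultimately show ?thesis using assms by (simp add: in_keys_iff)
qed

context
  fixes n t :: nat
  assumes t: "1 \<le> t" "t \<le> n"
begin

private abbreviation (input) "d \<equiv> n - t + 1"

private abbreviation (input) "z \<equiv> z_var n t"

lemma inj_z_var: "inj z"
  unfolding inj_def z_var_def Let_def using t by (auto split: if_splits)

lemma z_var_image: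
  assumes "j < t"
  shows "z ` {1..2 * d + j} = {1..d + j} \<times> {1} \<union> {1..d} \<times> {2}"
proof
  show "z ` {1..2 * d + j} \<subseteq> {1..d + j} \<times> {1} \<union> {1..d} \<times> {2}"
    using assms t by (auto simp: z_var_def Let_def)
  show "{1..d + j} \<times> {1} \<union> {1..d} \<times> {2} \<subseteq> z ` {1..2 * d + j}"
  proof (rule subrelI)
    fix i c assume *: "(i, c) \<in> {1..d + j} \<times> {1} \<union> {1..d} \<times> {2 :: nat}"
    let ?k = "if c = 1 \<and> i \<le> d then i else i + d"
    have "(i, c) = z ?k"
      using * assms t by (auto simp: z_var_def Let_def)
    moreover have "?k \<in> {1..2 * d + j}" using * by auto
    ultimately show "(i, c) \<in> z ` {1..2 * d + j}" by (rule image_eqI)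
  qed
qed

lemma z_var_image_vars: "z ` {1..2 * n} = vars n"
proof
  show "z ` {1..2 * n} \<subseteq> vars n"
    using t by (auto simp: z_var_def Let_def vars_def)
  show "vars n \<subseteq> z ` {1..2 * n}"
  proof clarify
    fix i c assume *: "(i, c) \<in> vars n"
    let ?k = "if c = 1 \<and> i \<le> d then i else if c = 1 \<or> i \<le> d then i + d else i + n"
    have "(i, c) = z ?k"
      using * t by (auto simp: z_var_def Let_def vars_def)
    moreover have "?k \<in> {1..2 * n}"
      using * t by (auto simp: vars_def)
    ultimately show "(i, c) \<in> z ` {1..2 * n}" by (rule image_eqI)
  qed
qed

lemma J_gens_keys: "m \<in> J_gens n t \<Longrightarrow> Poly_Mapping.keys m \<subseteq> z ` {1..2 * d + (t - 1)}"
proof -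
  assume m: "m \<in> J_gens n t"
  have "(i, c) \<in> {1..d + (t - 1)} \<times> {1} \<union> {1..d} \<times> {2}" if v: "(i, c) \<in> Poly_Mapping.keys m" for i c
  proof (cases "c = 2")
    case True
    then show ?thesis using m v by (auto simp: J_gens_def)
  next
    case False
    then have "weight2 m < t" using weight2_less[OF v] m by (simp add: J_gens_def)
    moreover have "1 \<le> i" "i \<le> d + weight2 m" "c = 1" using m v False by (auto simp: J_gens_def)
    ultimately show ?thesis by auto
  qed
  then have "Poly_Mapping.keys m \<subseteq> {1..d + (t - 1)} \<times> {1} \<union> {1..d} \<times> {2}" by (rule subrelI)
  then show ?thesis using z_var_image[of "t - 1"] t by simp
qed

lemma J_gens_keys_vars: "m \<in> J_gens n t \<Longrightarrow> Poly_Mapping.keys m \<subseteq> vars n"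
proof -
  assume "m \<in> J_gens n t"
  then have "Poly_Mapping.keys m \<subseteq> z ` {1..2 * d + (t - 1)}" by (rule J_gens_keys)
  also have "\<dots> \<subseteq> z ` {1..2 * n}" using t by (intro image_mono) auto
  finally show ?thesis by (simp only: z_var_image_vars)
qed

text \<open>Among the first 2d + j indeterminates those of the first family stop at index d + j, so
  e at least j already implies the bound d + e. \<open>J_gens_weight2\<close> is the converse when
  the indeterminate numbered 2d + j occurs.\<close>

lemma J_gensI:
  assumes "monom_degree m = t" "j < t" "Poly_Mapping.keys m \<subseteq> z ` {1..2 * d + j}" "j \<le> weight2 m"
  shows "m \<in> J_gens n t"
proof -
  have "Poly_Mapping.keys m \<subseteq> {1..d + j} \<times> {1} \<union> {1..d} \<times> {2}"
    using assms(3) by (simp only: z_var_image[OF assms(2)])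
  also have "\<dots> \<subseteq> {1..d + weight2 m} \<times> {1} \<union> {1..d} \<times> {2}"
    using assms(4) by auto
  finally show ?thesis using assms(1) by (simp add: J_gens_def)
qed

lemma J_gens_weight2:
  assumes "m \<in> J_gens n t" "j < t" "z (2 * d + j) \<in> Poly_Mapping.keys m"
  shows "j \<le> weight2 m"
proof (cases "j = 0")
  case False
  then have "z (2 * d + j) = (d + j, 1)"
    using assms(2) t by (auto simp: z_var_def Let_def)
  then show ?thesis using assms by (auto simp: J_gens_def)
qed simp

text \<open>A nonzero product picks an actual variable in each row; the bounds on its index come
  from the columns that later rows still have to occupy.\<close>

lemma diagonal_product_J_gens:
  assumes c: "strict_mono_on {1..t} c" "c ` {1..t} \<subseteq> {1..2 * n}"
    and nz: "(\<Prod>r = 1..t. T_matrix n r (c r)) \<noteq> (0 :: (nat \<times> nat, 'k::field) mpoly)"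
  shows "(\<Prod>r = 1..t. T_matrix n r (c r)) \<in> (monomial ` J_gens n t :: (nat \<times> nat, 'k) mpoly set)"
proof -
  define p where "p r = (if c r \<le> n then (c r - r + 1, 1) else (c r - n - r + 1, 2 :: nat))" for r
  have T: "T_matrix n r (c r) = (var (p r) :: (nat \<times> nat, 'k) mpoly)"
    "if c r \<le> n then r \<le> c r else r \<le> c r - n" if "r \<in> {1..t}" for r
  proof -
    have "T_matrix n r (c r) \<noteq> (0 :: (nat \<times> nat, 'k) mpoly)"
      using nz that by (metis finite_atLeastAtMost prod_zero)
    then show "T_matrix n r (c r) = (var (p r) :: (nat \<times> nat, 'k) mpoly)"
      "if c r \<le> n then r \<le> c r else r \<le> c r - n"
      by (auto simp: T_matrix_def T_block_def p_def split: if_splits)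
  qed
  define m where "m = (\<Sum>r = 1..t. Poly_Mapping.single (p r) (1::nat))"
  have "(\<Prod>r = 1..t. T_matrix n r (c r)) = (\<Prod>r = 1..t. var (p r) :: (nat \<times> nat, 'k) mpoly)"
    using T by (intro prod.cong) auto
  also have "\<dots> = monomial m" unfolding m_def by (rule prod_var) simp
  finally have prod: "(\<Prod>r = 1..t. T_matrix n r (c r)) = (monomial m :: (nat \<times> nat, 'k) mpoly)" .
  have deg: "monom_degree m = t" by (simp add: m_def monom_degree_sum)
  have "weight2 m = (\<Sum>r = 1..t. if n < c r then 1 else 0)"
    unfolding m_def weight_sum by (intro sum.cong) (auto simp: p_def)
  then have w2: "weight2 m = card {r \<in> {1..t}. n < c r}"
    by (simp add: sum.If_cases Int_def)
  have gap: "c r + k \<le> c (r + k)" if "1 \<le> r" "r + k \<le> t" for r k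
    using that
  proof (induction k)
    case (Suc k)
    have "c (r + k) < c (r + Suc k)"
      using c(1) Suc.prems by (intro strict_mono_onD[OF c(1)]) auto
    then show ?case using Suc by simp
  qed simp
  \<comment> \<open>Let \<open>s\<close> be the last row meeting the first block. Then
    \<open>c r + (s - r)\<close> is at most \<open>c s\<close>, hence at most n. Since all such rows
    are among the first s, s is at least t minus the degree in the second family.\<close>
  have low: "c r - r + 1 \<le> d + weight2 m" if r: "r \<in> {1..t}" "c r \<le> n" for r
  proof -
    let ?R = "{r \<in> {1..t}. c r \<le> n}"
    define s where "s = Max ?R"
    have s: "s \<in> ?R" unfolding s_def by (rule Max_in) (use r in auto)
    have "r' \<le> s" if "r' \<in> ?R" for r' unfolding s_def by (rule Max_ge) (use that in auto)
    then have R: "?R \<subseteq> {1..s}" and rs: "r \<le> s" using r by auto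
    have "card ?R \<le> s" using card_mono[OF _ R] by simp
    moreover have "card ?R + weight2 m = t"
    proof -
      have "card ?R + card {r \<in> {1..t}. n < c r} = card (?R \<union> {r \<in> {1..t}. n < c r})"
        by (rule card_Un_disjoint[symmetric]) auto
      also have "?R \<union> {r \<in> {1..t}. n < c r} = {1..t}" by auto
      finally show ?thesis by (simp add: w2)
    qed
    moreover have "c r + (s - r) \<le> c s" using gap[of r "s - r"] r s rs by auto
    ultimately show ?thesis using s rs T(2)[OF r(1)] r t by auto
  qed
  \<comment> \<open>The t - r rows below r need that many larger columns, and the last one is at
    most 2n.\<close>
  have high: "c r - n - r + 1 \<le> d" if r: "r \<in> {1..t}" "n < c r" for r
  proof -
    have "c r + (t - r) \<le> c t" using gap[of r "t - r"] r by auto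
    moreover have "c t \<le> 2 * n"
    proof -
      have "c t \<in> c ` {1..t}" using t by simp
      then have "c t \<in> {1..2 * n}" using c(2) by blast
      then show ?thesis by simp
    qed
    ultimately show ?thesis using T(2)[OF r(1)] r t by auto
  qed
  have "Poly_Mapping.keys m = p ` {1..t}"
    unfolding m_def by (subst keys_sum_nat) auto
  then have "Poly_Mapping.keys m \<subseteq> {1..d + weight2 m} \<times> {1} \<union> {1..d} \<times> {2}"
    using low high by (auto simp: p_def)
  then have "m \<in> J_gens n t" using deg by (simp add: J_gens_def)
  then show ?thesis unfolding prod by (rule imageI)
qed

text \<open>Conversely, sort the variables of a generator so that those with second index 1 come first;
  the \<open>r\<close>-th variable then determines the column \<open>c r\<close>.\<close>

lemma J_gens_diagonal_product:
  assumes m: "m \<in> J_gens n t"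
  shows "\<exists>c. strict_mono_on {1..t} c \<and> c ` {1..t} \<subseteq> {1..2 * n} \<and>
    monomial m = (\<Prod>r = 1..t. T_matrix n r (c r) :: (nat \<times> nat, 'k::field) mpoly)"
proof -
  \<comment> \<open>\<open>w\<close> is the column of a variable in row 1. In row r the same
    variable stands r - 1 columns further right, so a weakly increasing \<open>w\<close> produces
    strictly increasing columns.\<close>
  define w where "w v = fst v + (if snd v = 2 then n else 0)" for v :: "nat \<times> nat"
  obtain xs where xs: "length xs = t" "sorted (map w xs)"
    and m_eq: "m = (\<Sum>i<t. Poly_Mapping.single (xs ! i) 1)"
    using monom_as_sorted_sum[of m w] m by (auto simp: J_gens_def)
  have keys: "xs ! i \<in> Poly_Mapping.keys m" if "i < t" for i
    unfolding m_eq using that by (subst keys_sum_nat) auto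
  have var: "1 \<le> fst (xs ! i) \<and> (snd (xs ! i) = 2 \<and> fst (xs ! i) \<le> d \<or>
      snd (xs ! i) = 1 \<and> fst (xs ! i) \<le> d + weight2 m)" if "i < t" for i
    using keys[OF that] m by (cases "xs ! i") (auto simp: J_gens_def)
  have w2: "weight2 m = card {i \<in> {..<t}. snd (xs ! i) = 2}"
    unfolding m_eq weight_sum by (simp add: sum.If_cases Int_def)
  have mono: "w (xs ! i) \<le> w (xs ! k)" if "i \<le> k" "k < t" for i k
    using sorted_nth_mono[OF xs(2), of i k] xs(1) that by simp
  \<comment> \<open>The shifted column must not leave the first block. All variables up to position
    i belong to the first family, so at most t - 1 - i belong to the second, and the bound d + e is
    at most n - i.\<close>
  have le_n: "fst (xs ! i) + i \<le> n" if i: "i < t" "snd (xs ! i) = 1" for i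
  proof -
    have "fst (xs ! i) \<le> n"
      using J_gens_keys_vars[OF m] keys[OF i(1)] by (auto simp: vars_def)
    then have "snd (xs ! k) \<noteq> 2" if "k \<le> i" for k
      using mono[OF that i(1)] i(2) var[of k] that i(1) by (auto simp: w_def)
    then have "{i \<in> {..<t}. snd (xs ! i) = 2} \<subseteq> {i<..<t}"
      by (auto simp: not_le[symmetric])
    then have "weight2 m \<le> card {i<..<t}"
      unfolding w2 by (intro card_mono) auto
    then show ?thesis using var[OF i(1)] i t by auto
  qed
  define c where "c r = w (xs ! (r - 1)) + r - 1" for r
  have "strict_mono_on {1..t} c"
  proof (rule strict_mono_onI)
    fix r s assume "r \<in> {1..t}" "s \<in> {1..t}" "r < s"
    moreover from this have "w (xs ! (r - 1)) \<le> w (xs ! (s - 1))" by (intro mono) auto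
    ultimately show "c r < c s" by (auto simp: c_def)
  qed
  moreover have "c r \<in> {1..2 * n} \<and>
      T_matrix n r (c r) = (var (xs ! (r - 1)) :: (nat \<times> nat, 'k) mpoly)" if r: "r \<in> {1..t}" for r
  proof -
    have i: "r - 1 < t" using r by auto
    obtain a b where ab: "xs ! (r - 1) = (a, b)" by fastforce
    show ?thesis
    proof (cases "b = 2")
      case True
      then have "1 \<le> a" "a \<le> d" using var[OF i] ab by auto
      moreover have "c r = a + n + r - 1" using ab True by (simp add: c_def w_def)
      ultimately show ?thesis using ab True r t by (auto simp: T_matrix_def T_block_def)
    next
      case False
      then have "1 \<le> a" "b = 1" using var[OF i] ab by auto
      moreover have "c r = a + r - 1" using ab False by (simp add: c_def w_def)
      moreover have "a + (r - 1) \<le> n" using le_n[OF i] ab \<open>b = 1\<close> by simp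
      ultimately show ?thesis using ab r by (auto simp: T_matrix_def T_block_def)
    qed
  qed
  moreover have "m = (\<Sum>r = 1..t. Poly_Mapping.single (xs ! (r - 1)) 1)"
    unfolding m_eq by (rule sum.reindex_bij_witness[of _ "\<lambda>r. r - 1" Suc]) auto
  then have "monomial m = (\<Prod>r = 1..t. var (xs ! (r - 1)) :: (nat \<times> nat, 'k) mpoly)"
    by (simp add: prod_var)
  ultimately show ?thesis by (intro exI[of _ c]) auto
qed

lemma diagonal_products_eq:
  "diagonal_products n t = (monomial ` J_gens n t :: (nat \<times> nat, 'k::field) mpoly set)"
proof
  show "diagonal_products n t \<subseteq> (monomial ` J_gens n t :: (nat \<times> nat, 'k) mpoly set)"
    unfolding diagonal_products_def using diagonal_product_J_gens by blast
  show "(monomial ` J_gens n t :: (nat \<times> nat, 'k) mpoly set) \<subseteq> diagonal_products n t"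
    unfolding diagonal_products_def using J_gens_diagonal_product monomial_neq_0 by fastforce
qed

lemma J_ideal_eq: "J_ideal n t = (monomial_ideal (vars n) (J_gens n t) :: (nat \<times> nat, 'k::field) mpoly set)"
  unfolding J_ideal_def diagonal_products_eq
  using J_gens_keys_vars by (intro genideal_monomials) blast

lemma min_monomial_gens_J: "min_monomial_gens (vars n) (J_ideal n t :: (nat \<times> nat, 'k::field) mpoly set) = J_gens n t"
  unfolding J_ideal_eq
  by (rule min_monomial_gens_equal_degree[of _ _ t]) (use J_gens_keys_vars in \<open>auto simp: J_gens_def\<close>)

lemma finite_J_gens: "finite (J_gens n t)"
proof -
  have "vars n \<noteq> {}" "finite (vars n)" using t by (auto simp: vars_def)
  then have "finite (monoms_on (vars n) t)" using card_monoms_on by blast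
  moreover have "J_gens n t \<subseteq> monoms_on (vars n) t"
    using J_gens_keys_vars by (auto simp: monoms_on_def J_gens_def)
  ultimately show ?thesis by (rule finite_subset[rotated])
qed

text \<open>If the largest index is at most 2d, every monomial of degree t in the first 2d
  indeterminates is a generator. If it is 2d + j with j > 0, the indeterminate removed belongs to
  the first family, so the exchange does not lower e, which stays at least j.\<close>

lemma stable_monomials_J_gens: "stable_monomials z (2 * n) t (J_gens n t)"
proof
  show "inj z" "1 \<le> t" "finite (J_gens n t)" by (fact inj_z_var t finite_J_gens)+
  fix u assume u: "u \<in> J_gens n t"
  show "Poly_Mapping.keys u \<subseteq> z ` {1..2 * n}"
    using J_gens_keys_vars[OF u] by (simp only: z_var_image_vars)
  show deg: "monom_degree u = t" using u by (simp add: J_gens_def)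
  fix l i
  assume l: "z l \<in> Poly_Mapping.keys u" and max: "\<And>j. z j \<in> Poly_Mapping.keys u \<Longrightarrow> j \<le> l"
    and i: "1 \<le> i" "i < l"
  let ?r = "u - Poly_Mapping.single (z l) 1"
  let ?m = "Poly_Mapping.single (z i) 1 + ?r"
  have deg_m: "monom_degree ?m = t"
    using deg monom_degree_minus_single[OF l] by (simp add: monom_degree_add)
  have "Poly_Mapping.keys u \<subseteq> z ` {1..l}"
    using J_gens_keys[OF u] max by auto
  moreover have "Poly_Mapping.keys ?r \<subseteq> Poly_Mapping.keys u"
    by (auto simp: in_keys_iff lookup_minus)
  ultimately have keys_m: "Poly_Mapping.keys ?m \<subseteq> z ` {1..l}"
    using i by (auto simp: keys_add_nat)
  have "z l \<in> z ` {1..2 * d + (t - 1)}" using J_gens_keys[OF u] l by blast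
  then have l_le: "l \<le> 2 * d + (t - 1)"
    by (simp only: inj_image_mem_iff[OF inj_z_var] atLeastAtMost_iff)
  show "?m \<in> J_gens n t"
  proof (cases "l \<le> 2 * d")
    case True
    then have "z ` {1..l} \<subseteq> z ` {1..2 * d + 0}" by (intro image_mono) auto
    with keys_m show ?thesis using t by (intro J_gensI[OF deg_m, of 0]) auto
  next
    case False
    define j where "j = l - 2 * d"
    have j: "l = 2 * d + j" "1 \<le> j" "j < t" using False l_le t by (auto simp: j_def)
    have "snd (z l) = 1" unfolding j(1) using j(2,3) t by (auto simp: z_var_def Let_def)
    then have "weight2 u = weight2 ?r"
      using arg_cong[OF single_add_minus[OF l], of weight2] by (simp add: weight_add)
    then have "weight2 u \<le> weight2 ?m" by (simp add: weight_add)
    moreover have "j \<le> weight2 u" using J_gens_weight2[OF u j(3)] l j(1) by simp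
    ultimately show ?thesis using keys_m j by (intro J_gensI[OF deg_m j(3)]) auto
  qed
qed

lemma largest_index_iff:
  assumes "m \<in> J_gens n t" "1 \<le> l" "l \<le> 2 * n"
  shows "largest_index n t m l \<longleftrightarrow> z l \<in> Poly_Mapping.keys m \<and> Poly_Mapping.keys m \<subseteq> z ` {1..l}"
proof
  assume *: "largest_index n t m l"
  then have "z l \<in> Poly_Mapping.keys m"
    by (simp add: largest_index_def in_keys_iff)
  moreover have "Poly_Mapping.keys m \<subseteq> z ` {1..l}"
  proof
    fix v assume v: "v \<in> Poly_Mapping.keys m"
    then obtain i where "v = z i" "i \<in> {1..2 * n}"
      using J_gens_keys_vars[OF assms(1)] z_var_image_vars by blast
    then show "v \<in> z ` {1..l}" using * v by (auto simp: largest_index_def in_keys_iff)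
  qed
  ultimately show "z l \<in> Poly_Mapping.keys m \<and> Poly_Mapping.keys m \<subseteq> z ` {1..l}" ..
next
  assume *: "z l \<in> Poly_Mapping.keys m \<and> Poly_Mapping.keys m \<subseteq> z ` {1..l}"
  have "i \<le> l" if "z i \<in> Poly_Mapping.keys m" for i
  proof -
    have "z i \<in> z ` {1..l}" using * that by blast
    then show ?thesis by (simp only: inj_image_mem_iff[OF inj_z_var] atLeastAtMost_iff)
  qed
  then show "largest_index n t m l"
    using * assms by (auto simp: largest_index_def in_keys_iff)
qed

lemma num_max_index_J:
  "num_max_index n t (J_ideal n t :: (nat \<times> nat, 'k::field) mpoly set) l =
     card {m \<in> J_gens n t. largest_index n t m l}"
  unfolding num_max_index_def min_monomial_gens_J ..

text \<open>Covers (a) with j = 0 and (b) with l = 2d + j at once. The conditions are put on the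
  quotient by \<open>z l\<close>; for j > 0 this indeterminate belongs to the first family, so the
  division leaves \<open>weight2\<close> unchanged.\<close>

lemma J_gens_largest_index_iff:
  assumes l: "1 \<le> l" "l \<le> 2 * d + j" "j < t" "j = 0 \<or> l = 2 * d + j"
  shows "m \<in> J_gens n t \<and> largest_index n t m l \<longleftrightarrow>
    Poly_Mapping.keys m \<subseteq> z ` {1..l} \<and> z l \<in> Poly_Mapping.keys m \<and>
    monom_degree (m - Poly_Mapping.single (z l) 1) = t - 1 \<and>
    j \<le> weight2 (m - Poly_Mapping.single (z l) 1)"
proof -
  let ?r = "m - Poly_Mapping.single (z l) 1"
  have l2: "l \<le> 2 * n" using l t by auto
  have deg: "monom_degree ?r = t - 1 \<longleftrightarrow> monom_degree m = t" if zl: "z l \<in> Poly_Mapping.keys m"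
  proof -
    show ?thesis using monom_degree_minus_single[OF zl] t by auto
  qed
  have w: "j \<le> weight2 ?r \<longleftrightarrow> j \<le> weight2 m" if zl: "z l \<in> Poly_Mapping.keys m"
  proof (cases "j = 0")
    case False
    then have "snd (z l) = 1" using l t by (auto simp: z_var_def Let_def)
    then show ?thesis
      using arg_cong[OF single_add_minus[OF zl], of weight2] by (simp add: weight_add)
  qed simp
  show ?thesis
  proof
    assume m: "m \<in> J_gens n t \<and> largest_index n t m l"
    then have k: "z l \<in> Poly_Mapping.keys m" "Poly_Mapping.keys m \<subseteq> z ` {1..l}"
      using largest_index_iff[OF _ l(1) l2] by auto
    have "j \<le> weight2 m"
      using J_gens_weight2[OF _ l(3), of m] m k(1) l(4) by auto
    then show "Poly_Mapping.keys m \<subseteq> z ` {1..l} \<and> z l \<in> Poly_Mapping.keys m \<and>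
        monom_degree ?r = t - 1 \<and> j \<le> weight2 ?r"
      using m k deg w by (auto simp: J_gens_def)
  next
    assume m: "Poly_Mapping.keys m \<subseteq> z ` {1..l} \<and> z l \<in> Poly_Mapping.keys m \<and>
        monom_degree ?r = t - 1 \<and> j \<le> weight2 ?r"
    have "z ` {1..l} \<subseteq> z ` {1..2 * d + j}" using l by (intro image_mono) auto
    then have "m \<in> J_gens n t" using m deg w by (intro J_gensI[OF _ l(3)]) auto
    then show "m \<in> J_gens n t \<and> largest_index n t m l"
      using m largest_index_iff[OF _ l(1) l2] by auto
  qed
qed

lemma num_max_index_eq:
  assumes l: "1 \<le> l" "l \<le> 2 * d + j" "j < t" "j = 0 \<or> l = 2 * d + j"
  shows "num_max_index n t (J_ideal n t :: (nat \<times> nat, 'k::field) mpoly set) l =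
     card {m. Poly_Mapping.keys m \<subseteq> z ` {1..l} \<and> monom_degree m = t - 1 \<and> j \<le> weight2 m}"
proof -
  have zl: "z l \<in> z ` {1..l}" using l by simp
  show ?thesis
    unfolding num_max_index_J J_gens_largest_index_iff[OF l]
    by (rule card_monoms_with_factor[OF zl, of "\<lambda>m. monom_degree m = t - 1 \<and> j \<le> weight2 m"])
qed

lemma num_max_index_low:
  assumes "l \<in> {1..2 * d}"
  shows "num_max_index n t (J_ideal n t :: (nat \<times> nat, 'k::field) mpoly set) l =
     (t + l - 2) choose (t - 1)"
proof -
  have "num_max_index n t (J_ideal n t :: (nat \<times> nat, 'k) mpoly set) l = card (monoms_on (z ` {1..l}) (t - 1))"
    using num_max_index_eq[of l 0, where 'k = 'k] assms t by (simp add: monoms_on_def)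
  also have "\<dots> = (card (z ` {1..l}) - 1 + (t - 1)) choose (t - 1)"
    using assms by (intro card_monoms_on[THEN conjunct2]) auto
  also have "card (z ` {1..l}) = l"
    using inj_z_var by (subst card_image) (auto intro: inj_on_subset)
  also have "l - 1 + (t - 1) = t + l - 2" using assms t by auto
  finally show ?thesis .
qed

text \<open>After division by the last indeterminate, monomials of degree t - 1 remain with degree e
  at least j in the second family. They are sorted by e, with d + j variables in the first family
  and d in the second; k = t - 1 - e gives the first sum of (b).\<close>

lemma num_max_index_high:
  assumes j: "1 \<le> j" "j < t"
  shows "num_max_index n t (J_ideal n t :: (nat \<times> nat, 'k::field) mpoly set) (2 * d + j) =
     (\<Sum>k\<le>t - j - 1. ((n - t + j + k) choose k) * ((n - 1 - k) choose (n - t)))"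
proof -
  let ?A = "{1..d + j} \<times> {1 :: nat}" and ?B = "{1..d} \<times> {2 :: nat}"
  have img: "z ` {1..2 * d + j} = ?A \<union> ?B" by (rule z_var_image[OF j(2)])
  have AB: "?A \<inter> ?B = {}" by auto
  have A: "finite (monoms_on ?A k)" "card (monoms_on ?A k) = (n - t + j + k) choose k"
    and B: "finite (monoms_on ?B k)" "card (monoms_on ?B k) = (n - t + k) choose k" for k
    using card_monoms_on[of ?A k] card_monoms_on[of ?B k] by (simp_all add: card_cartesian_product)
  have w: "weight2 m = weight (\<lambda>v. v \<in> ?B) m" if "Poly_Mapping.keys m \<subseteq> ?A \<union> ?B" for m
    unfolding weight_def using that by (intro sum.cong refl) auto
  have "num_max_index n t (J_ideal n t :: (nat \<times> nat, 'k) mpoly set) (2 * d + j) =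
      card {m. Poly_Mapping.keys m \<subseteq> ?A \<union> ?B \<and> monom_degree m = t - 1 \<and> j \<le> weight2 m}"
    using num_max_index_eq[of "2 * d + j" j, where 'k = 'k] j unfolding img by simp
  also have "{m. Poly_Mapping.keys m \<subseteq> ?A \<union> ?B \<and> monom_degree m = t - 1 \<and> j \<le> weight2 m} =
      {m. Poly_Mapping.keys m \<subseteq> ?A \<union> ?B \<and> monom_degree m = t - 1 \<and> j \<le> weight (\<lambda>v. v \<in> ?B) m}"
    using w by (intro Collect_cong) (metis (no_types, lifting))
  also have "card \<dots> = (\<Sum>e = j..t - 1. card (monoms_on ?A (t - 1 - e)) * card (monoms_on ?B e))"
    by (rule card_monoms_on_Un(2)[OF AB A(1) B(1)])
  also have "\<dots> = (\<Sum>e = j..t - 1. ((n - t + j + (t - 1 - e)) choose (t - 1 - e)) * ((n - t + e) choose e))"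
    by (simp only: A B)
  also have "\<dots> = (\<Sum>k\<le>t - j - 1. ((n - t + j + k) choose k) * ((n - 1 - k) choose (n - t)))"
  proof (rule sum.reindex_bij_witness[of _ "\<lambda>k. t - 1 - k" "\<lambda>e. t - 1 - e"])
    fix e assume e: "e \<in> {j..t - 1}"
    have "n - 1 - (t - 1 - e) = n - t + e" using e t by auto
    moreover have "(n - t + e) choose (n - t) = (n - t + e) choose e"
      by (subst binomial_symmetric) auto
    ultimately show "((n - t + j + (t - 1 - e)) choose (t - 1 - e)) * ((n - 1 - (t - 1 - e)) choose (n - t)) =
        ((n - t + j + (t - 1 - e)) choose (t - 1 - e)) * ((n - t + e) choose e)" by simp
  qed (use j in auto)
  finally show ?thesis .
qed

text \<open>The formula for stable ideals, with the generators grouped by largest index.\<close>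

lemma betti_J:
  "betti (vars n) (J_ideal n t :: (nat \<times> nat, 'k::field) mpoly set) q =
     (\<Sum>l = q + 1..2 * n - t + 1. ((l - 1) choose q) *
        num_max_index n t (J_ideal n t :: (nat \<times> nat, 'k) mpoly set) l)"
proof -
  interpret stable_monomials z "2 * n" t "J_gens n t" by (rule stable_monomials_J_gens)
  let ?J = "J_ideal n t :: (nat \<times> nat, 'k) mpoly set"
  let ?h = "\<lambda>l. ((l - 1) choose q) * num_max_index n t ?J l"
  have max: "max_index u = l \<longleftrightarrow> largest_index n t u l" if u: "u \<in> J_gens n t" and l: "l \<in> {1..2 * n}" for u l
  proof
    note m = max_index_in[OF u]
    have "Poly_Mapping.keys u \<subseteq> z ` {1..max_index u}"
      using keys_G[OF u] max_index_ge by fastforce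
    then have mm: "largest_index n t u (max_index u)"
      using largest_index_iff[OF u] m by auto
    show "max_index u = l" if "largest_index n t u l"
      using that mm by (auto simp: largest_index_def Let_def intro: antisym)
    show "largest_index n t u l" if "max_index u = l" using mm that by simp
  qed
  have range: "max_index u \<in> {1..2 * n - t + 1}" if u: "u \<in> J_gens n t" for u
  proof -
    have "z (max_index u) \<in> z ` {1..2 * d + (t - 1)}"
      using J_gens_keys[OF u] max_index_in[OF u] by blast
    then have "max_index u \<in> {1..2 * d + (t - 1)}"
      by (simp only: inj_image_mem_iff[OF inj_z_var])
    then show ?thesis using t by auto
  qed
  have "betti (vars n) ?J q = (\<Sum>u \<in> J_gens n t. (max_index u - 1) choose q)"
    unfolding J_ideal_eq z_var_image_vars[symmetric] by (rule betti_stable_ideal)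
  also have "\<dots> = (\<Sum>l = 1..2 * n - t + 1. \<Sum>u \<in> {u \<in> J_gens n t. max_index u = l}. (max_index u - 1) choose q)"
    using range by (intro sum.group[symmetric] finite_G) auto
  also have "\<dots> = (\<Sum>l = 1..2 * n - t + 1. ?h l)"
  proof (intro sum.cong refl)
    fix l assume "l \<in> {1..2 * n - t + 1}"
    then have "l \<in> {1..2 * n}" using t by auto
    then have "{u \<in> J_gens n t. max_index u = l} = {u \<in> J_gens n t. largest_index n t u l}"
      using max by blast
    then have "num_max_index n t ?J l = card {u \<in> J_gens n t. max_index u = l}"
      by (simp add: num_max_index_J)
    then show "(\<Sum>u \<in> {u \<in> J_gens n t. max_index u = l}. (max_index u - 1) choose q) = ?h l"
      by simp
  qed
  \<comment> \<open>The omitted terms have l - 1 < q, so their binomial coefficient is 0.\<close>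
  also have "\<dots> = (\<Sum>l = q + 1..2 * n - t + 1. ?h l)"
    by (intro sum.mono_neutral_right) (auto simp: binomial_eq_0)
  finally show ?thesis .
qed

end

theorem lemma3p3:
  fixes n t d :: nat
    and J :: "(nat \<times> nat, 'k::field) mpoly set"
    and \<nu> :: "nat \<Rightarrow> nat"
  assumes "1 \<le> t" and "t \<le> n"
    and "d = n - t + 1"
    and "J = J_ideal n t"
    and "\<nu> = num_max_index n t J"
  shows
    "(\<forall>l \<in> {1..2 * d}. \<nu> l = binom (int t + int l - 2) (int t - 1)) \<and>
     (\<forall>l \<in> {2 * d + 1..2 * d + t - 1}. \<forall>j. j = l - 2 * d \<longrightarrow>
        \<nu> l = (\<Sum>k = 0..t - j - 1.
                 binom (int n - int t + int j + int k) (int k) *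
                 binom (int n - int k - 1) (int n - int t)) \<and>
        \<nu> l = (\<Sum>\<tau> = 1..n - t + 1.
                 binom (int n + int \<tau> - 1) (int t - int j - 1) *
                 binom (int n - int t + int j - int \<tau>) (int j - 1)) \<and>
        \<nu> l = (\<Sum>\<tau> = 1..n - t + 1.
                 binom (int n) (int t - int j - int \<tau>) *
                 binom (int n - int t + int j) (int j + int \<tau> - 1))) \<and>
     (\<forall>q \<in> {0..2 * n - t + 1}.
        betti (vars n) J q =
          (\<Sum>l = q + 1..2 * n - t + 1. binom (int l - 1) (int q) * \<nu> l))"
proof (intro conjI ballI allI impI)
  note t = assms(1,2)
  fix l assume l: "l \<in> {1..2 * d}"
  have "binom (int t + int l - 2) (int t - 1) = (t + l - 2) choose (t - 1)"
    using l t by (intro binom_eqI) auto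
  then show "\<nu> l = binom (int t + int l - 2) (int t - 1)"
    using num_max_index_low[OF t, of l] l unfolding assms by simp
next
  note t = assms(1,2)
  fix l j assume "l \<in> {2 * d + 1..2 * d + t - 1}" "j = l - 2 * d"
  then have l: "l = 2 * (n - t + 1) + j" and j: "1 \<le> j" "j < t" using assms(3) by auto
  have \<nu>: "\<nu> l = (\<Sum>k\<le>t - j - 1. ((n - t + j + k) choose k) * ((n - 1 - k) choose (n - t)))"
    unfolding assms l by (rule num_max_index_high[OF t j])
  show "\<nu> l = (\<Sum>k = 0..t - j - 1. binom (int n - int t + int j + int k) (int k) *
      binom (int n - int k - 1) (int n - int t))"
    unfolding binom_sum_1[OF j t(2)] by (rule \<nu>)
  show "\<nu> l = (\<Sum>\<tau> = 1..n - t + 1. binom (int n + int \<tau> - 1) (int t - int j - 1) *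
      binom (int n - int t + int j - int \<tau>) (int j - 1))"
    unfolding binom_sum_2[OF j t(2)] by (rule \<nu>)
  show "\<nu> l = (\<Sum>\<tau> = 1..n - t + 1. binom (int n) (int t - int j - int \<tau>) *
      binom (int n - int t + int j) (int j + int \<tau> - 1))"
    unfolding binom_sum_3[OF j t(2)] by (rule \<nu>)
next
  fix q
  have "binom (int l - 1) (int q) = (l - 1) choose q" if "l \<in> {q + 1..2 * n - t + 1}" for l
    using that by (intro binom_eqI) auto
  then show "betti (vars n) J q =
      (\<Sum>l = q + 1..2 * n - t + 1. binom (int l - 1) (int q) * \<nu> l)"
    unfolding assms betti_J[OF assms(1,2)] by (intro sum.cong) auto
qed

end
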